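(* Let $T$ be NIP and $M\prec\mathcal U$ a small model. Then $\tilde F_M=F_M$; that is, for every global $M$-invariant Keisler measure $\mu$, $\tilde F_M(\mu)=F_M(\mu)$.
   Context: $L$ is a first-order language, $T$ a complete $L$-theory, $\mathcal U$ a monster model (a big saturated model) of $T$; small means small compared with $\mathcal U$. A Keisler measure over $A$ in variable $x$ is a finitely additive probability measure on the Boolean algebra of $L(A)$-formulas in $x$ modulo equivalence in $\mathcal U$; it is global if $A=\mathcal U$. $\mu_{|A}$ denotes restriction to $L(A)$-formulas. Types are identified with $\{0,1\}$-valued measures. A global measure $\mu$ is $M$-invariant if $\mu(\phi(x;b))=\mu(\phi(x;b'))$ whenever $\mathrm{tp}(b/M)=\mathrm{tp}(b'/M)$; it is finitely satisfiable in $M$ if every $\phi(x)\in L(\mathcal U)$ of positive measure is satisfied by a tuple of $M$. $A\prec^+B$ means that $B$ is a $(|A|+|T|)^+$-saturated elementary extension of $A$. For $M'\succ M$, $(M',M)$ is the expansion of $M'$ to $L_P=L\cup\{P\}$ with the unary predicate $P$ interpreted by $M$; for a tuple $x$, $P(x)$ means that all coordinates satisfy $P$. Throughout let $M\prec^+M'$ and $(M',M)\prec^+(N',N)$, and expand $\mathcal U$ to an elementary extension $(\mathcal U,P(\mathcal U))$ of $(N',N)$. Definition of $F_M$. For a global $M$-invariant type $p(x)$, by NIP $p_{|N}\cup\{P(x)\}$ implies (in the $L_P$-theory of $(N',N)$ with parameters) a complete $L$-type $q$ over $M'$, finitely satisfiable in $M$; $F_M(p)$ is the unique global $M$-invariant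 extension of $q$ (independent of choices). For a global $M$-invariant measure $\mu$, viewed as a regular Borel probability measure on $S_x(\mathcal U)$ (by NIP concentrated on the closed set of $M$-invariant types), $F_M(\mu)$ is the pushforward of $\mu$ by the continuous map $p\mapsto F_M(p)$, i.e. $F_M(\mu)(\phi)=\mu(\{p\ M\text{-invariant}:\phi\in F_M(p)\})$. Definition of $\tilde F_M$. Let $\Delta$ be the Boolean algebra generated by $L$-formulas and $P(x)$; a global $\Delta$-measure is a finitely additive probability measure on the Boolean algebra of $\Delta$-formulas in variable $x$ with parameters in $\mathcal U$. Let $\mu$ be a global $M$-invariant measure. Any two global $\Delta$-measures $\nu$ which extend $\mu_{|N}$ and satisfy $\nu(P(x))=1$ have the same restriction to $L(M')$-formulas. $\tilde F_M(\mu)$ is the unique global $M$-invariant Keisler measure whose restriction to $M'$ is this common restriction (it is independent of the choices of $M',N',N$, and finitely satisfiable in $M$). *)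

theory Defs
  imports "HOL-Probability.Probability"
begin

unbundle cardinal_syntax

section \<open>First-order languages, structures and formulas\<close>

text \<open>A language assigns an arity to each of its symbols; a symbol that is mapped to
  \<^term>\<open>None\<close> does not belong to the language.\<close>

record ('f, 'r) lang =
  farity :: "'f \<Rightarrow> nat option"
  rarity :: "'r \<Rightarrow> nat option"

record ('f, 'r, 'a) struct =
  univ :: "'a set"
  fint :: "'f \<Rightarrow> 'a list \<Rightarrow> 'a"
  rint :: "'r \<Rightarrow> 'a list \<Rightarrow> bool"

definition is_struct :: "('f, 'r) lang \<Rightarrow> ('f, 'r, 'a) struct \<Rightarrow> bool" where
  "is_struct L K \<longleftrightarrow> univ K \<noteq> {} \<and>
     (\<forall>f xs. farity L f = Some (length xs) \<longrightarrow> set xs \<subseteq> univ K \<longrightarrow> fint K f xs \<in> univ K)"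

text \<open>Formulas may mention elements of the structure directly (constructor \<open>Par\<close>); a formula
  over \<open>A\<close> is one whose parameters all lie in \<open>A\<close>.\<close>

datatype ('f, tpars: 'a) tm = Var nat | Par 'a | App 'f "('f, 'a) tm list"

datatype ('f, 'r, pars: 'a) fm =
    Bot
  | Equ "('f, 'a) tm" "('f, 'a) tm"
  | Rel 'r "('f, 'a) tm list"
  | Neg "('f, 'r, 'a) fm"
  | Conj "('f, 'r, 'a) fm" "('f, 'r, 'a) fm"
  | Exi nat "('f, 'r, 'a) fm"

definition Top :: "('f, 'r, 'a) fm" where
  "Top = Neg Bot"

definition Disj :: "('f, 'r, 'a) fm \<Rightarrow> ('f, 'r, 'a) fm \<Rightarrow> ('f, 'r, 'a) fm" where
  "Disj \<phi> \<psi> = Neg (Conj (Neg \<phi>) (Neg \<psi>))"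

primrec eval :: "('f, 'r, 'a) struct \<Rightarrow> (nat \<Rightarrow> 'a) \<Rightarrow> ('f, 'a) tm \<Rightarrow> 'a" where
  "eval K e (Var i) = e i"
| "eval K e (Par a) = a"
| "eval K e (App f ts) = fint K f (map (eval K e) ts)"

primrec sat :: "('f, 'r, 'a) struct \<Rightarrow> (nat \<Rightarrow> 'a) \<Rightarrow> ('f, 'r, 'a) fm \<Rightarrow> bool" where
  "sat K e Bot \<longleftrightarrow> False"
| "sat K e (Equ s t) \<longleftrightarrow> eval K e s = eval K e t"
| "sat K e (Rel r ts) \<longleftrightarrow> rint K r (map (eval K e) ts)"
| "sat K e (Neg \<phi>) \<longleftrightarrow> \<not> sat K e \<phi>"
| "sat K e (Conj \<phi> \<psi>) \<longleftrightarrow> sat K e \<phi> \<and> sat K e \<psi>"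
| "sat K e (Exi i \<phi>) \<longleftrightarrow> (\<exists>a\<in>univ K. sat K (e(i := a)) \<phi>)"

primrec tm_wf :: "('f, 'r) lang \<Rightarrow> ('f, 'a) tm \<Rightarrow> bool" where
  "tm_wf L (Var i) \<longleftrightarrow> True"
| "tm_wf L (Par a) \<longleftrightarrow> True"
| "tm_wf L (App f ts) \<longleftrightarrow> farity L f = Some (length ts) \<and> list_all (tm_wf L) ts"

primrec fm_wf :: "('f, 'r) lang \<Rightarrow> ('f, 'r, 'a) fm \<Rightarrow> bool" where
  "fm_wf L Bot \<longleftrightarrow> True"
| "fm_wf L (Equ s t) \<longleftrightarrow> tm_wf L s \<and> tm_wf L t"
| "fm_wf L (Rel r ts) \<longleftrightarrow> rarity L r = Some (length ts) \<and> list_all (tm_wf L) ts"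
| "fm_wf L (Neg \<phi>) \<longleftrightarrow> fm_wf L \<phi>"
| "fm_wf L (Conj \<phi> \<psi>) \<longleftrightarrow> fm_wf L \<phi> \<and> fm_wf L \<psi>"
| "fm_wf L (Exi i \<phi>) \<longleftrightarrow> fm_wf L \<phi>"

primrec tm_vars :: "('f, 'a) tm \<Rightarrow> nat set" where
  "tm_vars (Var i) = {i}"
| "tm_vars (Par a) = {}"
| "tm_vars (App f ts) = \<Union> (set (map tm_vars ts))"

primrec free_vars :: "('f, 'r, 'a) fm \<Rightarrow> nat set" where
  "free_vars Bot = {}"
| "free_vars (Equ s t) = tm_vars s \<union> tm_vars t"
| "free_vars (Rel r ts) = \<Union> (set (map tm_vars ts))"
| "free_vars (Neg \<phi>) = free_vars \<phi>"
| "free_vars (Conj \<phi> \<psi>) = free_vars \<phi> \<union> free_vars \<psi>"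
| "free_vars (Exi i \<phi>) = free_vars \<phi> - {i}"

text \<open>\<open>Fm L A n\<close> is the set of \<open>L(A)\<close>-formulas in the variable \<open>x = (v\<^sub>0, \<dots>, v\<^sub>n\<^sub>-\<^sub>1)\<close>;
  \<open>Fm L {} 0\<close> is the set of \<open>L\<close>-sentences. An \<open>L\<close>-formula \<open>\<phi>(x;y)\<close> with
  \<open>|x| = n\<close> and \<open>|y| = m\<close> is an element of \<open>Fm L {} (n + m)\<close>, with
  \<open>y = (v\<^sub>n, \<dots>, v\<^sub>n\<^sub>+\<^sub>m\<^sub>-\<^sub>1)\<close>.\<close>

definition Fm :: "('f, 'r) lang \<Rightarrow> 'a set \<Rightarrow> nat \<Rightarrow> ('f, 'r, 'a) fm set" where
  "Fm L A n = {\<phi>. fm_wf L \<phi> \<and> pars \<phi> \<subseteq> A \<and> free_vars \<phi> \<subseteq> {..<n}}"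

definition tuples :: "('f, 'r, 'a) struct \<Rightarrow> nat \<Rightarrow> 'a list set" where
  "tuples K n = {a. length a = n \<and> set a \<subseteq> univ K}"

text \<open>\<open>K \<Turnstile> \<phi>(a)\<close> for a tuple \<open>a\<close>. The values of the assignment beyond \<open>length a\<close> are
  irrelevant for \<open>\<phi> \<in> Fm L A (length a)\<close>.\<close>

definition holds :: "('f, 'r, 'a) struct \<Rightarrow> ('f, 'r, 'a) fm \<Rightarrow> 'a list \<Rightarrow> bool" where
  "holds K \<phi> a \<longleftrightarrow> sat K (\<lambda>i. a ! i) \<phi>"

primrec tm_subst :: "(nat \<Rightarrow> 'a option) \<Rightarrow> ('f, 'a) tm \<Rightarrow> ('f, 'a) tm" where
  "tm_subst \<sigma> (Var i) = (case \<sigma> i of None \<Rightarrow> Var i | Some a \<Rightarrow> Par a)"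
| "tm_subst \<sigma> (Par a) = Par a"
| "tm_subst \<sigma> (App f ts) = App f (map (tm_subst \<sigma>) ts)"

primrec fm_subst :: "('f, 'r, 'a) fm \<Rightarrow> (nat \<Rightarrow> 'a option) \<Rightarrow> ('f, 'r, 'a) fm" where
  "fm_subst Bot \<sigma> = Bot"
| "fm_subst (Equ s t) \<sigma> = Equ (tm_subst \<sigma> s) (tm_subst \<sigma> t)"
| "fm_subst (Rel r ts) \<sigma> = Rel r (map (tm_subst \<sigma>) ts)"
| "fm_subst (Neg \<phi>) \<sigma> = Neg (fm_subst \<phi> \<sigma>)"
| "fm_subst (Conj \<phi> \<psi>) \<sigma> = Conj (fm_subst \<phi> \<sigma>) (fm_subst \<psi> \<sigma>)"
| "fm_subst (Exi i \<phi>) \<sigma> = Exi i (fm_subst \<phi> (\<sigma>(i := None)))"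

text \<open>\<open>inst n \<phi> b\<close> is \<open>\<phi>(x;b)\<close>, where \<open>|x| = n\<close>; cf. \<open>holds_inst\<close>.\<close>

definition inst :: "nat \<Rightarrow> ('f, 'r, 'a) fm \<Rightarrow> 'a list \<Rightarrow> ('f, 'r, 'a) fm" where
  "inst n \<phi> b = fm_subst \<phi> (\<lambda>i. if n \<le> i \<and> i < n + length b then Some (b ! (i - n)) else None)"

lemma eval_tm_subst:
  "eval K e (tm_subst \<sigma> t) = eval K (\<lambda>i. case \<sigma> i of None \<Rightarrow> e i | Some a \<Rightarrow> a) t"
  by (induction t) (auto split: option.splits cong: map_cong)

lemma sat_fm_subst:
  "sat K e (fm_subst \<phi> \<sigma>) \<longleftrightarrow> sat K (\<lambda>i. case \<sigma> i of None \<Rightarrow> e i | Some a \<Rightarrow> a) \<phi>"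
proof (induction \<phi> arbitrary: e \<sigma>)
  case (Exi j \<phi>)
  have "(\<lambda>i. case (\<sigma>(j := None)) i of None \<Rightarrow> (e(j := a)) i | Some c \<Rightarrow> c)
      = (\<lambda>i. case \<sigma> i of None \<Rightarrow> e i | Some c \<Rightarrow> c)(j := a)" for a
    by (auto simp: fun_eq_iff split: option.splits)
  with Exi show ?case by simp
qed (simp_all add: eval_tm_subst comp_def)

lemma eval_cong:
  "(\<And>i. i \<in> tm_vars t \<Longrightarrow> e i = e' i) \<Longrightarrow> eval K e t = eval K e' t"
proof (induction t)
  case (App f ts)
  have "map (eval K e) ts = map (eval K e') ts"
    using App by (intro map_cong) auto
  then show ?case by (simp only: eval.simps)
qed auto

lemma sat_cong:
  "(\<And>i. i \<in> free_vars \<phi> \<Longrightarrow> e i = e' i) \<Longrightarrow> sat K e \<phi> \<longleftrightarrow> sat K e' \<phi>"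
proof (induction \<phi> arbitrary: e e')
  case (Equ s t)
  have "eval K e s = eval K e' s" "eval K e t = eval K e' t"
    by (rule eval_cong, use Equ in simp)+
  then show ?case by simp
next
  case (Rel r ts)
  have "map (eval K e) ts = map (eval K e') ts"
    using Rel by (intro map_cong eval_cong) auto
  then show ?case by (simp only: sat.simps)
next
  case (Conj \<phi> \<psi>)
  have "sat K e \<phi> = sat K e' \<phi>" "sat K e \<psi> = sat K e' \<psi>"
    by (rule Conj.IH, use Conj.prems in simp)+
  then show ?case by simp
next
  case (Exi j \<phi>)
  have "sat K (e(j := a)) \<phi> = sat K (e'(j := a)) \<phi>" for a
    by (rule Exi.IH, use Exi.prems in simp)
  then show ?case by simp
next
  case (Neg \<phi>)
  have "sat K e \<phi> = sat K e' \<phi>"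
    by (rule Neg.IH, use Neg.prems in simp)
  then show ?case by simp
qed simp

lemma holds_inst:
  assumes "\<phi> \<in> Fm L A (length a + length b)"
  shows "holds K (inst (length a) \<phi> b) a \<longleftrightarrow> holds K \<phi> (a @ b)"
  unfolding holds_def inst_def sat_fm_subst
  using assms by (intro sat_cong) (auto simp: Fm_def nth_append)


section \<open>Types, elementary extensions, saturation\<close>

definition tp :: "('f, 'r) lang \<Rightarrow> ('f, 'r, 'a) struct \<Rightarrow> 'a list \<Rightarrow> 'a set \<Rightarrow> ('f, 'r, 'a) fm set" where
  "tp L K b A = {\<phi> \<in> Fm L A (length b). holds K \<phi> b}"

text \<open>\<open>types L K A n\<close> is the space \<open>S\<^sub>x(A)\<close> of complete types over \<open>A\<close>, \<open>|x| = n\<close>,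
  with respect to the theory of \<open>K\<close> with parameters.\<close>

definition types :: "('f, 'r) lang \<Rightarrow> ('f, 'r, 'a) struct \<Rightarrow> 'a set \<Rightarrow> nat \<Rightarrow> ('f, 'r, 'a) fm set set" where
  "types L K A n = {p. p \<subseteq> Fm L A n
     \<and> (\<forall>F. finite F \<longrightarrow> F \<subseteq> p \<longrightarrow> (\<exists>a\<in>tuples K n. \<forall>\<phi>\<in>F. holds K \<phi> a))
     \<and> (\<forall>\<phi>\<in>Fm L A n. \<phi> \<in> p \<or> Neg \<phi> \<in> p)}"

definition elem_sub :: "('f, 'r) lang \<Rightarrow> ('f, 'r, 'a) struct \<Rightarrow> ('f, 'r, 'a) struct \<Rightarrow> bool" where
  "elem_sub L A B \<longleftrightarrow> is_struct L A \<and> is_struct L B \<and> univ A \<subseteq> univ B \<and>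
     (\<forall>n. \<forall>\<phi>\<in>Fm L {} n. \<forall>a\<in>tuples A n. holds A \<phi> a \<longleftrightarrow> holds B \<phi> a)"

definition saturated :: "('f, 'r) lang \<Rightarrow> ('f, 'r, 'a) struct \<Rightarrow> 'k rel \<Rightarrow> bool" where
  "saturated L K \<kappa> \<longleftrightarrow>
     (\<forall>A\<subseteq>univ K. |A| <o \<kappa> \<longrightarrow> (\<forall>n. \<forall>p\<in>types L K A n. \<exists>a\<in>tuples K n. \<forall>\<phi>\<in>p. holds K \<phi> a))"

text \<open>A complete theory is taken to be deductively closed, so that its cardinality as a set is
  the usual \<open>|T| = |L| + \<aleph>\<^sub>0\<close>. Consistency is not part of the definition; it follows from
  the existence of a model.\<close>

definition complete_theory :: "('f, 'r) lang \<Rightarrow> ('f, 'r, 'a) fm set \<Rightarrow> bool" where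
  "complete_theory L T \<longleftrightarrow> T \<subseteq> Fm L {} 0 \<and> (\<forall>\<sigma>\<in>Fm L {} 0. \<sigma> \<in> T \<or> Neg \<sigma> \<in> T)"

definition model :: "('f, 'r) lang \<Rightarrow> ('f, 'r, 'a) fm set \<Rightarrow> ('f, 'r, 'a) struct \<Rightarrow> bool" where
  "model L T K \<longleftrightarrow> is_struct L K \<and> (\<forall>\<sigma>\<in>T. holds K \<sigma> [])"

definition monster :: "('f, 'r) lang \<Rightarrow> ('f, 'r, 'a) fm set \<Rightarrow> ('f, 'r, 'a) struct \<Rightarrow> bool" where
  "monster L T U \<longleftrightarrow> model L T U \<and> |T| <o |univ U| \<and> saturated L U |univ U|"

definition small :: "('f, 'r, 'a) struct \<Rightarrow> 'a set \<Rightarrow> bool" where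
  "small U A \<longleftrightarrow> A \<subseteq> univ U \<and> |A| <o |univ U|"

text \<open>The relation \<open>A \<prec>\<^sup>+ B\<close>. The language is a separate argument because the relation is
  also used for \<open>L\<^sub>P\<close>-structures; the cardinal \<open>|T|\<close> is the same for both languages.\<close>

definition elem_sub_plus ::
  "('f, 'r) lang \<Rightarrow> 't set \<Rightarrow> ('f, 'r, 'a) struct \<Rightarrow> ('f, 'r, 'a) struct \<Rightarrow> bool" where
  "elem_sub_plus L T A B \<longleftrightarrow> elem_sub L A B \<and> saturated L B (cardSuc ( |univ A| +c |T| ))"

text \<open>\<open>\<phi>(x;y)\<close> is NIP if, for some \<open>k\<close>, it shatters no family of \<open>k\<close> tuples.\<close>

definition NIP_formula :: "('f, 'r, 'a) struct \<Rightarrow> nat \<Rightarrow> nat \<Rightarrow> ('f, 'r, 'a) fm \<Rightarrow> bool" where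
  "NIP_formula U n m \<phi> \<longleftrightarrow>
     (\<exists>k::nat. \<not> (\<exists>a. (\<forall>i<k. a i \<in> tuples U n) \<and>
        (\<forall>I\<subseteq>{..<k}. \<exists>b\<in>tuples U m. \<forall>i<k. holds U \<phi> (a i @ b) \<longleftrightarrow> i \<in> I)))"

text \<open>NIP of a complete theory, read off in one of its models; it does not depend on the model.\<close>

definition NIP :: "('f, 'r) lang \<Rightarrow> ('f, 'r, 'a) struct \<Rightarrow> bool" where
  "NIP L U \<longleftrightarrow> (\<forall>n m. \<forall>\<phi>\<in>Fm L {} (n + m). NIP_formula U n m \<phi>)"


section \<open>Pairs\<close>

text \<open>The language \<open>L\<^sub>P\<close> has relation symbols of type \<^typ>\<open>'r option\<close>, with
  \<^term>\<open>None\<close> in the role of \<open>P\<close>.\<close>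

definition LP :: "('f, 'r) lang \<Rightarrow> ('f, 'r option) lang" where
  "LP L = \<lparr>farity = farity L, rarity = (\<lambda>r. case r of None \<Rightarrow> Some 1 | Some r' \<Rightarrow> rarity L r')\<rparr>"

definition pair :: "('f, 'r, 'a) struct \<Rightarrow> 'a set \<Rightarrow> ('f, 'r option, 'a) struct" where
  "pair K Q = \<lparr>univ = univ K, fint = fint K,
     rint = (\<lambda>r xs. case r of None \<Rightarrow> (\<exists>a\<in>Q. xs = [a]) | Some r' \<Rightarrow> rint K r' xs)\<rparr>"

definition lift :: "('f, 'r, 'a) fm \<Rightarrow> ('f, 'r option, 'a) fm" where
  "lift = map_fm id Some id"

text \<open>\<open>P(x)\<close>, \<open>|x| = n\<close>: all coordinates of the tuple satisfy \<open>P\<close>.\<close>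

definition Pfm :: "nat \<Rightarrow> ('f, 'r option, 'a) fm" where
  "Pfm n = foldr (\<lambda>i. Conj (Rel None [Var i])) [0..<n] Top"

text \<open>In \<open>\<Delta>\<close>-formulas the predicate is applied to the whole tuple \<open>x\<close> only.\<close>

inductive_set Delta :: "('f, 'r) lang \<Rightarrow> 'a set \<Rightarrow> nat \<Rightarrow> ('f, 'r option, 'a) fm set"
  for L :: "('f, 'r) lang" and A :: "'a set" and n :: nat where
  "\<phi> \<in> Fm L A n \<Longrightarrow> lift \<phi> \<in> Delta L A n"
| "Pfm n \<in> Delta L A n"
| "\<phi> \<in> Delta L A n \<Longrightarrow> Neg \<phi> \<in> Delta L A n"
| "\<phi> \<in> Delta L A n \<Longrightarrow> \<psi> \<in> Delta L A n \<Longrightarrow> Conj \<phi> \<psi> \<in> Delta L A n"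


section \<open>Keisler measures\<close>

text \<open>Finitely additive probability measures on the Boolean algebra formed by a set \<open>D\<close> of
  formulas in \<open>x\<close> (closed under Boolean combinations) modulo equivalence in \<open>K\<close>. They are
  functions on the formulas themselves, compatible with equivalence in \<open>K\<close>, and
  \<^term>\<open>undefined\<close> outside \<open>D\<close> so that equality of measures is equality of functions.\<close>

definition fa_prob ::
  "('f, 'r, 'a) struct \<Rightarrow> nat \<Rightarrow> ('f, 'r, 'a) fm set \<Rightarrow> (('f, 'r, 'a) fm \<Rightarrow> real) \<Rightarrow> bool" where
  "fa_prob K n D \<mu> \<longleftrightarrow>
     \<mu> \<in> extensional D \<and>
     (\<forall>\<phi>\<in>D. \<forall>\<psi>\<in>D. (\<forall>a\<in>tuples K n. holds K \<phi> a \<longleftrightarrow> holds K \<psi> a) \<longrightarrow> \<mu> \<phi> = \<mu> \<psi>) \<and>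
     (\<forall>\<phi>\<in>D. 0 \<le> \<mu> \<phi>) \<and>
     (\<forall>\<phi>\<in>D. (\<forall>a\<in>tuples K n. holds K \<phi> a) \<longrightarrow> \<mu> \<phi> = 1) \<and>
     (\<forall>\<phi>\<in>D. \<forall>\<psi>\<in>D. (\<forall>a\<in>tuples K n. \<not> (holds K \<phi> a \<and> holds K \<psi> a))
        \<longrightarrow> \<mu> (Disj \<phi> \<psi>) = \<mu> \<phi> + \<mu> \<psi>)"

definition keisler ::
  "('f, 'r) lang \<Rightarrow> ('f, 'r, 'a) struct \<Rightarrow> 'a set \<Rightarrow> nat \<Rightarrow> (('f, 'r, 'a) fm \<Rightarrow> real) \<Rightarrow> bool" where
  "keisler L U A n \<mu> \<longleftrightarrow> fa_prob U n (Fm L A n) \<mu>"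

text \<open>\<open>A\<close>-invariance of a function on global formulas in \<open>x\<close>, \<open>|x| = n\<close>: of a measure, or of
  the membership predicate of a type.\<close>

definition invariant ::
  "('f, 'r) lang \<Rightarrow> ('f, 'r, 'a) struct \<Rightarrow> 'a set \<Rightarrow> nat \<Rightarrow> (('f, 'r, 'a) fm \<Rightarrow> 'v) \<Rightarrow> bool" where
  "invariant L U A n \<mu> \<longleftrightarrow>
     (\<forall>m. \<forall>\<phi>\<in>Fm L {} (n + m). \<forall>b\<in>tuples U m. \<forall>b'\<in>tuples U m.
        tp L U b A = tp L U b' A \<longrightarrow> \<mu> (inst n \<phi> b) = \<mu> (inst n \<phi> b'))"

definition inv_types ::
  "('f, 'r) lang \<Rightarrow> ('f, 'r, 'a) struct \<Rightarrow> 'a set \<Rightarrow> nat \<Rightarrow> ('f, 'r, 'a) fm set set" where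
  "inv_types L U A n = {p \<in> types L U (univ U) n. invariant L U A n (\<lambda>\<phi>. \<phi> \<in> p)}"


section \<open>The map \<open>F\<^sub>M\<close>\<close>

text \<open>\<open>\<Sigma>(x)\<close> implies \<open>\<phi>(x)\<close> in the theory of \<open>K\<close> with parameters: for some finite
  \<open>\<Sigma>\<^sub>0 \<subseteq> \<Sigma>\<close> the sentence \<open>\<forall>x (\<And>\<Sigma>\<^sub>0 \<rightarrow> \<phi>)\<close> belongs to that (complete) theory.\<close>

definition implies ::
  "('f, 'r, 'a) struct \<Rightarrow> nat \<Rightarrow> ('f, 'r, 'a) fm set \<Rightarrow> ('f, 'r, 'a) fm \<Rightarrow> bool" where
  "implies K n \<Sigma> \<phi> \<longleftrightarrow>
     (\<exists>\<Sigma>\<^sub>0\<subseteq>\<Sigma>. finite \<Sigma>\<^sub>0 \<and> (\<forall>a\<in>tuples K n. (\<forall>\<theta>\<in>\<Sigma>\<^sub>0. holds K \<theta> a) \<longrightarrow> holds K \<phi> a))"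

text \<open>The type \<open>q\<close> over \<open>M'\<close> implied by \<open>p\<^sub>|\<^sub>N \<union> {P(x)}\<close>.\<close>

definition FM_base ::
  "('f, 'r) lang \<Rightarrow> ('f, 'r, 'a) struct \<Rightarrow> ('f, 'r, 'a) struct \<Rightarrow> 'a set \<Rightarrow> nat
    \<Rightarrow> ('f, 'r, 'a) fm set \<Rightarrow> ('f, 'r, 'a) fm set" where
  "FM_base L M' N' N n p =
     {\<phi> \<in> Fm L (univ M') n. implies (pair N' N) n (lift ` (p \<inter> Fm L N n) \<union> {Pfm n}) (lift \<phi>)}"

definition FM_type ::
  "('f, 'r) lang \<Rightarrow> ('f, 'r, 'a) struct \<Rightarrow> ('f, 'r, 'a) struct \<Rightarrow> ('f, 'r, 'a) struct
    \<Rightarrow> ('f, 'r, 'a) struct \<Rightarrow> 'a set \<Rightarrow> nat \<Rightarrow> ('f, 'r, 'a) fm set \<Rightarrow> ('f, 'r, 'a) fm set" where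
  "FM_type L U M M' N' N n p =
     (THE r. r \<in> inv_types L U (univ M) n \<and> FM_base L M' N' N n p \<subseteq> r)"

definition type_space ::
  "('f, 'r) lang \<Rightarrow> ('f, 'r, 'a) struct \<Rightarrow> nat \<Rightarrow> ('f, 'r, 'a) fm set topology" where
  "type_space L U n =
     topology_generated_by ((\<lambda>\<phi>. {p \<in> types L U (univ U) n. \<phi> \<in> p}) ` Fm L (univ U) n)"

definition regular_borel_prob :: "'b topology \<Rightarrow> 'b measure \<Rightarrow> bool" where
  "regular_borel_prob X \<nu> \<longleftrightarrow>
     prob_space \<nu> \<and> space \<nu> = topspace X \<and> sets \<nu> = sigma_sets (topspace X) {V. openin X V} \<and>
     (\<forall>B\<in>sets \<nu>. emeasure \<nu> B = (SUP C\<in>{C. C \<subseteq> B \<and> compactin X C}. emeasure \<nu> C)) \<and>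
     (\<forall>B\<in>sets \<nu>. emeasure \<nu> B = (INF V\<in>{V. B \<subseteq> V \<and> openin X V}. emeasure \<nu> V))"

definition borel_extension ::
  "('f, 'r) lang \<Rightarrow> ('f, 'r, 'a) struct \<Rightarrow> nat \<Rightarrow> (('f, 'r, 'a) fm \<Rightarrow> real)
    \<Rightarrow> ('f, 'r, 'a) fm set measure" where
  "borel_extension L U n \<mu> =
     (THE \<nu>. regular_borel_prob (type_space L U n) \<nu> \<and>
        (\<forall>\<phi>\<in>Fm L (univ U) n. measure \<nu> {p \<in> types L U (univ U) n. \<phi> \<in> p} = \<mu> \<phi>))"

definition FM ::
  "('f, 'r) lang \<Rightarrow> ('f, 'r, 'a) struct \<Rightarrow> ('f, 'r, 'a) struct \<Rightarrow> ('f, 'r, 'a) struct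
    \<Rightarrow> ('f, 'r, 'a) struct \<Rightarrow> 'a set \<Rightarrow> nat
    \<Rightarrow> (('f, 'r, 'a) fm \<Rightarrow> real) \<Rightarrow> (('f, 'r, 'a) fm \<Rightarrow> real)" where
  "FM L U M M' N' N n \<mu> =
     (\<lambda>\<phi>\<in>Fm L (univ U) n.
        measure (borel_extension L U n \<mu>)
          {p \<in> inv_types L U (univ M) n. \<phi> \<in> FM_type L U M M' N' N n p})"


section \<open>The map \<open>F\<^sub>M\<close> with a tilde\<close>

definition delta_extensions ::
  "('f, 'r) lang \<Rightarrow> ('f, 'r, 'a) struct \<Rightarrow> 'a set \<Rightarrow> 'a set \<Rightarrow> nat
    \<Rightarrow> (('f, 'r, 'a) fm \<Rightarrow> real) \<Rightarrow> (('f, 'r option, 'a) fm \<Rightarrow> real) set" where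
  "delta_extensions L U PU N n \<mu> =
     {\<nu>. fa_prob (pair U PU) n (Delta L (univ U) n) \<nu> \<and>
         (\<forall>\<phi>\<in>Fm L N n. \<nu> (lift \<phi>) = \<mu> \<phi>) \<and> \<nu> (Pfm n) = 1}"

text \<open>\<^const>\<open>the_elem\<close> picks the common restriction to \<open>L(M')\<close>-formulas of these measures.\<close>

definition FMt ::
  "('f, 'r) lang \<Rightarrow> ('f, 'r, 'a) struct \<Rightarrow> ('f, 'r, 'a) struct \<Rightarrow> ('f, 'r, 'a) struct
    \<Rightarrow> 'a set \<Rightarrow> 'a set \<Rightarrow> nat
    \<Rightarrow> (('f, 'r, 'a) fm \<Rightarrow> real) \<Rightarrow> (('f, 'r, 'a) fm \<Rightarrow> real)" where
  "FMt L U M M' N PU n \<mu> =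
     (THE \<kappa>. keisler L U (univ U) n \<kappa> \<and> invariant L U (univ M) n \<kappa> \<and>
        restrict \<kappa> (Fm L (univ M') n) =
          the_elem ((\<lambda>\<nu>. \<lambda>\<phi>\<in>Fm L (univ M') n. \<nu> (lift \<phi>)) ` delta_extensions L U PU N n \<mu>))"

end

theory Submission
  imports Defs
begin

text \<open>
  Why the two maps agree. Let \<open>p\<close> be an \<open>M\<close>-invariant type and \<open>\<phi>\<close> a formula over \<open>M'\<close>. By
  compactness, \<open>\<phi> \<in> F\<^sub>M(p)\<close> has a single reason: some \<open>\<theta> \<in> p\<^sub>|\<^sub>N\<close> with
  \<open>\<theta>(x) \<and> P(x) \<rightarrow> \<phi>(x)\<close> (\<open>FM_base_iff\<close>). So the set of invariant \<open>p\<close> with \<open>\<phi> \<in> F\<^sub>M(p)\<close> is the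
  trace on the invariant types of the open set \<open>\<Union>[\<theta>]\<close>, the union over all such \<open>\<theta>\<close>. A
  \<open>\<Delta>\<close>-measure \<open>\<eta>\<close> that extends \<open>\<mu>\<^sub>|\<^sub>N\<close> and gives \<open>P(x)\<close> measure \<open>1\<close> satisfies
  \<open>\<mu>(\<theta>) = \<eta>(\<theta>) \<le> \<eta>(\<phi>)\<close> for each of them. The family of these \<open>\<theta>\<close> is closed under disjunction, so
  by regularity the whole union has measure at most \<open>\<eta>(\<phi>)\<close>, that is, \<open>F\<^sub>M(\<mu>)(\<phi>) \<le> \<eta>(\<phi>)\<close>
  (\<open>FM_le_delta\<close>). The same inequality for \<open>\<not>\<phi>\<close> turns this into an equality. Hence \<open>F\<^sub>M(\<mu>)\<close> is an
  \<open>M\<close>-invariant Keisler measure whose restriction to \<open>M'\<close> is the one prescribed for the other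
  construction, and there is only one such measure, because \<open>M'\<close> realises all types over \<open>M\<close>
  (\<open>invariant_measure_unique\<close>).

  What this argument rests on has to be established first, and NIP enters twice.

  For types: \<open>p\<^sub>|\<^sub>N \<union> {P(x)}\<close> decides every formula over \<open>M'\<close> (\<open>FM_base_decides\<close>). Otherwise the
  saturation of the pair gives a Morley sequence of \<open>p\<close> along which \<open>\<phi>\<close> alternates, and
  indiscernibility turns a long alternation into a large shattered set (\<open>NIP_morley_alternation\<close>).
  The type obtained is finitely satisfiable in \<open>M\<close>, hence extends to a global invariant type.

  For measures: an invariant \<open>\<mu>\<close> lives on the invariant types (\<open>Inv_full\<close>). If \<open>b\<close> and \<open>b'\<close> have the
  same type over \<open>M\<close>, then \<open>\<phi>(x;b) \<and> \<not> \<phi>(x;b')\<close> is null: both tuples are first terms of Morley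
  sequences with the same continuation, and if consecutive terms differed with probability
  \<open>\<epsilon> > 0\<close>, then averaging would produce one \<open>x\<close> with many alternations.

  Two further ingredients are measure theoretic. The regular Borel extension of a finitely additive
  measure from clopen sets to a compact space is built as a Caratheodory measure: on open sets it is
  the supremum over clopen subsets, on arbitrary sets the infimum over open supersets
  (\<open>regular_extension\<close>). And a \<open>\<Delta>\<close>-extension of \<open>\<mu>\<^sub>|\<^sub>N\<close> exists (\<open>delta_extensions_nonempty\<close>),
  because finitely many values at a time can be realised by a charge on the points of \<open>P\<close> and
  the space of charges is compact.
\<close>

section \<open>Renaming variables and abstracting parameters\<close>

text \<open>All variables, bound ones included, are renamed by \<open>f\<close>, and each parameter is replaced by a
  term. No variable is captured if \<open>f\<close> is injective and its range avoids the variables of these terms.\<close>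

primrec tm_ren :: "(nat \<Rightarrow> nat) \<Rightarrow> ('a \<Rightarrow> ('f, 'a) tm) \<Rightarrow> ('f, 'a) tm \<Rightarrow> ('f, 'a) tm" where
  "tm_ren f g (Var i) = Var (f i)"
| "tm_ren f g (Par a) = g a"
| "tm_ren f g (App h ts) = App h (map (tm_ren f g) ts)"

primrec fm_ren :: "(nat \<Rightarrow> nat) \<Rightarrow> ('a \<Rightarrow> ('f, 'a) tm) \<Rightarrow> ('f, 'r, 'a) fm \<Rightarrow> ('f, 'r, 'a) fm" where
  "fm_ren f g Bot = Bot"
| "fm_ren f g (Equ s t) = Equ (tm_ren f g s) (tm_ren f g t)"
| "fm_ren f g (Rel r ts) = Rel r (map (tm_ren f g) ts)"
| "fm_ren f g (Neg \<phi>) = Neg (fm_ren f g \<phi>)"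
| "fm_ren f g (Conj \<phi> \<psi>) = Conj (fm_ren f g \<phi>) (fm_ren f g \<psi>)"
| "fm_ren f g (Exi i \<phi>) = Exi (f i) (fm_ren f g \<phi>)"

lemma eval_tm_ren:
  "(\<And>a. a \<in> tpars t \<Longrightarrow> eval K e (g a) = a) \<Longrightarrow> eval K e (tm_ren f g t) = eval K (e \<circ> f) t"
proof (induction t)
  case (App h ts)
  have "map (eval K e \<circ> tm_ren f g) ts = map (eval K (e \<circ> f)) ts"
    using App by (intro map_cong) (auto simp: comp_def)
  then show ?case by (simp only: tm_ren.simps eval.simps map_map)
qed auto

lemma sat_fm_ren:
  assumes "inj f"
  shows "(\<And>a. a \<in> pars \<phi> \<Longrightarrow> eval K e (g a) = a) \<Longrightarrow>
    (\<And>a. a \<in> pars \<phi> \<Longrightarrow> tm_vars (g a) \<inter> range f = {}) \<Longrightarrow>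
    sat K e (fm_ren f g \<phi>) \<longleftrightarrow> sat K (e \<circ> f) \<phi>"
proof (induction \<phi> arbitrary: e)
  case (Rel r ts)
  have "map (eval K e \<circ> tm_ren f g) ts = map (eval K (e \<circ> f)) ts"
    using Rel by (intro map_cong) (auto intro!: eval_tm_ren)
  then show ?case by (simp only: fm_ren.simps sat.simps map_map)
next
  case (Exi i \<phi>)
  have "sat K (e(f i := x)) (fm_ren f g \<phi>) \<longleftrightarrow> sat K ((e \<circ> f)(i := x)) \<phi>" for x
  proof -
    have "eval K (e(f i := x)) (g a) = a" if "a \<in> pars \<phi>" for a
    proof -
      have "eval K (e(f i := x)) (g a) = eval K e (g a)"
        using Exi.prems(2)[of a] that by (intro eval_cong) auto
      then show ?thesis using Exi.prems(1)[of a] that by simp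
    qed
    moreover have "e(f i := x) \<circ> f = (e \<circ> f)(i := x)"
      using \<open>inj f\<close> by (auto simp: fun_eq_iff inj_def)
    ultimately show ?thesis
      using Exi.IH[of "e(f i := x)"] Exi.prems(2) by (simp del: fun_upd_apply)
  qed
  then show ?case by (simp only: fm_ren.simps sat.simps)
qed (auto simp: eval_tm_ren)

lemma tm_wf_ren:
  "(\<And>a. a \<in> tpars t \<Longrightarrow> tm_wf L (g a)) \<Longrightarrow> tm_wf L t \<Longrightarrow> tm_wf L (tm_ren f g t)"
  by (induction t) (auto simp: list_all_iff)

lemma fm_wf_ren:
  "(\<And>a. a \<in> pars \<phi> \<Longrightarrow> tm_wf L (g a)) \<Longrightarrow> fm_wf L \<phi> \<Longrightarrow> fm_wf L (fm_ren f g \<phi>)"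
  by (induction \<phi>) (auto simp: list_all_iff intro!: tm_wf_ren)

lemma tm_vars_ren:
  "tm_vars (tm_ren f g t) \<subseteq> f ` tm_vars t \<union> (\<Union>a\<in>tpars t. tm_vars (g a))"
  by (induction t) fastforce+

lemma free_vars_ren:
  assumes "inj f"
  shows "free_vars (fm_ren f g \<phi>) \<subseteq> f ` free_vars \<phi> \<union> (\<Union>a\<in>pars \<phi>. tm_vars (g a))"
proof (induction \<phi>)
  case (Equ s t)
  then show ?case using tm_vars_ren[of f g s] tm_vars_ren[of f g t] by auto
next
  case (Rel r ts)
  then show ?case using tm_vars_ren[of f g] by fastforce
next
  case (Exi i \<phi>)
  then show ?case using \<open>inj f\<close> by (auto simp: inj_def)
qed auto

lemma tpars_ren: "tpars (tm_ren f g t) \<subseteq> (\<Union>a\<in>tpars t. tpars (g a))"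
  by (induction t) fastforce+

lemma pars_ren: "pars (fm_ren f g \<phi>) \<subseteq> (\<Union>a\<in>pars \<phi>. tpars (g a))"
proof (induction \<phi>)
  case (Equ s t)
  then show ?case using tpars_ren[of f g s] tpars_ren[of f g t] by auto
next
  case (Rel r ts)
  then show ?case using tpars_ren[of f g] by fastforce
qed auto

lemma finite_tpars: "finite (tpars t)"
  by (induction t) auto

lemma finite_pars: "finite (pars \<phi>)"
  by (induction \<phi>) (auto simp: finite_tpars)

lemma Fm_mono: "\<phi> \<in> Fm L A n \<Longrightarrow> A \<subseteq> B \<Longrightarrow> n \<le> n' \<Longrightarrow> \<phi> \<in> Fm L B n'"
  by (fastforce simp: Fm_def)

lemma Fm_NegI [intro, simp]: "Neg \<phi> \<in> Fm L A n \<longleftrightarrow> \<phi> \<in> Fm L A n"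
  by (auto simp: Fm_def)

lemma Fm_Conj [simp]: "Conj \<phi> \<psi> \<in> Fm L A n \<longleftrightarrow> \<phi> \<in> Fm L A n \<and> \<psi> \<in> Fm L A n"
  by (auto simp: Fm_def)

lemma Fm_Disj [simp]: "Disj \<phi> \<psi> \<in> Fm L A n \<longleftrightarrow> \<phi> \<in> Fm L A n \<and> \<psi> \<in> Fm L A n"
  by (auto simp: Disj_def)

lemma Fm_Bot [simp]: "Bot \<in> Fm L A n"
  by (auto simp: Fm_def)

lemma Fm_Top [simp]: "Top \<in> Fm L A n"
  by (auto simp: Top_def)

lemma Fm_over_pars: "\<phi> \<in> Fm L A n \<Longrightarrow> \<phi> \<in> Fm L (pars \<phi>) n"
  by (auto simp: Fm_def)

lemma holds_simps [simp]:
  "\<not> holds K Bot a" "holds K Top a"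
  "holds K (Neg \<phi>) a \<longleftrightarrow> \<not> holds K \<phi> a"
  "holds K (Conj \<phi> \<psi>) a \<longleftrightarrow> holds K \<phi> a \<and> holds K \<psi> a"
  "holds K (Disj \<phi> \<psi>) a \<longleftrightarrow> holds K \<phi> a \<or> holds K \<psi> a"
  by (auto simp: holds_def Top_def Disj_def)

lemma Fm_finite_conj:
  assumes "finite F" "F \<subseteq> Fm L A n"
  obtains \<psi> where "\<psi> \<in> Fm L A n" "\<And>K a. holds K \<psi> a \<longleftrightarrow> (\<forall>\<phi>\<in>F. holds K \<phi> a)"
proof -
  have "\<exists>\<psi>\<in>Fm L A n. \<forall>K a. holds K \<psi> a \<longleftrightarrow> (\<forall>\<phi>\<in>F. holds K \<phi> a)"
    using assms
  proof (induction F rule: finite_induct)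
    case empty
    show ?case by (rule bexI[of _ Top]) auto
  next
    case (insert \<phi> F)
    then obtain \<psi> where "\<psi> \<in> Fm L A n" "\<forall>K a. holds K \<psi> a \<longleftrightarrow> (\<forall>\<phi>\<in>F. holds K \<phi> a)" by auto
    then show ?case using insert.prems by (intro bexI[of _ "Conj \<phi> \<psi>"]) auto
  qed
  then show thesis using that by auto
qed

lemma Fm_finite_disj:
  assumes "finite G" "G \<subseteq> Fm L A n"
  obtains \<psi> where "\<psi> \<in> Fm L A n" "\<And>K a. holds K \<psi> a \<longleftrightarrow> (\<exists>\<phi>\<in>G. holds K \<phi> a)"
proof -
  have "finite (Neg ` G)" "Neg ` G \<subseteq> Fm L A n" using assms by auto
  from Fm_finite_conj[OF this] obtain \<psi> where "\<psi> \<in> Fm L A n"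
    "\<And>K a. holds K \<psi> a \<longleftrightarrow> (\<forall>\<phi>\<in>Neg ` G. holds K \<phi> a)" by metis
  then show thesis by (intro that[of "Neg \<psi>"]) auto
qed

lemma holds_sat_cong:
  assumes "\<phi> \<in> Fm L A n" "\<And>i. i < n \<Longrightarrow> e i = a ! i"
  shows "sat K e \<phi> \<longleftrightarrow> holds K \<phi> a"
  unfolding holds_def using assms by (intro sat_cong) (auto simp: Fm_def)

text \<open>Injectivity on all variables, bound ones included, is what prevents capture: the
  variables beyond \<open>n\<close> are moved out of the way of the new free variables.\<close>

lemma Fm_reindex:
  assumes "\<phi> \<in> Fm L A n" "inj_on f {..<n}" "f ` {..<n} \<subseteq> {..<n'}"
  obtains \<psi> where "\<psi> \<in> Fm L A n'"
    "\<And>K c. holds K \<psi> c \<longleftrightarrow> holds K \<phi> (map (\<lambda>i. c ! f i) [0..<n])"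
proof
  define h where "h i = (if i < n then f i else i + n')" for i
  have "inj h"
    using assms(2,3) by (force simp: inj_def h_def inj_on_def split: if_splits)
  let ?\<psi> = "fm_ren h Par \<phi>"
  have "free_vars ?\<psi> \<subseteq> h ` free_vars \<phi>" "pars ?\<psi> \<subseteq> pars \<phi>"
    using free_vars_ren[OF \<open>inj h\<close>, of Par \<phi>] pars_ren[of h Par \<phi>] by auto
  then show "?\<psi> \<in> Fm L A n'"
    using assms(1,3) fm_wf_ren[of \<phi> L Par h] by (fastforce simp: Fm_def h_def)
  show "holds K ?\<psi> c \<longleftrightarrow> holds K \<phi> (map (\<lambda>i. c ! f i) [0..<n])" for K c
  proof -
    have "holds K ?\<psi> c \<longleftrightarrow> sat K ((\<lambda>i. c ! i) \<circ> h) \<phi>"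
      unfolding holds_def by (rule sat_fm_ren[OF \<open>inj h\<close>]) auto
    also have "\<dots> \<longleftrightarrow> holds K \<phi> (map (\<lambda>i. c ! f i) [0..<n])"
      by (rule holds_sat_cong[OF assms(1)]) (simp add: h_def)
    finally show ?thesis .
  qed
qed

text \<open>The parameters become new variables right after the first \<open>n\<close>; variables from \<open>n\<close> on, which
  can only be bound, are shifted beyond them. Elementarity and invariance speak of formulas without
  parameters, and this is how they are applied to formulas with parameters.\<close>

lemma Fm_abstract:
  fixes \<phi> :: "('f, 'r, 'a) fm"
  assumes "\<phi> \<in> Fm L A n"
  obtains m \<phi>0 b where "\<phi>0 \<in> Fm L {} (n + m)" "length b = m" "set b \<subseteq> A"
    "\<And>K a. length a = n \<Longrightarrow> holds K \<phi>0 (a @ b) \<longleftrightarrow> holds K \<phi> a"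
proof -
  obtain b where b: "set b = pars \<phi>" "distinct b"
    using finite_distinct_list[OF finite_pars[of \<phi>]] by auto
  define m where "m = length b"
  define ix where "ix a = (SOME i. i < m \<and> b ! i = a)" for a
  have ix: "ix a < m \<and> b ! ix a = a" if "a \<in> pars \<phi>" for a
    unfolding ix_def by (rule someI_ex) (use that b in \<open>auto simp: in_set_conv_nth m_def\<close>)
  define h where "h i = (if i < n then i else i + m)" for i
  define g :: "'a \<Rightarrow> ('f, 'a) tm" where "g a = Var (n + ix a)" for a
  have "inj h" by (auto simp: inj_def h_def)
  let ?\<psi> = "fm_ren h g \<phi>"
  have "free_vars ?\<psi> \<subseteq> h ` free_vars \<phi> \<union> (\<lambda>a. n + ix a) ` pars \<phi>" "pars ?\<psi> \<subseteq> {}"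
    using free_vars_ren[OF \<open>inj h\<close>, of g \<phi>] pars_ren[of h g \<phi>] by (auto simp: g_def)
  moreover have "fm_wf L ?\<psi>"
    using assms by (intro fm_wf_ren) (auto simp: Fm_def g_def)
  moreover have "h ` free_vars \<phi> \<union> (\<lambda>a. n + ix a) ` pars \<phi> \<subseteq> {..<n + m}"
    using assms ix by (auto simp: Fm_def h_def)
  ultimately have 1: "?\<psi> \<in> Fm L {} (n + m)"
    unfolding Fm_def by blast
  have 2: "holds K ?\<psi> (a @ b) \<longleftrightarrow> holds K \<phi> a" if "length a = n" for K a
  proof -
    have "holds K ?\<psi> (a @ b) \<longleftrightarrow> sat K ((\<lambda>i. (a @ b) ! i) \<circ> h) \<phi>"
      unfolding holds_def
    proof (rule sat_fm_ren[OF \<open>inj h\<close>])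
      fix c assume c: "c \<in> pars \<phi>"
      then show "eval K ((!) (a @ b)) (g c) = c"
        using ix[OF c] that by (simp add: g_def nth_append)
      show "tm_vars (g c) \<inter> range h = {}"
        using ix[OF c] by (auto simp: g_def h_def split: if_splits)
    qed
    also have "\<dots> \<longleftrightarrow> holds K \<phi> a"
      by (rule holds_sat_cong[OF assms]) (simp add: h_def that nth_append)
    finally show ?thesis .
  qed
  show thesis
    by (rule that[OF 1 m_def[symmetric] _ 2]) (use b assms in \<open>auto simp: Fm_def\<close>)
qed

subsection \<open>Definable relations\<close>

text \<open>Formulas are mostly needed through what they say. \<open>expressible L A n R\<close> lets them be built from
  a description \<open>R\<close> of their meaning; one formula must serve for all structures \<open>K\<close>, as it is
  then compared in two of them.\<close>

definition expressible ::
  "('f, 'r) lang \<Rightarrow> 'a set \<Rightarrow> nat \<Rightarrow> (('f, 'r, 'a) struct \<Rightarrow> 'a list \<Rightarrow> bool) \<Rightarrow> bool" where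
  "expressible L A n R \<longleftrightarrow> (\<exists>\<phi>\<in>Fm L A n. \<forall>K a. length a = n \<longrightarrow> (holds K \<phi> a \<longleftrightarrow> R K a))"

lemma expressible_holds: "\<phi> \<in> Fm L A n \<Longrightarrow> expressible L A n (\<lambda>K a. holds K \<phi> a)"
  by (auto simp: expressible_def)

lemma expressible_Not: "expressible L A n R \<Longrightarrow> expressible L A n (\<lambda>K a. \<not> R K a)"
  unfolding expressible_def by (metis Fm_NegI holds_simps(3))

lemma expressible_conj:
  "expressible L A n R \<Longrightarrow> expressible L A n S \<Longrightarrow> expressible L A n (\<lambda>K a. R K a \<and> S K a)"
  unfolding expressible_def by (metis Fm_Conj holds_simps(4))

lemma expressible_True: "expressible L A n (\<lambda>K a. True)"
  unfolding expressible_def by (metis Fm_Top holds_simps(2))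

lemma expressible_Ball:
  "finite I \<Longrightarrow> (\<And>i. i \<in> I \<Longrightarrow> expressible L A n (R i)) \<Longrightarrow>
    expressible L A n (\<lambda>K a. \<forall>i\<in>I. R i K a)"
  by (induction I rule: finite_induct) (auto intro: expressible_True expressible_conj)

lemma expressible_iff:
  assumes "expressible L A n R"
  shows "expressible L A n (\<lambda>K a. R K a \<longleftrightarrow> Q)"
  using assms expressible_Not[OF assms] by (cases Q) auto

lemma expressible_cong:
  "expressible L A n R \<Longrightarrow> (\<And>K a. length a = n \<Longrightarrow> R K a \<longleftrightarrow> S K a) \<Longrightarrow> expressible L A n S"
  by (auto simp: expressible_def)

lemma expressible_reindex:
  assumes "expressible L A n R" "inj_on f {..<n}" "f ` {..<n} \<subseteq> {..<n'}"
  shows "expressible L A n' (\<lambda>K c. R K (map (\<lambda>i. c ! f i) [0..<n]))"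
proof -
  obtain \<phi> where \<phi>: "\<phi> \<in> Fm L A n" "\<And>K a. length a = n \<Longrightarrow> holds K \<phi> a \<longleftrightarrow> R K a"
    using assms(1) by (auto simp: expressible_def)
  from Fm_reindex[OF \<phi>(1) assms(2,3)] obtain \<psi> where "\<psi> \<in> Fm L A n'"
    "\<And>K c. holds K \<psi> c \<longleftrightarrow> holds K \<phi> (map (\<lambda>i. c ! f i) [0..<n])" by blast
  then show ?thesis using \<phi>(2) by (auto simp: expressible_def)
qed

lemma expressible_take:
  fixes R :: "('f, 'r, 'a) struct \<Rightarrow> 'a list \<Rightarrow> bool"
  assumes "expressible L A n R" "n \<le> n'"
  shows "expressible L A n' (\<lambda>K c. R K (take n c))"
proof -
  have "expressible L A n' (\<lambda>K c. R K (map (\<lambda>i. c ! i) [0..<n]))"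
    using assms by (intro expressible_reindex) auto
  then show ?thesis
  proof (rule expressible_cong)
    fix K :: "('f, 'r, 'a) struct" and c :: "'a list"
    assume "length c = n'"
    then have "map (\<lambda>i. c ! i) [0..<n] = take n c" using assms(2) by (intro nth_equalityI) auto
    then show "R K (map (\<lambda>i. c ! i) [0..<n]) \<longleftrightarrow> R K (take n c)" by simp
  qed
qed

lemma tuples_Suc: "tuples K (Suc m) = {b @ [x] | b x. b \<in> tuples K m \<and> x \<in> univ K}"
proof (intro set_eqI iffI)
  fix c assume "c \<in> tuples K (Suc m)"
  then show "c \<in> {b @ [x] | b x. b \<in> tuples K m \<and> x \<in> univ K}"
    by (cases c rule: rev_cases) (auto simp: tuples_def)
qed (auto simp: tuples_def)

lemma expressible_ex1:
  assumes "expressible L A (Suc n) R"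
  shows "expressible L A n (\<lambda>K a. \<exists>x\<in>univ K. R K (a @ [x]))"
proof -
  obtain \<phi> where \<phi>: "\<phi> \<in> Fm L A (Suc n)" "\<And>K a. length a = Suc n \<Longrightarrow> holds K \<phi> a \<longleftrightarrow> R K a"
    using assms(1) by (auto simp: expressible_def)
  have "Exi n \<phi> \<in> Fm L A n"
    using \<phi>(1) by (force simp: Fm_def)
  moreover have "holds K (Exi n \<phi>) a \<longleftrightarrow> (\<exists>x\<in>univ K. R K (a @ [x]))" if "length a = n" for K a
  proof -
    have "sat K (((!) a)(n := x)) \<phi> \<longleftrightarrow> holds K \<phi> (a @ [x])" for x
      by (rule holds_sat_cong[OF \<phi>(1)]) (use that in \<open>auto simp: nth_append\<close>)
    then show ?thesis using \<phi>(2) that by (simp add: holds_def)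
  qed
  ultimately show ?thesis unfolding expressible_def by blast
qed

lemma expressible_ex:
  "expressible L A (n + m) R \<Longrightarrow> expressible L A n (\<lambda>K a. \<exists>b\<in>tuples K m. R K (a @ b))"
proof (induction m arbitrary: R)
  case 0
  then show ?case by (auto simp: tuples_def expressible_def)
next
  case (Suc m)
  have "expressible L A (n + m) (\<lambda>K a. \<exists>x\<in>univ K. R K (a @ [x]))"
    using Suc.prems by (intro expressible_ex1) simp
  from Suc.IH[OF this] show ?case
    by (rule expressible_cong) (auto simp: tuples_Suc)
qed

text \<open>This gives the opposite formula, in which variables and parameters trade places. It is needed
  whenever a sequence of parameters is studied, and because \<open>expressible_ex\<close> quantifies the
  last variables.\<close>

lemma expressible_swap:
  fixes R :: "('f, 'r, 'a) struct \<Rightarrow> 'a list \<Rightarrow> bool"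
  assumes "expressible L A (n + m) R"
  shows "expressible L A (m + n) (\<lambda>K c. R K (drop m c @ take m c))"
proof -
  let ?f = "\<lambda>i. if i < n then m + i else i - n"
  have "expressible L A (m + n) (\<lambda>K c. R K (map (\<lambda>i. c ! ?f i) [0..<n + m]))"
    using assms by (rule expressible_reindex) (auto simp: inj_on_def split: if_splits)
  then show ?thesis
  proof (rule expressible_cong)
    fix K :: "('f, 'r, 'a) struct" and c :: "'a list"
    assume "length c = m + n"
    then have "map (\<lambda>i. c ! ?f i) [0..<n + m] = drop m c @ take m c"
      by (intro nth_equalityI) (auto simp: nth_append)
    then show "R K (map (\<lambda>i. c ! ?f i) [0..<n + m]) \<longleftrightarrow> R K (drop m c @ take m c)"
      by simp
  qed
qed

lemma expressible_elem_sub: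
  assumes "elem_sub L A B" "expressible L {} n R" "a \<in> tuples A n"
  shows "R A a \<longleftrightarrow> R B a"
proof -
  obtain \<phi> where "\<phi> \<in> Fm L {} n" "\<And>K a. length a = n \<Longrightarrow> holds K \<phi> a \<longleftrightarrow> R K a"
    using assms(2) by (auto simp: expressible_def)
  then show ?thesis using assms(1,3) by (force simp: elem_sub_def tuples_def)
qed

lemma expressible_tp:
  assumes "tp L K b A = tp L K b' A" "length b = n" "length b' = n" "expressible L A n R"
  shows "R K b \<longleftrightarrow> R K b'"
proof -
  obtain \<phi> where "\<phi> \<in> Fm L A n" "\<And>K a. length a = n \<Longrightarrow> holds K \<phi> a \<longleftrightarrow> R K a"
    using assms(4) by (auto simp: expressible_def)
  then show ?thesis using assms(1-3) by (force simp: tp_def)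
qed

section \<open>Complete types\<close>

definition finsat :: "('f, 'r, 'a) struct \<Rightarrow> 'a list set \<Rightarrow> ('f, 'r, 'a) fm set \<Rightarrow> bool" where
  "finsat K X p \<longleftrightarrow> (\<forall>F. finite F \<longrightarrow> F \<subseteq> p \<longrightarrow> (\<exists>a\<in>X. \<forall>\<phi>\<in>F. holds K \<phi> a))"

lemma types_alt: "p \<in> types L K A n \<longleftrightarrow>
    p \<subseteq> Fm L A n \<and> finsat K (tuples K n) p \<and> (\<forall>\<phi>\<in>Fm L A n. \<phi> \<in> p \<or> Neg \<phi> \<in> p)"
  by (auto simp: types_def finsat_def)

lemma finsatD: "finsat K X p \<Longrightarrow> finite F \<Longrightarrow> F \<subseteq> p \<Longrightarrow> \<exists>a\<in>X. \<forall>\<phi>\<in>F. holds K \<phi> a"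
  by (simp add: finsat_def)

lemma finsat_mono: "finsat K X p \<Longrightarrow> q \<subseteq> p \<Longrightarrow> X \<subseteq> Y \<Longrightarrow> finsat K Y q"
  unfolding finsat_def by blast

lemma type_consequence:
  assumes "p \<in> types L K A n" "finite F" "F \<subseteq> p" "\<psi> \<in> Fm L A n"
    "\<And>a. a \<in> tuples K n \<Longrightarrow> (\<forall>\<phi>\<in>F. holds K \<phi> a) \<Longrightarrow> holds K \<psi> a"
  shows "\<psi> \<in> p"
proof (rule ccontr)
  assume "\<psi> \<notin> p"
  with assms(1,4) have "insert (Neg \<psi>) F \<subseteq> p" using assms(3) by (auto simp: types_def)
  then obtain a where "a \<in> tuples K n" "\<forall>\<phi>\<in>insert (Neg \<psi>) F. holds K \<phi> a"
    using finsatD[of K "tuples K n" p "insert (Neg \<psi>) F"] assms(1,2) by (auto simp: types_alt)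
  with assms(5) show False by auto
qed

lemma type_mono:
  assumes "p \<in> types L K A n" "\<phi> \<in> p" "\<psi> \<in> Fm L A n"
    "\<And>a. a \<in> tuples K n \<Longrightarrow> holds K \<phi> a \<Longrightarrow> holds K \<psi> a"
  shows "\<psi> \<in> p"
  by (rule type_consequence[OF assms(1), of "{\<phi>}"]) (use assms in auto)

lemma type_cong:
  assumes "p \<in> types L K A n" "\<phi> \<in> Fm L A n" "\<psi> \<in> Fm L A n"
    "\<And>a. a \<in> tuples K n \<Longrightarrow> holds K \<phi> a \<longleftrightarrow> holds K \<psi> a"
  shows "\<phi> \<in> p \<longleftrightarrow> \<psi> \<in> p"
  using type_mono[OF assms(1)] assms(2-4) by metis

lemma type_sat:
  assumes "p \<in> types L K A n" "finite F" "F \<subseteq> p"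
  shows "\<exists>a\<in>tuples K n. \<forall>\<phi>\<in>F. holds K \<phi> a"
  by (rule finsatD[OF _ assms(2,3)]) (use assms(1) in \<open>simp add: types_alt\<close>)

lemma type_Neg:
  assumes "p \<in> types L K A n" "\<phi> \<in> Fm L A n"
  shows "Neg \<phi> \<in> p \<longleftrightarrow> \<phi> \<notin> p"
proof
  assume "Neg \<phi> \<in> p"
  show "\<phi> \<notin> p"
  proof
    assume "\<phi> \<in> p"
    with \<open>Neg \<phi> \<in> p\<close> show False
      using type_sat[OF assms(1), of "{\<phi>, Neg \<phi>}"] by auto
  qed
qed (use assms in \<open>auto simp: types_def\<close>)

lemma type_Conj:
  assumes "p \<in> types L K A n" "\<phi> \<in> Fm L A n" "\<psi> \<in> Fm L A n"
  shows "Conj \<phi> \<psi> \<in> p \<longleftrightarrow> \<phi> \<in> p \<and> \<psi> \<in> p"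
proof
  assume "Conj \<phi> \<psi> \<in> p"
  then show "\<phi> \<in> p \<and> \<psi> \<in> p"
    by (auto intro!: type_mono[OF assms(1), of "Conj \<phi> \<psi>"] simp: assms)
next
  assume "\<phi> \<in> p \<and> \<psi> \<in> p"
  then show "Conj \<phi> \<psi> \<in> p"
    by (intro type_consequence[OF assms(1), of "{\<phi>, \<psi>}"]) (use assms in auto)
qed

lemma type_Disj:
  assumes "p \<in> types L K A n" "\<phi> \<in> Fm L A n" "\<psi> \<in> Fm L A n"
  shows "Disj \<phi> \<psi> \<in> p \<longleftrightarrow> \<phi> \<in> p \<or> \<psi> \<in> p"
  using assms by (simp add: Disj_def type_Neg type_Conj)

lemma type_eqI:
  assumes "p \<in> types L K A n" "q \<in> types L K A n" "p \<subseteq> q"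
  shows "p = q"
proof
  show "q \<subseteq> p"
  proof
    fix \<phi> assume "\<phi> \<in> q"
    then have "\<phi> \<in> Fm L A n" using assms(2) by (auto simp: types_def)
    then show "\<phi> \<in> p" using type_Neg[OF assms(1)] type_Neg[OF assms(2)] assms(3) \<open>\<phi> \<in> q\<close> by blast
  qed
qed fact

lemma tp_type: "a \<in> tuples K n \<Longrightarrow> tp L K a A \<in> types L K A n"
  unfolding types_alt finsat_def by (auto simp: tp_def tuples_def)

text \<open>A maximal set of formulas finitely satisfied in \<open>X\<close> is complete: finite obstructions to adding
  \<open>\<phi>\<close> and to adding \<open>\<not>\<phi>\<close> would together not be satisfied in \<open>X\<close>. With \<open>X\<close> the set of all tuples
  this extends partial types, with \<open>X\<close> the tuples of a submodel it gives coheirs.\<close>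

lemma finsat_extend:
  assumes "\<Sigma> \<subseteq> Fm L A n" "finsat K X \<Sigma>" "X \<subseteq> tuples K n"
  obtains p where "\<Sigma> \<subseteq> p" "p \<in> types L K A n" "finsat K X p"
proof -
  let ?C = "{p. \<Sigma> \<subseteq> p \<and> p \<subseteq> Fm L A n \<and> finsat K X p}"
  have "\<exists>p\<in>?C. \<forall>q\<in>?C. p \<subseteq> q \<longrightarrow> q = p"
  proof (rule subset_Zorn_nonempty)
    show "?C \<noteq> {}" using assms by blast
    fix C assume C: "C \<noteq> {}" "subset.chain ?C C"
    have "finsat K X (\<Union>C)"
      unfolding finsat_def
    proof (intro allI impI)
      fix F assume "finite F" "F \<subseteq> \<Union>C"
      then obtain p where "p \<in> C" "F \<subseteq> p"
        using finite_subset_Union_chain[OF _ _ C] by blast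
      then show "\<exists>a\<in>X. \<forall>\<phi>\<in>F. holds K \<phi> a"
        using C(2) \<open>finite F\<close> by (auto simp: subset_chain_def finsat_def)
    qed
    then show "\<Union>C \<in> ?C" using C by (fastforce simp: subset_chain_def)
  qed
  then obtain p where pC: "p \<in> ?C" and max: "\<forall>q\<in>?C. p \<subseteq> q \<longrightarrow> q = p"
    by (rule bexE)
  from pC have p: "\<Sigma> \<subseteq> p" "p \<subseteq> Fm L A n" "finsat K X p" by simp_all
  have "\<phi> \<in> p \<or> Neg \<phi> \<in> p" if \<phi>: "\<phi> \<in> Fm L A n" for \<phi>
  proof (rule ccontr)
    assume *: "\<not> (\<phi> \<in> p \<or> Neg \<phi> \<in> p)"
    have no: "\<exists>F. finite F \<and> F \<subseteq> p \<and> (\<forall>a\<in>X. (\<forall>\<xi>\<in>F. holds K \<xi> a) \<longrightarrow> \<not> holds K \<psi> a)"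
      if \<psi>: "\<psi> \<in> Fm L A n" "\<psi> \<notin> p" for \<psi>
    proof -
      have "insert \<psi> p \<notin> ?C"
      proof
        assume "insert \<psi> p \<in> ?C"
        from bspec[OF max this] show False using \<psi>(2) by blast
      qed
      then have "\<not> finsat K X (insert \<psi> p)" using p(1,2) \<psi>(1) by blast
      then obtain F where F: "finite F" "F \<subseteq> insert \<psi> p" "\<forall>a\<in>X. \<exists>\<xi>\<in>F. \<not> holds K \<xi> a"
        by (auto simp: finsat_def)
      then show ?thesis by (intro exI[of _ "F - {\<psi>}"]) auto
    qed
    obtain F G where F: "finite F" "F \<subseteq> p" "\<forall>a\<in>X. (\<forall>\<xi>\<in>F. holds K \<xi> a) \<longrightarrow> \<not> holds K \<phi> a"
      and G: "finite G" "G \<subseteq> p" "\<forall>a\<in>X. (\<forall>\<xi>\<in>G. holds K \<xi> a) \<longrightarrow> \<not> holds K (Neg \<phi>) a"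
      using no[of \<phi>] no[of "Neg \<phi>"] \<phi> * by auto
    have "\<exists>a\<in>X. \<forall>\<xi>\<in>F \<union> G. holds K \<xi> a"
      by (rule finsatD[OF p(3)]) (use F G in auto)
    then show False using F(3) G(3) by auto
  qed
  then have "p \<in> types L K A n"
    using p(2) finsat_mono[OF p(3) order_refl assms(3)] by (simp add: types_alt)
  then show thesis by (rule that[OF p(1) _ p(3)])
qed

lemma saturated_realize:
  assumes "saturated L K \<kappa>" "A \<subseteq> univ K" "|A| <o \<kappa>" "\<Sigma> \<subseteq> Fm L A n" "finsat K (tuples K n) \<Sigma>"
  obtains a where "a \<in> tuples K n" "\<And>\<phi>. \<phi> \<in> \<Sigma> \<Longrightarrow> holds K \<phi> a"
proof -
  obtain p where p: "\<Sigma> \<subseteq> p" "p \<in> types L K A n"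
    using finsat_extend[OF assms(4,5) order_refl] by metis
  obtain a where "a \<in> tuples K n" "\<forall>\<phi>\<in>p. holds K \<phi> a"
    using assms(1)[unfolded saturated_def, rule_format, OF assms(2,3) p(2)] ..
  then show thesis using p(1) that[of a] by auto
qed

subsection \<open>Instances\<close>

lemma tpars_subst: "tpars (tm_subst \<sigma> t) \<subseteq> tpars t \<union> {a. \<exists>i. \<sigma> i = Some a}"
proof (induction t)
  case (App f ts)
  then have "tpars (tm_subst \<sigma> t) \<subseteq> tpars (App f ts) \<union> {a. \<exists>i. \<sigma> i = Some a}" if "t \<in> set ts" for t
    using that by auto
  then show ?case by auto
qed (auto split: option.splits)

lemma tm_vars_subst: "tm_vars (tm_subst \<sigma> t) = tm_vars t - {i. \<sigma> i \<noteq> None}"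
  by (induction t) (auto split: option.splits)

lemma tm_wf_subst: "tm_wf L t \<Longrightarrow> tm_wf L (tm_subst \<sigma> t)"
  by (induction t) (auto split: option.splits simp: list_all_iff)

lemma pars_subst: "pars (fm_subst \<phi> \<sigma>) \<subseteq> pars \<phi> \<union> {a. \<exists>i. \<sigma> i = Some a}"
proof (induction \<phi> arbitrary: \<sigma>)
  case (Equ s t)
  then show ?case using tpars_subst[of \<sigma> s] tpars_subst[of \<sigma> t] by auto
next
  case (Rel r ts)
  have "tpars (tm_subst \<sigma> t) \<subseteq> pars (Rel r ts) \<union> {a. \<exists>i. \<sigma> i = Some a}" if "t \<in> set ts" for t
    using that tpars_subst[of \<sigma> t] by auto
  then show ?case by auto
next
  case (Conj \<phi> \<psi>)
  show ?case using Conj[of \<sigma>] by auto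
next
  case (Exi i \<phi>)
  have "{a. \<exists>j. (\<sigma>(i := None)) j = Some a} \<subseteq> {a. \<exists>j. \<sigma> j = Some a}"
    by (auto split: if_splits)
  then show ?case using Exi[of "\<sigma>(i := None)"] by (simp del: fun_upd_apply) blast
qed auto

lemma free_vars_subst: "free_vars (fm_subst \<phi> \<sigma>) = free_vars \<phi> - {i. \<sigma> i \<noteq> None}"
  by (induction \<phi> arbitrary: \<sigma>) (auto simp: tm_vars_subst)

lemma fm_wf_subst: "fm_wf L \<phi> \<Longrightarrow> fm_wf L (fm_subst \<phi> \<sigma>)"
  by (induction \<phi> arbitrary: \<sigma>) (auto simp: tm_wf_subst list_all_iff)

lemma inst_Fm:
  assumes "\<phi> \<in> Fm L A (n + length b)" "A \<subseteq> B" "set b \<subseteq> B"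
  shows "inst n \<phi> b \<in> Fm L B n"
proof -
  let ?\<sigma> = "\<lambda>i. if n \<le> i \<and> i < n + length b then Some (b ! (i - n)) else None"
  have "pars (inst n \<phi> b) \<subseteq> pars \<phi> \<union> set b"
    using pars_subst[of \<phi> ?\<sigma>] unfolding inst_def by (auto split: if_splits dest!: subsetD)
  moreover have "free_vars (inst n \<phi> b) \<subseteq> {..<n}"
    using assms(1) unfolding inst_def free_vars_subst by (auto simp: Fm_def)
  moreover have "fm_wf L (inst n \<phi> b)" "pars \<phi> \<union> set b \<subseteq> B"
    using assms fm_wf_subst[of L \<phi> ?\<sigma>] by (auto simp: Fm_def inst_def)
  ultimately show ?thesis
    unfolding Fm_def by blast
qed

lemma Fm_as_inst:
  assumes "\<phi> \<in> Fm L A n"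
  obtains m \<phi>0 b where "\<phi>0 \<in> Fm L {} (n + m)" "length b = m" "set b \<subseteq> A"
    "inst n \<phi>0 b \<in> Fm L A n"
    "\<And>K a. length a = n \<Longrightarrow> holds K (inst n \<phi>0 b) a \<longleftrightarrow> holds K \<phi> a"
proof -
  from Fm_abstract[OF assms] obtain m \<phi>0 b where *: "\<phi>0 \<in> Fm L {} (n + m)" "length b = m" "set b \<subseteq> A"
    "\<And>K a. length a = n \<Longrightarrow> holds K \<phi>0 (a @ b) \<longleftrightarrow> holds K \<phi> a" by metis
  show thesis
  proof (rule that[OF *(1-3)])
    show "inst n \<phi>0 b \<in> Fm L A n" using * by (intro inst_Fm[of _ _ "{}"]) auto
    show "holds K (inst n \<phi>0 b) a \<longleftrightarrow> holds K \<phi> a" if "length a = n" for K a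
      using holds_inst[of \<phi>0 L "{}" a b K] * that by simp
  qed
qed

lemma holds_elem_sub:
  assumes "elem_sub L A B" "\<phi> \<in> Fm L (univ A) n" "a \<in> tuples A n"
  shows "holds A \<phi> a \<longleftrightarrow> holds B \<phi> a"
proof -
  from Fm_abstract[OF assms(2)] obtain m \<phi>0 b where *: "\<phi>0 \<in> Fm L {} (n + m)" "length b = m"
    "set b \<subseteq> univ A" "\<And>K a. length a = n \<Longrightarrow> holds K \<phi>0 (a @ b) \<longleftrightarrow> holds K \<phi> a" by metis
  have "a @ b \<in> tuples A (n + m)" using * assms(3) by (auto simp: tuples_def)
  then have "holds A \<phi>0 (a @ b) \<longleftrightarrow> holds B \<phi>0 (a @ b)"
    using assms(1) *(1) by (auto simp: elem_sub_def)
  then show ?thesis using * assms(3) by (simp add: tuples_def)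
qed

lemma elem_sub_ex:
  assumes "elem_sub L A B" "\<phi> \<in> Fm L (univ A) n" "b \<in> tuples B n" "holds B \<phi> b"
  obtains a where "a \<in> tuples A n" "holds A \<phi> a" "holds B \<phi> a"
proof -
  have "expressible L (univ A) 0 (\<lambda>K c. \<exists>b\<in>tuples K n. holds K \<phi> (c @ b))"
    using assms(2) by (intro expressible_ex expressible_holds) simp
  then obtain \<psi> where \<psi>: "\<psi> \<in> Fm L (univ A) 0"
    "\<And>K. holds K \<psi> [] \<longleftrightarrow> (\<exists>b\<in>tuples K n. holds K \<phi> b)"
    by (auto simp: expressible_def)
  have "holds A \<psi> []"
    using holds_elem_sub[OF assms(1) \<psi>(1), of "[]"] assms(3,4) \<psi>(2) by (auto simp: tuples_def)
  then obtain a where "a \<in> tuples A n" "holds A \<phi> a" using \<psi>(2) by auto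
  then show thesis using holds_elem_sub[OF assms(1,2)] that by blast
qed

lemma elem_sub_tuples: "elem_sub L A B \<Longrightarrow> tuples A n \<subseteq> tuples B n"
  by (auto simp: elem_sub_def tuples_def)

lemma elem_sub_trans: "elem_sub L A B \<Longrightarrow> elem_sub L B C \<Longrightarrow> elem_sub L A C"
  unfolding elem_sub_def by (fastforce simp: tuples_def)

section \<open>Pairs\<close>

lemma lift_simps [simp]:
  "lift Bot = Bot" "lift (Equ s t) = Equ s t" "lift (Rel r ts) = Rel (Some r) ts"
  "lift (Neg \<phi>) = Neg (lift \<phi>)" "lift (Conj \<phi> \<psi>) = Conj (lift \<phi>) (lift \<psi>)"
  "lift (Exi i \<phi>) = Exi i (lift \<phi>)"
  by (simp_all add: lift_def tm.map_id tm.map_id0)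

lemma eval_pair [simp]: "eval (pair K Q) e t = eval K e t"
proof (induction t)
  case (App f ts)
  then have "map (eval (pair K Q) e) ts = map (eval K e) ts" by auto
  then show ?case by (simp only: eval.simps) (simp add: pair_def)
qed auto

lemma sat_lift: "sat (pair K Q) e (lift \<phi>) \<longleftrightarrow> sat K e \<phi>"
proof (induction \<phi> arbitrary: e)
  case (Rel r ts)
  have "map (eval (pair K Q) e) ts = map (eval K e) ts" by simp
  then show ?case by (simp only: lift_simps sat.simps) (simp add: pair_def)
qed (simp_all add: pair_def[of K Q, THEN arg_cong[of _ _ univ]])

lemma univ_pair [simp]: "univ (pair K Q) = univ K"
  by (simp add: pair_def)

lemma tuples_pair [simp]: "tuples (pair K Q) n = tuples K n"
  by (simp add: tuples_def)

lemma holds_lift [simp]: "holds (pair K Q) (lift \<phi>) a \<longleftrightarrow> holds K \<phi> a"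
  by (simp add: holds_def sat_lift)

lemma tm_wf_LP: "tm_wf (LP L) t \<longleftrightarrow> tm_wf L t"
proof (induction t)
  case (App f ts)
  then have "list_all (tm_wf (LP L)) ts \<longleftrightarrow> list_all (tm_wf L) ts" by (auto simp: list_all_iff)
  then show ?case by (simp add: LP_def)
qed auto

lemma lift_wf: "fm_wf (LP L) (lift \<phi>) \<longleftrightarrow> fm_wf L \<phi>"
  by (induction \<phi>) (auto simp: tm_wf_LP list_all_iff, auto simp: LP_def)

lemma lift_pars: "pars (lift \<phi>) = pars \<phi>"
  by (induction \<phi>) auto

lemma lift_free_vars: "free_vars (lift \<phi>) = free_vars \<phi>"
  by (induction \<phi>) auto

lemma lift_Fm [simp]: "lift \<phi> \<in> Fm (LP L) A n \<longleftrightarrow> \<phi> \<in> Fm L A n"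
  by (simp add: Fm_def lift_wf lift_pars lift_free_vars)

lemma elem_sub_reduct:
  fixes A B :: "('f, 'r, 'a) struct"
  assumes "elem_sub (LP L) (pair A P) (pair B Q)"
  shows "elem_sub L A B"
proof -
  have "is_struct (LP L) (pair K R) \<longleftrightarrow> is_struct L K" for K :: "('f, 'r, 'a) struct" and R

    by (auto simp: is_struct_def LP_def pair_def)
  then have "is_struct L A" "is_struct L B" "univ A \<subseteq> univ B"
    using assms by (auto simp: elem_sub_def)
  moreover have "holds A \<phi> a \<longleftrightarrow> holds B \<phi> a" if "\<phi> \<in> Fm L {} n" "a \<in> tuples A n" for n \<phi> a
  proof -
    have "lift \<phi> \<in> Fm (LP L) {} n" "a \<in> tuples (pair A P) n" using that by simp_all
    then have "holds (pair A P) (lift \<phi>) a \<longleftrightarrow> holds (pair B Q) (lift \<phi>) a"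
      using assms unfolding elem_sub_def by blast
    then show ?thesis by simp
  qed
  ultimately show ?thesis unfolding elem_sub_def by blast
qed

lemma holds_Pfm [simp]: "length a = n \<Longrightarrow> holds (pair K Q) (Pfm n) a \<longleftrightarrow> set a \<subseteq> Q"
proof -
  assume n: "length a = n"
  have "holds (pair K Q) (foldr (\<lambda>i. Conj (Rel None [Var i])) l Top) a \<longleftrightarrow> (\<forall>i\<in>set l. a ! i \<in> Q)" for l
  proof (induction l)
    case (Cons i l)
    have "holds (pair K Q) (Rel None [Var i]) a \<longleftrightarrow> a ! i \<in> Q"
      by (auto simp: holds_def) (auto simp: pair_def)
    with Cons show ?case by simp
  qed simp
  then show ?thesis using n by (auto simp: Pfm_def set_conv_nth)
qed

lemma Pfm_Fm [simp]: "Pfm n \<in> Fm (LP L) A n"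
proof -
  have "set l \<subseteq> {..<n} \<Longrightarrow> foldr (\<lambda>i. Conj (Rel None [Var i])) l Top \<in> Fm (LP L) A n" for l
    by (induction l) (auto simp: Fm_def Top_def LP_def)
  then show ?thesis by (force simp: Pfm_def)
qed

lemma expressible_ex_P:
  fixes \<phi> :: "('f, 'r, 'a) fm"
  assumes "\<phi> \<in> Fm L {} (n + m)"
  shows "expressible (LP L) {} m
    (\<lambda>K y. \<exists>x\<in>tuples K n. holds K (Pfm n) x \<and> holds K (lift \<phi>) (x @ y))"
proof -
  have "expressible (LP L) {} (n + m)
      (\<lambda>(K :: ('f, 'r option, 'a) struct) c. holds K (Pfm n) (take n c))"
    by (intro expressible_take expressible_holds) auto
  then have "expressible (LP L) {} (n + m) (\<lambda>K c. holds K (Pfm n) (take n c) \<and> holds K (lift \<phi>) c)"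
    by (intro expressible_conj expressible_holds) (simp_all add: assms)
  from expressible_ex[OF expressible_swap[OF this]] show ?thesis
    by (rule expressible_cong) (auto simp: tuples_def)
qed

text \<open>This is how solutions that were found in the large predicate are pulled back to \<open>M\<close>.\<close>

lemma pair_ex_P:
  assumes "elem_sub (LP L) (pair A P) (pair B Q)" "\<phi> \<in> Fm L (univ A) n" "P \<subseteq> univ A"
    "c \<in> tuples B n" "set c \<subseteq> Q" "holds B \<phi> c"
  obtains a where "length a = n" "set a \<subseteq> P" "holds A \<phi> a"
proof -
  from Fm_abstract[OF assms(2)] obtain m \<phi>0 b where *: "\<phi>0 \<in> Fm L {} (n + m)" "length b = m"
    "set b \<subseteq> univ A" "\<And>K a. length a = n \<Longrightarrow> holds K \<phi>0 (a @ b) \<longleftrightarrow> holds K \<phi> a" by metis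
  have b: "b \<in> tuples (pair A P) m" using * by (auto simp: tuples_def)
  have "\<exists>x\<in>tuples (pair A P) n. holds (pair A P) (Pfm n) x \<and> holds (pair A P) (lift \<phi>0) (x @ b)"
    unfolding expressible_elem_sub[OF assms(1) expressible_ex_P[OF *(1)] b]
    by (rule bexI[of _ c]) (use assms(4-6) * in \<open>auto simp: tuples_def\<close>)
  then show thesis using * that by (auto simp: tuples_def)
qed

text \<open>The predicate of an elementary extension of \<open>(M',M)\<close> names a substructure \<open>N\<close> that is
  elementary in the language without predicate: the Tarski--Vaught test for a given formula is
  expressed by one sentence with predicate, which holds in \<open>(M',M)\<close>.\<close>

lemma pair_Tarski_Vaught:
  assumes MM': "elem_sub L M M'" and ext: "elem_sub (LP L) (pair M' (univ M)) (pair N' N)"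
    and N: "N \<subseteq> univ N'" and \<theta>: "\<theta> \<in> Fm L N n" and a: "a \<in> tuples N' n" "holds N' \<theta> a"
  obtains c where "length c = n" "set c \<subseteq> N" "holds N' \<theta> c"
proof -
  from Fm_abstract[OF \<theta>] obtain m \<theta>0 b where *: "\<theta>0 \<in> Fm L {} (n + m)" "length b = m"
    "set b \<subseteq> N" "\<And>K a. length a = n \<Longrightarrow> holds K \<theta>0 (a @ b) \<longleftrightarrow> holds K \<theta> a" by metis
  \<comment> \<open>\<open>R\<close> says that the Tarski--Vaught test fails for \<open>\<theta>0\<close> at the parameter \<open>y\<close>.\<close>
  define R where "R K y \<longleftrightarrow> holds K (Pfm m) y \<and> (\<exists>x\<in>tuples K n. holds K (lift \<theta>0) (x @ y)) \<and>
    \<not> (\<exists>x\<in>tuples K n. holds K (Pfm n) x \<and> holds K (lift \<theta>0) (x @ y))" for K y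
  have "expressible (LP L) {} m (\<lambda>K y. \<exists>x\<in>tuples K n. holds K (lift \<theta>0) (x @ y))"
  proof -
    have "expressible (LP L) {} (n + m) (\<lambda>K c. holds K (lift \<theta>0) c)"
      by (intro expressible_holds) (simp add: *)
    from expressible_ex[OF expressible_swap[OF this]] show ?thesis
      by (rule expressible_cong) (auto simp: tuples_def)
  qed
  then have "expressible (LP L) {} (0 + m) R"
    unfolding R_def using *(1)
    by (intro expressible_conj expressible_Not expressible_ex_P) (simp_all add: expressible_holds)
  from expressible_ex[OF this]
  have sent: "expressible (LP L) {} 0 (\<lambda>K z. \<exists>y\<in>tuples K m. R K (z @ y))" .
  have "\<not> R (pair M' (univ M)) y" if y: "y \<in> tuples M' m" for y
  proof
    assume R: "R (pair M' (univ M)) y"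
    then have yM: "set y \<subseteq> univ M" using y by (auto simp: R_def tuples_def)
    obtain x where x: "x \<in> tuples M' n" "holds M' \<theta>0 (x @ y)" using R by (auto simp: R_def)
    have "inst n \<theta>0 y \<in> Fm L (univ M) n"
      using * y yM by (intro inst_Fm[of _ _ "{}"]) (auto simp: tuples_def)
    moreover have inst: "holds K (inst n \<theta>0 y) x \<longleftrightarrow> holds K \<theta>0 (x @ y)" if "length x = n" for K x
      using holds_inst[of \<theta>0 L "{}" x y K] * y that by (simp add: tuples_def)
    moreover from inst[of x] x have "holds M' (inst n \<theta>0 y) x" by (simp add: tuples_def)
    ultimately obtain z where z: "z \<in> tuples M n" "holds M' (inst n \<theta>0 y) z"
      using elem_sub_ex[OF MM' _ x(1)] by blast
    then have "z \<in> tuples M' n" "set z \<subseteq> univ M" "holds M' \<theta>0 (z @ y)"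
      using elem_sub_tuples[OF MM'] inst[of z] by (auto simp: tuples_def)
    then show False using R by (auto simp: R_def tuples_def)
  qed
  then have "\<not> (\<exists>y\<in>tuples (pair N' N) m. R (pair N' N) ([] @ y))"
    using expressible_elem_sub[OF ext sent, of "[]"] by (auto simp: tuples_def)
  moreover have "b \<in> tuples (pair N' N) m" using * N by (auto simp: tuples_def)
  ultimately have "\<not> R (pair N' N) b" by auto
  then show thesis using * a that by (auto simp: R_def tuples_def)
qed

section \<open>Cardinalities\<close>

text \<open>Iterated negations of \<open>Bot\<close> are pairwise different, and one of any two successive ones belongs
  to \<open>T\<close>. Thus adding finitely many parameters never exceeds the cardinals in question.\<close>

lemma complete_theory_infinite:
  fixes T :: "('f, 'r, 'a) fm set"
  assumes "complete_theory L T"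
  shows "infinite T"
proof
  assume "finite T"
  define f :: "nat \<Rightarrow> ('f, 'r, 'a) fm" where "f k = (Neg ^^ k) Bot" for k
  have inj: "inj f"
  proof (rule injI)
    fix i j show "f i = f j \<Longrightarrow> i = j"
    proof (induction i arbitrary: j)
      case 0 then show ?case by (cases j) (auto simp: f_def)
    next
      case (Suc i) then show ?case by (cases j) (auto simp: f_def)
    qed
  qed
  have "f k \<in> Fm L {} 0" for k
    by (induction k) (auto simp: f_def)
  moreover have "f (Suc k) = Neg (f k)" for k by (simp add: f_def)
  ultimately have T: "f k \<in> T \<or> f (Suc k) \<in> T" for k
    using assms by (auto simp: complete_theory_def)
  have "finite {k. f k \<in> T}"
    using finite_vimageI[OF \<open>finite T\<close> inj] by (simp add: vimage_def)
  then obtain k where "\<And>j. f j \<in> T \<Longrightarrow> j < k"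
    by (metis finite_nat_set_iff_bounded mem_Collect_eq)
  with T[of k] show False by force
qed

lemma finite_card_less: "finite A \<Longrightarrow> infinite B \<Longrightarrow> |A| <o |B|"
  by (rule finite_ordLess_infinite) (simp_all add: Field_card_of card_of_Well_order card_of_well_order_on)

lemma card_Un_finite_cardSuc:
  assumes "infinite T" "A \<subseteq> B \<union> F" "finite F"
  shows "|A| <o cardSuc ( |B| +c |T| )"
proof -
  have "|F| \<le>o |T|" using assms(1,3) finite_card_less ordLess_imp_ordLeq by blast
  then have "|B| +c |F| \<le>o |B| +c |T|" by (intro csum_mono2)
  moreover have "|A| \<le>o |B \<union> F|" using assms(2) by (rule card_of_mono1)
  ultimately have "|A| \<le>o |B| +c |T|" using Un_csum[of B F] by (meson ordLeq_transitive)
  then show ?thesis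
    using cardSuc_ordLeq_ordLess[OF Card_order_csum[of "|B|" "|T|"] card_of_Card_order[of A]] by simp
qed

lemma card_Un_finite_monster:
  assumes "infinite U" "|A| <o |U|" "finite F"
  shows "|A \<union> F| <o |U|"
  using card_of_Un_ordLess_infinite[OF assms(1,2) finite_card_less[OF assms(3,1)]] .

section \<open>Morley sequences\<close>

lemma expressible_mono: "expressible L A n R \<Longrightarrow> A \<subseteq> B \<Longrightarrow> expressible L B n R"
  unfolding expressible_def using Fm_mono[OF _ _ order_refl] by blast

lemma expressible_const:
  fixes R :: "('f, 'r, 'a) struct \<Rightarrow> 'a list \<Rightarrow> bool"
  assumes "expressible L A (n + m) R" "length b = m" "set b \<subseteq> A"
  shows "expressible L A n (\<lambda>K a. R K (a @ b))"
proof -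
  obtain \<phi> where \<phi>: "\<phi> \<in> Fm L A (n + m)" "\<And>K a. length a = n + m \<Longrightarrow> holds K \<phi> a \<longleftrightarrow> R K a"
    using assms(1) by (auto simp: expressible_def)
  have "expressible L A n (\<lambda>K a. holds K (inst n \<phi> b) a)"
    by (rule expressible_holds) (use \<phi>(1) assms in \<open>auto intro: inst_Fm\<close>)
  then show ?thesis
  proof (rule expressible_cong)
    fix K :: "('f, 'r, 'a) struct" and a :: "'a list"
    assume "length a = n"
    then show "holds K (inst n \<phi> b) a \<longleftrightarrow> R K (a @ b)"
      using holds_inst[of \<phi> L A a b K] \<phi>(1) \<phi>(2)[of "a @ b" K] assms(2) by simp
  qed
qed

lemma tp_eqI:
  assumes "length b = length b'"
    "\<And>\<phi>. \<phi> \<in> Fm L A (length b) \<Longrightarrow> holds K \<phi> b \<longleftrightarrow> holds K \<phi> b'"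
  shows "tp L K b A = tp L K b' A"
  using assms by (auto simp: tp_def)

lemma tp_append_const:
  assumes "tp L K c A = tp L K c' A" "length c = length c'" "set b \<subseteq> A"
  shows "tp L K (c @ b) A = tp L K (c' @ b) A"
proof (rule tp_eqI)
  fix \<phi> assume "\<phi> \<in> Fm L A (length (c @ b))"
  then have "expressible L A (length c) (\<lambda>K a. holds K \<phi> (a @ b))"
    using assms(3) by (intro expressible_const expressible_holds) auto
  then show "holds K \<phi> (c @ b) \<longleftrightarrow> holds K \<phi> (c' @ b)"
    using expressible_tp[OF assms(1) refl] assms(2) by metis
qed (use assms in auto)

lemma inv_typeI:
  fixes q :: "('f, 'r, 'a) fm set"
  assumes q: "q \<in> types L U (univ U) n"
    and imp: "\<And>m \<phi> b b'. \<phi> \<in> Fm L {} (n + m) \<Longrightarrow> b \<in> tuples U m \<Longrightarrow> b' \<in> tuples U m \<Longrightarrow>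
      tp L U b A = tp L U b' A \<Longrightarrow> inst n \<phi> b \<in> q \<Longrightarrow> inst n \<phi> b' \<in> q"
  shows "q \<in> inv_types L U A n"
proof -
  have "invariant L U A n (\<lambda>\<phi>. \<phi> \<in> q)"
    unfolding invariant_def
  proof (intro allI ballI impI iffI)
    fix m and \<phi> :: "('f, 'r, 'a) fm" and b b'
    assume *: "\<phi> \<in> Fm L {} (n + m)" "b \<in> tuples U m" "b' \<in> tuples U m" "tp L U b A = tp L U b' A"
    show "inst n \<phi> b' \<in> q" if "inst n \<phi> b \<in> q" using imp[OF *(1-4) that] .
    show "inst n \<phi> b \<in> q" if "inst n \<phi> b' \<in> q" using imp[OF *(1,3,2) *(4)[symmetric] that] .
  qed
  then show ?thesis using q by (simp add: inv_types_def)
qed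

text \<open>Invariance refers to formulas without parameters; parameters from \<open>A\<close> itself do no harm, since
  they can be appended to the tuples that are compared.\<close>

lemma inv_type_inst:
  assumes p: "p \<in> inv_types L U A n" and A: "A \<subseteq> univ U" and \<phi>: "\<phi> \<in> Fm L A (n + m)"
    and c: "c \<in> tuples U m" "c' \<in> tuples U m" "tp L U c A = tp L U c' A"
  shows "inst n \<phi> c \<in> p \<longleftrightarrow> inst n \<phi> c' \<in> p"
proof -
  have pt: "p \<in> types L U (univ U) n" using p by (simp add: inv_types_def)
  from Fm_abstract[OF \<phi>] obtain k \<phi>0 b where *: "\<phi>0 \<in> Fm L {} (n + m + k)" "length b = k" "set b \<subseteq> A"
    "\<And>K a. length a = n + m \<Longrightarrow> holds K \<phi>0 (a @ b) \<longleftrightarrow> holds K \<phi> a" by metis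
  have eq: "inst n \<phi> d \<in> p \<longleftrightarrow> inst n \<phi>0 (d @ b) \<in> p" if d: "d \<in> tuples U m" for d
  proof (rule type_cong[OF pt])
    have len: "length d = m" "set d \<subseteq> univ U" using d by (auto simp: tuples_def)
    show "inst n \<phi> d \<in> Fm L (univ U) n" by (rule inst_Fm[of _ _ A]) (use \<phi> A len in auto)
    show "inst n \<phi>0 (d @ b) \<in> Fm L (univ U) n"
      by (rule inst_Fm[of _ _ "{}"]) (use * A len in \<open>auto simp: add.assoc\<close>)
    fix a assume "a \<in> tuples U n"
    then have a: "length a = n" by (simp add: tuples_def)
    have "holds U (inst n \<phi> d) a \<longleftrightarrow> holds U \<phi> (a @ d)"
      using holds_inst[of \<phi> L A a d U] \<phi> a len by simp
    also have "\<dots> \<longleftrightarrow> holds U \<phi>0 (a @ d @ b)" using *(4)[of "a @ d" U] a len by simp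
    also have "\<dots> \<longleftrightarrow> holds U (inst n \<phi>0 (d @ b)) a"
      using holds_inst[of \<phi>0 L "{}" a "d @ b" U] * a len by (simp add: add.assoc)
    finally show "holds U (inst n \<phi> d) a \<longleftrightarrow> holds U (inst n \<phi>0 (d @ b)) a" .
  qed
  have "tp L U (c @ b) A = tp L U (c' @ b) A"
    using c *(3) by (intro tp_append_const) (auto simp: tuples_def)
  moreover have "c @ b \<in> tuples U (m + k)" "c' @ b \<in> tuples U (m + k)"
    using c * A by (auto simp: tuples_def)
  moreover have "\<phi>0 \<in> Fm L {} (n + (m + k))" using *(1) by (simp add: add.assoc)
  ultimately have "inst n \<phi>0 (c @ b) \<in> p \<longleftrightarrow> inst n \<phi>0 (c' @ b) \<in> p"
    using p unfolding inv_types_def invariant_def by blast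
  then show ?thesis using eq c by simp
qed

text \<open>Terms are listed in reverse order, the latest one first. In the concatenation the new term then
  occupies the variables that \<open>inst\<close> leaves free, and the earlier ones are its parameters.\<close>

fun morley ::
  "('f, 'r) lang \<Rightarrow> ('f, 'r, 'a) struct \<Rightarrow> ('f, 'r, 'a) fm set \<Rightarrow> 'a set \<Rightarrow> nat \<Rightarrow> 'a list list \<Rightarrow> bool"
where
  "morley L U p A n [] \<longleftrightarrow> True"
| "morley L U p A n (a # as) \<longleftrightarrow> a \<in> tuples U n \<and>
     (\<forall>\<phi>\<in>p \<inter> Fm L (A \<union> set (concat as)) n. holds U \<phi> a) \<and> morley L U p A n as"

lemma morley_tuples: "morley L U p A n as \<Longrightarrow> a \<in> set as \<Longrightarrow> a \<in> tuples U n"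
  by (induction as) auto

lemma morley_concat: "morley L U p A n as \<Longrightarrow> concat as \<in> tuples U (length as * n)"
  by (induction as) (auto simp: tuples_def)

text \<open>Whether the newest term satisfies \<open>\<phi>(x;c)\<close> is decided by \<open>\<phi>(x;c) \<in> p\<close>, where \<open>c\<close> are the
  earlier terms, and by invariance this depends only on the type of \<open>c\<close> over \<open>A\<close>.\<close>

lemma morley_tp:
  assumes p: "p \<in> inv_types L U A n" and A: "A \<subseteq> univ U"
  shows "length as = length bs \<Longrightarrow> morley L U p A n as \<Longrightarrow> morley L U p A n bs \<Longrightarrow>
    tp L U (concat as) A = tp L U (concat bs) A"
proof (induction as bs rule: list_induct2)
  case (Cons a as b bs)
  have pt: "p \<in> types L U (univ U) n" using p by (simp add: inv_types_def)
  let ?m = "length as * n"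
  have as: "concat as \<in> tuples U ?m" "concat bs \<in> tuples U ?m"
    using morley_concat[of L U p A n as] morley_concat[of L U p A n bs] Cons by auto
  have real: "holds U \<phi> (d @ concat ds) \<longleftrightarrow> inst n \<phi> (concat ds) \<in> p"
    if "\<phi> \<in> Fm L A (n + ?m)" "morley L U p A n (d # ds)" "concat ds \<in> tuples U ?m" for \<phi> d ds
  proof -
    have len: "length d = n" "length (concat ds) = ?m" "set (concat ds) \<subseteq> univ U"
      using that by (auto simp: tuples_def)
    have i: "inst n \<phi> (concat ds) \<in> Fm L (A \<union> set (concat ds)) n"
      by (rule inst_Fm[of _ _ A]) (use that len in auto)
    then have iU: "inst n \<phi> (concat ds) \<in> Fm L (univ U) n"
      by (rule Fm_mono) (use A len in auto)
    have D: "\<forall>\<phi>\<in>p \<inter> Fm L (A \<union> set (concat ds)) n. holds U \<phi> d" using that(2) by simp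
    have "holds U (inst n \<phi> (concat ds)) d \<longleftrightarrow> inst n \<phi> (concat ds) \<in> p"
    proof (cases "inst n \<phi> (concat ds) \<in> p")
      case True
      then show ?thesis using D i by blast
    next
      case False
      then have "Neg (inst n \<phi> (concat ds)) \<in> p" using type_Neg[OF pt iU] by simp
      moreover have "Neg (inst n \<phi> (concat ds)) \<in> Fm L (A \<union> set (concat ds)) n" using i by simp
      ultimately have "holds U (Neg (inst n \<phi> (concat ds))) d" using D by blast
      then show ?thesis using False by simp
    qed
    then show ?thesis using holds_inst[of \<phi> L A d "concat ds" U] that(1) len by simp
  qed
  have ab: "length a = n" "length b = n" using Cons.prems by (auto simp: tuples_def)
  have IH: "tp L U (concat as) A = tp L U (concat bs) A" using Cons by auto
  have "tp L U (a @ concat as) A = tp L U (b @ concat bs) A"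
  proof (rule tp_eqI)
    fix \<phi> assume "\<phi> \<in> Fm L A (length (a @ concat as))"
    moreover have "length (concat as) = ?m" using as by (simp add: tuples_def)
    ultimately have "\<phi> \<in> Fm L A (n + ?m)" using ab by simp
    then show "holds U \<phi> (a @ concat as) \<longleftrightarrow> holds U \<phi> (b @ concat bs)"
      using real[of \<phi> a as] real[of \<phi> b bs] inv_type_inst[OF p A _ as IH] Cons.prems as by simp
  qed (use as ab in \<open>auto simp: tuples_def\<close>)
  then show ?case by simp
qed simp

text \<open>The entries of the list are pairs of consecutive terms of a sequence, each with the later term
  first.\<close>

fun flat :: "('b \<times> 'b) list \<Rightarrow> 'b list" where
  "flat [] = []"
| "flat ((x, y) # ps) = x # y # flat ps"

lemma morley_mono:
  "a \<in> tuples U n \<Longrightarrow> \<forall>\<phi>\<in>p \<inter> Fm L (A \<union> B) n. holds U \<phi> a \<Longrightarrow> set (concat as) \<subseteq> B \<Longrightarrow>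
    morley L U p A n as \<Longrightarrow> morley L U p A n (a # as)"
proof -
  assume *: "a \<in> tuples U n" "\<forall>\<phi>\<in>p \<inter> Fm L (A \<union> B) n. holds U \<phi> a" "set (concat as) \<subseteq> B"
    "morley L U p A n as"
  have "Fm L (A \<union> set (concat as)) n \<subseteq> Fm L (A \<union> B) n"
    using *(3) by (intro subsetI, elim Fm_mono) auto
  then have "\<forall>\<phi>\<in>p \<inter> Fm L (A \<union> set (concat as)) n. holds U \<phi> a" using *(2) by blast
  then show ?thesis using *(1,4) by simp
qed

lemma morley_select:
  "morley L U p A n (flat ps) \<Longrightarrow> list_all2 (\<lambda>b (x, y). b = x \<or> b = y) bs ps \<Longrightarrow>
    morley L U p A n bs \<and> set (concat bs) \<subseteq> set (concat (flat ps))"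
proof (induction ps arbitrary: bs rule: flat.induct)
  case (2 x y ps)
  then obtain b bs' where bs: "bs = b # bs'" "b = x \<or> b = y"
    "list_all2 (\<lambda>b (x, y). b = x \<or> b = y) bs' ps"
    by (auto simp: list_all2_Cons2)
  have IH: "morley L U p A n bs'" "set (concat bs') \<subseteq> set (concat (flat ps))"
    using 2 bs(3) by auto
  have "morley L U p A n (b # bs')"
  proof (cases "b = x")
    case True
    show ?thesis
      by (rule morley_mono[where B = "set (concat (y # flat ps))"]) (use 2(2) IH True in auto)
  next
    case False
    show ?thesis
      by (rule morley_mono[where B = "set (concat (flat ps))"]) (use 2(2) IH bs(2) False in auto)
  qed
  then show ?case using IH bs by auto
qed simp

lemma morley_filter:
  "morley L U p A n (flat ps) \<Longrightarrow> morley L U p A n (flat (filter Q ps)) \<and>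
    set (concat (flat (filter Q ps))) \<subseteq> set (concat (flat ps))"
proof (induction ps rule: flat.induct)
  case (2 x y ps)
  then have IH: "morley L U p A n (flat (filter Q ps))"
    "set (concat (flat (filter Q ps))) \<subseteq> set (concat (flat ps))" by auto
  have y: "morley L U p A n (y # flat (filter Q ps))"
    by (rule morley_mono[where B = "set (concat (flat ps))"]) (use 2(2) IH in auto)
  have "morley L U p A n (x # y # flat (filter Q ps))"
    by (rule morley_mono[where B = "set (concat (y # flat ps))"]) (use 2(2) IH y in auto)
  then show ?case using IH by auto
qed simp

lemma concat_nth_uniform:
  "(\<And>x. x \<in> set bs \<Longrightarrow> length x = n) \<Longrightarrow> i < length bs \<Longrightarrow> j < n \<Longrightarrow> concat bs ! (i * n + j) = bs ! i ! j"
proof (induction bs arbitrary: i)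
  case (Cons b bs)
  then show ?case by (cases i) (auto simp: nth_append)
qed simp

text \<open>An alternation of \<open>\<phi>(x;d)\<close> along a Morley sequence can, by indiscernibility, be turned into
  a shattered family of the same length: a pattern \<open>I\<close> on one subsequence is realised by picking
  from each pair of consecutive terms the one with the prescribed truth value.\<close>

lemma NIP_morley_alternation:
  fixes L :: "('f, 'r) lang" and U :: "('f, 'r, 'a) struct"
  assumes "NIP L U" "\<phi> \<in> Fm L {} (n + m)"
  obtains k where "\<And>A p ps d. A \<subseteq> univ U \<Longrightarrow> p \<in> inv_types L U A n \<Longrightarrow> morley L U p A n (flat ps) \<Longrightarrow>
    d \<in> tuples U m \<Longrightarrow> (\<And>x y. (x, y) \<in> set ps \<Longrightarrow> holds U \<phi> (x @ d) \<and> \<not> holds U \<phi> (y @ d)) \<Longrightarrow>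
    length ps < k"
proof -
  let ?S = "\<lambda>k a. (\<forall>i<k. a i \<in> tuples U n) \<and>
      (\<forall>I\<subseteq>{..<k}. \<exists>b\<in>tuples U m. \<forall>i<k. holds U \<phi> (a i @ b) \<longleftrightarrow> i \<in> I)"
  have "\<exists>k::nat. \<not> (\<exists>a. ?S k a)"
    using assms(1)[unfolded NIP_def, rule_format, OF assms(2)] unfolding NIP_formula_def .
  then obtain k :: nat where k: "\<not> ?S k a" for a by iprover
  show thesis
  proof (rule that[of k], rule ccontr)
    fix A p and ps :: "('a list \<times> 'a list) list" and d
    assume A: "A \<subseteq> univ U" and p: "p \<in> inv_types L U A n" and mor: "morley L U p A n (flat ps)"
      and d: "d \<in> tuples U m"
      and alt: "\<And>x y. (x, y) \<in> set ps \<Longrightarrow> holds U \<phi> (x @ d) \<and> \<not> holds U \<phi> (y @ d)"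
      and "\<not> length ps < k"
    define l where "l = length ps"
    have kl: "k \<le> l" using \<open>\<not> length ps < k\<close> by (simp add: l_def)
    define sel where "sel I = map (\<lambda>i. if i \<in> I then fst (ps ! i) else snd (ps ! i)) [0..<l]" for I
    have sel: "morley L U p A n (sel I)" for I
    proof -
      have "list_all2 (\<lambda>b (x, y). b = x \<or> b = y) (sel I) ps"
        by (auto simp: list_all2_conv_all_nth sel_def l_def split: prod.splits)
      then show ?thesis using morley_select[OF mor] by blast
    qed
    have len: "length (sel I) = l" for I by (simp add: sel_def)
    have tup: "sel I ! i \<in> tuples U n" if "i < l" for I i
      using morley_tuples[OF sel[of I]] len that by simp
    \<comment> \<open>\<open>f i\<close> places the variables of \<open>\<phi>(x;y)\<close>: \<open>x\<close> at the \<open>i\<close>-th of \<open>l\<close> blocks, \<open>y\<close> after all of them.\<close>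
    define f where "f i j = (if j < n then i * n + j else l * n + (j - n))" for i j
    have in_block: "i * n + j < l * n" if "i < l" "j < n" for i j
    proof -
      have "Suc i * n \<le> l * n" using that(1) by (intro mult_le_mono1) simp
      then show ?thesis using that(2) by simp
    qed
    \<comment> \<open>\<open>R I\<close> says that some \<open>b\<close> cuts out the pattern \<open>I\<close> on the first \<open>k\<close> blocks.\<close>
    define R where "R I K z \<longleftrightarrow> (\<exists>b\<in>tuples K m. \<forall>i\<in>{..<k}.
      holds K \<phi> (map (\<lambda>j. (z @ b) ! f i j) [0..<n + m]) \<longleftrightarrow> i \<in> I)"
      for I :: "nat set" and K :: "('f, 'r, 'a) struct" and z
    have "expressible L {} (l * n) (R I)" for I
      unfolding R_def
    proof (intro expressible_ex expressible_Ball expressible_iff)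
      fix i assume "i \<in> {..<k}"
      then have i: "i < l" using kl by simp
      show "expressible L {} (l * n + m)
          (\<lambda>K z. holds K \<phi> (map (\<lambda>j. z ! f i j) [0..<n + m]))"
      proof (rule expressible_reindex[OF expressible_holds[OF assms(2)]])
        show "inj_on (f i) {..<n + m}"
          using in_block[OF i] by (force simp: inj_on_def f_def split: if_splits)
        show "f i ` {..<n + m} \<subseteq> {..<l * n + m}"
          using in_block[OF i] by (force simp: f_def split: if_splits)
      qed
    qed simp
    then have ex: "expressible L A (l * n) (R I)" for I by (rule expressible_mono) simp
    have block: "map (\<lambda>j. (concat (sel I) @ b) ! f i j) [0..<n + m] = sel I ! i @ b"
      if "i < l" "length b = m" for I i b
    proof (rule nth_equalityI)
      have lc: "length (concat (sel I)) = l * n"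
        using morley_concat[OF sel[of I]] len by (simp add: tuples_def)
      have le: "length (sel I ! i) = n" using tup[OF that(1)] by (simp add: tuples_def)
      show "length (map (\<lambda>j. (concat (sel I) @ b) ! f i j) [0..<n + m]) = length (sel I ! i @ b)"
        using le that by simp
      fix j assume "j < length (map (\<lambda>j. (concat (sel I) @ b) ! f i j) [0..<n + m])"
      then have j: "j < n + m" by simp
      have "concat (sel I) ! (i * n + j) = sel I ! i ! j" if "j < n"
        by (rule concat_nth_uniform)
          (use morley_tuples[OF sel[of I]] len \<open>i < l\<close> that in \<open>auto simp: tuples_def\<close>)
      then show "map (\<lambda>j. (concat (sel I) @ b) ! f i j) [0..<n + m] ! j = (sel I ! i @ b) ! j"
        using j lc le in_block[OF \<open>i < l\<close>] by (auto simp: nth_append f_def)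
    qed
    have Riff: "R J U (concat (sel I)) \<longleftrightarrow>
        (\<exists>b\<in>tuples U m. \<forall>i<k. holds U \<phi> (sel I ! i @ b) \<longleftrightarrow> i \<in> J)" for I J
      unfolding R_def
    proof (rule bex_cong[OF refl])
      fix b assume "b \<in> tuples U m"
      then have "map (\<lambda>j. (concat (sel I) @ b) ! f i j) [0..<n + m] = sel I ! i @ b" if "i < k" for i
        using block[of i b I] that kl by (simp add: tuples_def)
      then show "(\<forall>i\<in>{..<k}. holds U \<phi> (map (\<lambda>j. (concat (sel I) @ b) ! f i j) [0..<n + m]) \<longleftrightarrow> i \<in> J)
          \<longleftrightarrow> (\<forall>i<k. holds U \<phi> (sel I ! i @ b) \<longleftrightarrow> i \<in> J)"
        by (simp del: map_append add: Ball_def)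
    qed
    have "R I U (concat (sel {}))" for I
    proof -
      have "holds U \<phi> (sel I ! i @ d) \<longleftrightarrow> i \<in> I" if "i < k" for i
        using alt[of "fst (ps ! i)" "snd (ps ! i)"] that kl by (auto simp: sel_def l_def)
      then have "R I U (concat (sel I))" unfolding Riff using d by blast
      moreover have "length (concat (sel J)) = l * n" for J
        using morley_concat[OF sel[of J]] len by (simp add: tuples_def)
      moreover have "tp L U (concat (sel I)) A = tp L U (concat (sel {})) A"
        by (rule morley_tp[OF p A _ sel sel]) (simp add: len)
      ultimately show ?thesis
        using expressible_tp[OF _ _ _ ex[of I]] by blast
    qed
    then have "\<exists>b\<in>tuples U m. \<forall>i<k. holds U \<phi> (sel {} ! i @ b) \<longleftrightarrow> i \<in> I" for I
      by (simp only: Riff)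
    moreover have "\<forall>i<k. sel {} ! i \<in> tuples U n" using tup kl by simp
    ultimately show False using k[of "\<lambda>i. sel {} ! i"] by simp
  qed
qed

text \<open>A point of \<open>A\<close> in \<open>\<phi>(x;b) \<and> \<not> \<phi>(x;b')\<close> would tell the types of \<open>b\<close> and \<open>b'\<close> over \<open>A\<close>
  apart.\<close>

lemma coheir_invariant:
  fixes L :: "('f, 'r) lang" and U :: "('f, 'r, 'a) struct"
  assumes q: "q \<in> types L U (univ U) n" "finsat U {a. length a = n \<and> set a \<subseteq> A} q"
  shows "q \<in> inv_types L U A n"
proof (rule inv_typeI[OF q(1)])
  fix m \<phi> b b'
  assume \<phi>: "\<phi> \<in> Fm L {} (n + m)" and b: "b \<in> tuples U m" "b' \<in> tuples U m"
    and eq: "tp L U b A = tp L U b' A" and q1: "inst n \<phi> b \<in> q"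
  show "inst n \<phi> b' \<in> q"
  proof (rule ccontr)
    assume "inst n \<phi> b' \<notin> q"
    moreover have "inst n \<phi> b' \<in> Fm L (univ U) n"
      by (rule inst_Fm[of _ _ "{}"]) (use \<phi> b in \<open>auto simp: tuples_def\<close>)
    ultimately have "Neg (inst n \<phi> b') \<in> q" using type_Neg[OF q(1)] by simp
    then have "\<exists>a\<in>{a. length a = n \<and> set a \<subseteq> A}. \<forall>\<psi>\<in>{inst n \<phi> b, Neg (inst n \<phi> b')}. holds U \<psi> a"
      by (intro finsatD[OF q(2)]) (use q1 in auto)
    then obtain a where a: "length a = n" "set a \<subseteq> A"
      and ha: "holds U (inst n \<phi> b) a" "\<not> holds U (inst n \<phi> b') a"
      by auto
    have h: "holds U \<phi> (a @ c) \<longleftrightarrow> holds U (inst n \<phi> c) a" if "c \<in> tuples U m" for c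
      using holds_inst[of \<phi> L "{}" a c U] \<phi> a that by (simp add: tuples_def)
    have "expressible L A (m + n) (\<lambda>K c. holds K \<phi> (drop m c @ take m c))"
      using \<phi> by (intro expressible_swap expressible_holds) (auto intro: Fm_mono)
    from expressible_const[OF this a] have "expressible L A m (\<lambda>K y. holds K \<phi> (a @ y))"
      by (rule expressible_cong) simp
    from expressible_tp[OF eq _ _ this] show False
      using ha b h by (simp add: tuples_def)
  qed
qed

section \<open>The type \<open>F\<^sub>M(p)\<close>\<close>

locale nip_pair =
  fixes L :: "('f, 'r) lang" and T :: "('f, 'r, 'a) fm set"
    and U M M' N' :: "('f, 'r, 'a) struct" and N PU :: "'a set" and n :: nat
  assumes complete: "complete_theory L T" and monster: "monster L T U" and nip: "NIP L U"
    and MU: "elem_sub L M U" and small_M: "small U (univ M)"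
    and MM'_plus: "elem_sub_plus L T M M'"
    and N_sub: "N \<subseteq> univ N'"
    and N_plus: "elem_sub_plus (LP L) T (pair M' (univ M)) (pair N' N)"
    and PU_sub: "PU \<subseteq> univ U" and N'U_pair: "elem_sub (LP L) (pair N' N) (pair U PU)"
begin

lemma MM': "elem_sub L M M'"
  using MM'_plus by (simp add: elem_sub_plus_def)

lemma M'N'_pair: "elem_sub (LP L) (pair M' (univ M)) (pair N' N)"
  using N_plus by (simp add: elem_sub_plus_def)

lemma M'N': "elem_sub L M' N'" and N'U: "elem_sub L N' U"
  using elem_sub_reduct[OF M'N'_pair] elem_sub_reduct[OF N'U_pair] by auto

lemma M'U: "elem_sub L M' U"
  using elem_sub_trans[OF M'N' N'U] .

lemma subs: "univ M \<subseteq> univ U" "univ M \<subseteq> univ M'" "univ M' \<subseteq> univ N'" "univ N' \<subseteq> univ U"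
    "univ M' \<subseteq> univ U" "N \<subseteq> univ U"
  using MU MM' M'N' N'U N_sub by (auto simp: elem_sub_def)

lemma infinite_T: "infinite T"
  using complete_theory_infinite[OF complete] .

lemma saturated_U: "saturated L U |univ U|" and infinite_U: "infinite (univ U)"
proof -
  show "saturated L U |univ U|" using monster by (simp add: monster_def)
  have "|T| <o |univ U|" using monster by (simp add: monster_def)
  then show "infinite (univ U)"
    using infinite_T card_of_ordLeq_finite ordLess_imp_ordLeq by blast
qed

lemma M_sub_N: "univ M \<subseteq> N" and N_sub_PU: "N \<subseteq> PU"
proof -
  have "x \<in> Q" if "elem_sub (LP L) (pair A P) (pair B Q)" "x \<in> P" "x \<in> univ A"
    for x :: 'a and A B P Q
  proof -
    have "holds (pair A P) (Pfm 1) [x] \<longleftrightarrow> holds (pair B Q) (Pfm 1) [x]"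
      using that by (intro expressible_elem_sub[OF that(1), where n = 1] expressible_holds)
        (auto simp: tuples_def)
    then show "x \<in> Q" using that(2) by simp
  qed
  then show "univ M \<subseteq> N" "N \<subseteq> PU" using M'N'_pair N'U_pair subs N_sub by blast+
qed

lemma realize_tp_M:
  assumes "b \<in> tuples U m"
  obtains b' where "b' \<in> tuples M' m" "tp L U b' (univ M) = tp L U b (univ M)"
proof -
  have b: "length b = m" using assms by (simp add: tuples_def)
  have Fm: "tp L U b (univ M) \<subseteq> Fm L (univ M) m" using b by (auto simp: tp_def)
  have "finsat M' (tuples M' m) (tp L U b (univ M))"
    unfolding finsat_def
  proof (intro allI impI)
    fix F assume F: "finite F" "F \<subseteq> tp L U b (univ M)"
    then have FM: "F \<subseteq> Fm L (univ M) m" using Fm by blast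
    from Fm_finite_conj[OF F(1) FM] obtain \<psi> where \<psi>: "\<psi> \<in> Fm L (univ M) m"
      "\<And>K a. holds K \<psi> a \<longleftrightarrow> (\<forall>\<phi>\<in>F. holds K \<phi> a)" by metis
    have "holds U \<psi> b" using F(2) by (auto simp: \<psi>(2) tp_def)
    moreover have "\<psi> \<in> Fm L (univ M') m" using \<psi>(1) subs by (auto intro: Fm_mono)
    ultimately obtain a where "a \<in> tuples M' m" "holds M' \<psi> a"
      using elem_sub_ex[OF M'U _ assms] by metis
    then show "\<exists>a\<in>tuples M' m. \<forall>\<phi>\<in>F. holds M' \<phi> a" by (auto simp: \<psi>(2))
  qed
  moreover have "|univ M| <o cardSuc ( |univ M| +c |T| )"
    using card_Un_finite_cardSuc[OF infinite_T, of "univ M" "univ M" "{}"] by simp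
  moreover have "saturated L M' (cardSuc ( |univ M| +c |T| ))"
    using MM'_plus by (simp add: elem_sub_plus_def)
  ultimately obtain b' where b': "b' \<in> tuples M' m" "\<And>\<phi>. \<phi> \<in> tp L U b (univ M) \<Longrightarrow> holds M' \<phi> b'"
    using saturated_realize[of L M' _ "univ M" "tp L U b (univ M)" m] Fm subs by blast
  have b'U: "b' \<in> tuples U m" using b' elem_sub_tuples[OF M'U] by blast
  have "tp L U b (univ M) \<subseteq> tp L U b' (univ M)"
  proof
    fix \<phi> assume \<phi>: "\<phi> \<in> tp L U b (univ M)"
    have "\<phi> \<in> Fm L (univ M') m" using \<phi> Fm subs Fm_mono by blast
    then have "holds U \<phi> b'" using b' \<phi> holds_elem_sub[OF M'U] by blast
    then show "\<phi> \<in> tp L U b' (univ M)" using \<phi> Fm b' by (auto simp: tp_def tuples_def)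
  qed
  from type_eqI[OF tp_type[OF assms] tp_type[OF b'U] this]
  show thesis using that b'(1) by metis
qed

lemma FM_base_Fm: "FM_base L M' N' N n p \<subseteq> Fm L (univ M') n"
  by (auto simp: FM_base_def)

text \<open>If neither \<open>\<phi>\<close> nor its negation followed from \<open>p\<^sub>|\<^sub>N \<union> {P(x)}\<close>, saturation of the pair
  would produce a Morley sequence of \<open>p\<close> over \<open>M\<close> along which \<open>\<phi>\<close> alternates. Its terms lie in
  \<open>N\<close>, so at each stage the type to be realised is part of \<open>p\<^sub>|\<^sub>N\<close>.\<close>

lemma FM_base_decides:
  assumes p: "p \<in> inv_types L U (univ M) n" and \<phi>: "\<phi> \<in> Fm L (univ M') n"
  shows "\<phi> \<in> FM_base L M' N' N n p \<or> Neg \<phi> \<in> FM_base L M' N' N n p"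
proof (rule ccontr)
  assume contra: "\<not> ?thesis"
  have pt: "p \<in> types L U (univ U) n" using p by (simp add: inv_types_def)
  let ?\<Sigma> = "lift ` (p \<inter> Fm L N n) \<union> {Pfm n}"
  \<comment> \<open>\<open>p\<^sub>|\<^sub>N \<union> {P(x)}\<close> is consistent with \<open>\<phi>\<close> and with its negation; \<open>s\<close> tells which.\<close>
  have fs: "\<exists>a\<in>tuples N' n. (\<forall>\<theta>\<in>F. holds (pair N' N) \<theta> a) \<and> (holds N' \<phi> a \<longleftrightarrow> s)"
    if "finite F" "F \<subseteq> ?\<Sigma>" for F s
  proof -
    have "\<not> implies (pair N' N) n ?\<Sigma> (lift (if s then Neg \<phi> else \<phi>))"
      using contra \<phi> by (auto simp: FM_base_def)
    then have "\<exists>a\<in>tuples (pair N' N) n. (\<forall>\<theta>\<in>F. holds (pair N' N) \<theta> a) \<and>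
        \<not> holds (pair N' N) (lift (if s then Neg \<phi> else \<phi>)) a"
      unfolding implies_def using that by blast
    then show ?thesis by (cases s) auto
  qed
  \<comment> \<open>Both can be realised in \<open>N\<close> over \<open>M\<close> and finitely many points \<open>B\<close>: these are few parameters.\<close>
  have step: "\<exists>a. a \<in> tuples U n \<and> set a \<subseteq> N \<and> (\<forall>\<theta>\<in>p \<inter> Fm L (univ M \<union> B) n. holds U \<theta> a) \<and>
      (holds U \<phi> a \<longleftrightarrow> s)" if B: "finite B" "B \<subseteq> N" for B s
  proof -
    let ?lit = "lift (if s then \<phi> else Neg \<phi>)"
    let ?\<Gamma> = "lift ` (p \<inter> Fm L (univ M \<union> B) n) \<union> {Pfm n, ?lit}"
    let ?A = "univ M \<union> B \<union> pars \<phi>"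
    have MBN: "univ M \<union> B \<subseteq> N" using M_sub_N B by blast
    have \<phi>M': "pars \<phi> \<subseteq> univ M'" using \<phi> by (auto simp: Fm_def)
    have "?\<Gamma> \<subseteq> Fm (LP L) ?A n"
    proof -
      have "\<phi> \<in> Fm L ?A n" using Fm_over_pars[OF \<phi>] by (rule Fm_mono) auto
      moreover have "Fm L (univ M \<union> B) n \<subseteq> Fm L ?A n" using Fm_mono by blast
      ultimately show ?thesis by auto
    qed
    moreover have "finsat (pair N' N) (tuples (pair N' N) n) ?\<Gamma>"
      unfolding finsat_def
    proof (intro allI impI)
      fix F assume F: "finite F" "F \<subseteq> ?\<Gamma>"
      have "Fm L (univ M \<union> B) n \<subseteq> Fm L N n" using Fm_mono[OF _ MBN order_refl] by blast
      then have "F - {?lit} \<subseteq> ?\<Sigma>" using F(2) by blast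
      then obtain a where "a \<in> tuples N' n" "\<forall>\<theta>\<in>F - {?lit}. holds (pair N' N) \<theta> a"
          "holds N' \<phi> a \<longleftrightarrow> s"
        using fs[of "F - {?lit}" s] F(1) by auto
      then show "\<exists>a\<in>tuples (pair N' N) n. \<forall>\<theta>\<in>F. holds (pair N' N) \<theta> a"
        by (intro bexI[of _ a]) (cases s; auto)+
    qed
    moreover have "?A \<subseteq> univ (pair N' N)" using MBN \<phi>M' subs N_sub by auto
    moreover have "|?A| <o cardSuc ( |univ (pair M' (univ M))| +c |T| )"
      by (rule card_Un_finite_cardSuc[OF infinite_T _ B(1)]) (use subs \<phi>M' in auto)
    moreover have "saturated (LP L) (pair N' N) (cardSuc ( |univ (pair M' (univ M))| +c |T| ))"
      using N_plus by (simp only: elem_sub_plus_def)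
    ultimately obtain a where a: "a \<in> tuples (pair N' N) n"
      "\<And>\<theta>. \<theta> \<in> ?\<Gamma> \<Longrightarrow> holds (pair N' N) \<theta> a"
      using saturated_realize[of "LP L" "pair N' N" _ ?A ?\<Gamma> n] by blast
    have a1: "a \<in> tuples N' n" "length a = n" using a(1) by (auto simp: tuples_def)
    have "set a \<subseteq> N" using a(2)[of "Pfm n"] a1 by simp
    moreover have "holds N' \<phi> a \<longleftrightarrow> s" using a(2)[of ?lit] by (cases s) auto
    then have "holds U \<phi> a \<longleftrightarrow> s"
      using holds_elem_sub[OF N'U _ a1(1)] Fm_mono[OF \<phi>] subs by blast
    moreover have "holds U \<theta> a" if "\<theta> \<in> p \<inter> Fm L (univ M \<union> B) n" for \<theta>
    proof -
      have "holds N' \<theta> a" using a(2)[of "lift \<theta>"] that by auto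
      moreover have "\<theta> \<in> Fm L (univ N') n" using that Fm_mono[of \<theta> L "univ M \<union> B" n "univ N'" n] MBN N_sub by auto
      ultimately show ?thesis using holds_elem_sub[OF N'U _ a1(1)] by blast
    qed
    moreover have "a \<in> tuples U n" using a1 elem_sub_tuples[OF N'U] by blast
    ultimately show ?thesis by blast
  qed
  from Fm_abstract[OF \<phi>] obtain m \<phi>0 d where \<phi>0: "\<phi>0 \<in> Fm L {} (n + m)" "length d = m"
    "set d \<subseteq> univ M'" "\<And>K a. length a = n \<Longrightarrow> holds K \<phi>0 (a @ d) \<longleftrightarrow> holds K \<phi> a" by metis
  have dU: "d \<in> tuples U m" using \<phi>0 subs by (auto simp: tuples_def)
  have build: "\<exists>ps. length ps = l \<and> morley L U p (univ M) n (flat ps) \<and> set (concat (flat ps)) \<subseteq> N \<and>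
      (\<forall>(x, y)\<in>set ps. holds U \<phi>0 (x @ d) \<and> \<not> holds U \<phi>0 (y @ d))" for l
  proof (induction l)
    case 0
    show ?case by (rule exI[of _ "[]"]) simp
  next
    case (Suc l)
    then obtain ps where ps: "length ps = l" "morley L U p (univ M) n (flat ps)"
      "set (concat (flat ps)) \<subseteq> N" "\<forall>(x, y)\<in>set ps. holds U \<phi>0 (x @ d) \<and> \<not> holds U \<phi>0 (y @ d)"
      by blast
    obtain y where y: "y \<in> tuples U n" "set y \<subseteq> N" "\<not> holds U \<phi> y"
      "\<forall>\<theta>\<in>p \<inter> Fm L (univ M \<union> set (concat (flat ps))) n. holds U \<theta> y"
      using step[of "set (concat (flat ps))" False] ps(3) by blast
    have "set (concat (y # flat ps)) \<subseteq> N" using y(2) ps(3) by auto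
    then obtain x where x: "x \<in> tuples U n" "set x \<subseteq> N" "holds U \<phi> x"
      "\<forall>\<theta>\<in>p \<inter> Fm L (univ M \<union> set (concat (y # flat ps))) n. holds U \<theta> x"
      using step[of "set (concat (y # flat ps))" True] by blast
    have "morley L U p (univ M) n (flat ((x, y) # ps))"
      using ps(2) x(1,4) y(1,4) by (simp only: flat.simps morley.simps simp_thms)
    moreover have "holds U \<phi>0 (x @ d) \<and> \<not> holds U \<phi>0 (y @ d)"
      using x y \<phi>0(4) by (simp add: tuples_def)
    ultimately show ?case using ps x(2) y(2) by (intro exI[of _ "(x, y) # ps"]) auto
  qed
  from NIP_morley_alternation[OF nip \<phi>0(1)] obtain k where k:
    "\<And>A p ps d. A \<subseteq> univ U \<Longrightarrow> p \<in> inv_types L U A n \<Longrightarrow> morley L U p A n (flat ps) \<Longrightarrow>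
      d \<in> tuples U m \<Longrightarrow> (\<And>x y. (x, y) \<in> set ps \<Longrightarrow> holds U \<phi>0 (x @ d) \<and> \<not> holds U \<phi>0 (y @ d)) \<Longrightarrow>
      length ps < k" by metis
  from build[of k] obtain ps where ps: "length ps = k" "morley L U p (univ M) n (flat ps)"
      "\<forall>(x, y)\<in>set ps. holds U \<phi>0 (x @ d) \<and> \<not> holds U \<phi>0 (y @ d)" by blast
  have "length ps < k"
    by (rule k[OF subs(1) p ps(2) dU]) (use ps(3) in blast)
  then show False using ps(1) by simp
qed

text \<open>The possible reasons for \<open>\<phi>\<close> to belong to \<open>F\<^sub>M(p)\<close>, independently of \<open>p\<close>.\<close>

definition \<Theta> :: "('f, 'r, 'a) fm \<Rightarrow> ('f, 'r, 'a) fm set" where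
  "\<Theta> \<phi> = {\<theta> \<in> Fm L N n. \<forall>a\<in>tuples N' n. set a \<subseteq> N \<longrightarrow> holds N' \<theta> a \<longrightarrow> holds N' \<phi> a}"

lemma \<Theta>_Fm: "\<Theta> \<phi> \<subseteq> Fm L (univ U) n"
  using Fm_mono[OF _ subs(6) order_refl] by (auto simp: \<Theta>_def)

text \<open>Finitely many formulas of \<open>p\<^sub>|\<^sub>N\<close> can be replaced by their conjunction, which again belongs
  to \<open>p\<^sub>|\<^sub>N\<close>.\<close>

lemma FM_base_iff:
  assumes pt: "p \<in> types L U (univ U) n" and \<phi>: "\<phi> \<in> Fm L (univ M') n"
  shows "\<phi> \<in> FM_base L M' N' N n p \<longleftrightarrow> (\<exists>\<theta>\<in>\<Theta> \<phi>. \<theta> \<in> p)"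
proof -
  have "\<phi> \<in> FM_base L M' N' N n p \<longleftrightarrow>
      implies (pair N' N) n (lift ` (p \<inter> Fm L N n) \<union> {Pfm n}) (lift \<phi>)"
    using \<phi> by (simp add: FM_base_def)
  also have "\<dots> \<longleftrightarrow> (\<exists>\<theta>\<in>\<Theta> \<phi>. \<theta> \<in> p)"
  proof
    assume "implies (pair N' N) n (lift ` (p \<inter> Fm L N n) \<union> {Pfm n}) (lift \<phi>)"
    then obtain S where S: "S \<subseteq> lift ` (p \<inter> Fm L N n) \<union> {Pfm n}" "finite S"
      "\<forall>a\<in>tuples N' n. (\<forall>\<xi>\<in>S. holds (pair N' N) \<xi> a) \<longrightarrow> holds N' \<phi> a"
      unfolding implies_def by auto
    then have "finite (S - {Pfm n})" "S - {Pfm n} \<subseteq> lift ` (p \<inter> Fm L N n)" by auto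
    from finite_subset_image[OF this] obtain G where
      G: "G \<subseteq> p \<inter> Fm L N n" "finite G" "S - {Pfm n} = lift ` G" by blast
    have "G \<subseteq> Fm L N n" using G(1) by simp
    from Fm_finite_conj[OF G(2) this] obtain \<theta> where \<theta>: "\<theta> \<in> Fm L N n"
      "\<And>K a. holds K \<theta> a \<longleftrightarrow> (\<forall>\<phi>\<in>G. holds K \<phi> a)" by metis
    have "holds N' \<phi> a" if a: "a \<in> tuples N' n" "set a \<subseteq> N" "holds N' \<theta> a" for a
    proof -
      have "holds (pair N' N) \<xi> a" if "\<xi> \<in> S" for \<xi>
      proof (cases "\<xi> = Pfm n")
        case True
        then show ?thesis using a by (simp add: tuples_def)
      next
        case False
        then have "\<xi> \<in> lift ` G" using G(3) that by blast
        then show ?thesis using a(3) \<theta>(2) by auto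
      qed
      then show ?thesis using S(3) a(1) by blast
    qed
    then have "\<theta> \<in> \<Theta> \<phi>" using \<theta>(1) by (simp add: \<Theta>_def)
    moreover have "\<theta> \<in> p"
    proof (rule type_consequence[OF pt G(2)])
      show "G \<subseteq> p" using G(1) by blast
      show "\<theta> \<in> Fm L (univ U) n" by (rule Fm_mono[OF \<theta>(1) subs(6) order_refl])
      show "holds U \<theta> a" if "\<forall>\<phi>\<in>G. holds U \<phi> a" for a using that by (simp add: \<theta>(2))
    qed
    ultimately show "\<exists>\<theta>\<in>\<Theta> \<phi>. \<theta> \<in> p" by blast
  next
    assume "\<exists>\<theta>\<in>\<Theta> \<phi>. \<theta> \<in> p"
    then obtain \<theta> where \<theta>: "\<theta> \<in> \<Theta> \<phi>" "\<theta> \<in> p" by blast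
    have "{lift \<theta>, Pfm n} \<subseteq> lift ` (p \<inter> Fm L N n) \<union> {Pfm n}" using \<theta> by (auto simp: \<Theta>_def)
    moreover have "holds (pair N' N) (lift \<phi>) a"
      if "a \<in> tuples (pair N' N) n" "\<forall>\<xi>\<in>{lift \<theta>, Pfm n}. holds (pair N' N) \<xi> a" for a
      using that \<theta>(1) by (auto simp: \<Theta>_def tuples_def)
    ultimately show "implies (pair N' N) n (lift ` (p \<inter> Fm L N n) \<union> {Pfm n}) (lift \<phi>)"
      unfolding implies_def by (intro exI[of _ "{lift \<theta>, Pfm n}"]) simp
  qed
  finally show ?thesis .
qed

text \<open>Every \<open>L(N)\<close>-formula of \<open>p\<close> has a solution in \<open>N\<close>, since \<open>N\<close> is elementary in
  \<open>N'\<close> for the language without predicate.\<close>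

lemma realize_in_N:
  assumes p: "p \<in> types L U (univ U) n" and G: "finite G" "G \<subseteq> p \<inter> Fm L N n"
  obtains c where "length c = n" "set c \<subseteq> N" "\<forall>\<phi>\<in>G. holds N' \<phi> c"
proof -
  have "G \<subseteq> Fm L N n" using G(2) by simp
  from Fm_finite_conj[OF G(1) this] obtain \<theta> where \<theta>: "\<theta> \<in> Fm L N n"
    "\<And>K a. holds K \<theta> a \<longleftrightarrow> (\<forall>\<phi>\<in>G. holds K \<phi> a)" by metis
  have "G \<subseteq> p" using G(2) by blast
  from type_sat[OF p G(1) this] obtain a0 where a0: "a0 \<in> tuples U n" "holds U \<theta> a0"
    by (auto simp: \<theta>(2))
  from elem_sub_ex[OF N'U Fm_mono[OF \<theta>(1) N_sub order_refl] a0]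
  obtain a1 where a1: "a1 \<in> tuples N' n" "holds N' \<theta> a1" by metis
  from pair_Tarski_Vaught[OF MM' M'N'_pair N_sub \<theta>(1) a1]
  obtain c where "length c = n" "set c \<subseteq> N" "holds N' \<theta> c" .
  then show thesis using that by (simp add: \<theta>(2))
qed

text \<open>A consequence of
  \<open>\<theta>(x) \<and> P(x)\<close> with \<open>\<theta> \<in> p\<^sub>|\<^sub>N\<close> has a solution in \<open>N\<close>, and having a solution in the predicate
  transfers down to \<open>(M',M)\<close>.\<close>

lemma FM_base_finsat:
  assumes p: "p \<in> types L U (univ U) n"
  shows "finsat U {a. length a = n \<and> set a \<subseteq> univ M} (FM_base L M' N' N n p)"
  unfolding finsat_def
proof (intro allI impI)
  fix F assume F: "finite F" "F \<subseteq> FM_base L M' N' N n p"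
  have "\<forall>\<phi>\<in>F. \<exists>\<theta>. \<theta> \<in> \<Theta> \<phi> \<and> \<theta> \<in> p"
  proof
    fix \<phi> assume "\<phi> \<in> F"
    then have "\<phi> \<in> FM_base L M' N' N n p" using F(2) by blast
    moreover from this have "\<phi> \<in> Fm L (univ M') n" using FM_base_Fm by blast
    ultimately show "\<exists>\<theta>. \<theta> \<in> \<Theta> \<phi> \<and> \<theta> \<in> p" using FM_base_iff[OF p] by blast
  qed
  from bchoice[OF this] obtain t where t: "\<forall>\<phi>\<in>F. t \<phi> \<in> \<Theta> \<phi> \<and> t \<phi> \<in> p" ..
  have "t ` F \<subseteq> p \<inter> Fm L N n" using t by (auto simp: \<Theta>_def)
  from realize_in_N[OF p finite_imageI[OF F(1)] this] obtain c where
    c: "length c = n" "set c \<subseteq> N" "\<forall>\<theta>\<in>t ` F. holds N' \<theta> c" .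
  have cN: "c \<in> tuples N' n" using c N_sub by (auto simp: tuples_def)
  have hF: "holds N' \<phi> c" if "\<phi> \<in> F" for \<phi>
    using bspec[OF t that] bspec[OF c(3) imageI[OF that]] cN c(2) by (simp add: \<Theta>_def)
  have "F \<subseteq> Fm L (univ M') n" using F(2) FM_base_Fm by blast
  from Fm_finite_conj[OF F(1) this] obtain \<psi> where \<psi>: "\<psi> \<in> Fm L (univ M') n"
    "\<And>K a. holds K \<psi> a \<longleftrightarrow> (\<forall>\<phi>\<in>F. holds K \<phi> a)" by metis
  have "holds N' \<psi> c" using hF by (simp add: \<psi>(2))
  then obtain a where a: "length a = n" "set a \<subseteq> univ M" "holds M' \<psi> a"
    using pair_ex_P[OF M'N'_pair \<psi>(1) subs(2) cN c(2)] by metis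
  then have "holds U \<psi> a"
    using holds_elem_sub[OF M'U \<psi>(1)] subs by (auto simp: tuples_def)
  then show "\<exists>a\<in>{a. length a = n \<and> set a \<subseteq> univ M}. \<forall>\<phi>\<in>F. holds U \<phi> a"
    using a \<psi>(2) by blast
qed

text \<open>Since \<open>M'\<close> realises all types over \<open>M\<close>, invariant objects are determined by their
  restriction to \<open>M'\<close>.\<close>

lemma invariant_representative:
  assumes "\<phi> \<in> Fm L (univ U) n"
  obtains m \<phi>0 b b' where "\<phi>0 \<in> Fm L {} (n + m)" "b \<in> tuples U m" "b' \<in> tuples U m"
    "tp L U b (univ M) = tp L U b' (univ M)"
    "inst n \<phi>0 b \<in> Fm L (univ U) n" "inst n \<phi>0 b' \<in> Fm L (univ M') n"
    "\<And>a. a \<in> tuples U n \<Longrightarrow> holds U \<phi> a \<longleftrightarrow> holds U (inst n \<phi>0 b) a"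
proof -
  from Fm_as_inst[OF assms] obtain m \<phi>0 b where *: "\<phi>0 \<in> Fm L {} (n + m)" "length b = m"
    "set b \<subseteq> univ U" "inst n \<phi>0 b \<in> Fm L (univ U) n"
    "\<And>K a. length a = n \<Longrightarrow> holds K (inst n \<phi>0 b) a \<longleftrightarrow> holds K \<phi> a" by metis
  have b: "b \<in> tuples U m" using * by (simp add: tuples_def)
  from realize_tp_M[OF b] obtain b' where b': "b' \<in> tuples M' m"
    "tp L U b' (univ M) = tp L U b (univ M)" by metis
  have b'U: "b' \<in> tuples U m" using b'(1) elem_sub_tuples[OF M'U] by blast
  have "inst n \<phi>0 b' \<in> Fm L (univ M') n"
    by (rule inst_Fm[of _ _ "{}"]) (use * b' in \<open>auto simp: tuples_def\<close>)
  then show thesis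
    by (rule that[OF *(1) b b'U b'(2)[symmetric] *(4)]) (simp add: *(5) tuples_def)
qed

lemma inv_type_representative:
  assumes "\<phi>0 \<in> Fm L {} (n + m)" "b \<in> tuples U m" "b' \<in> tuples U m"
    "tp L U b (univ M) = tp L U b' (univ M)" "\<phi> \<in> Fm L (univ U) n" "inst n \<phi>0 b \<in> Fm L (univ U) n"
    "\<And>a. a \<in> tuples U n \<Longrightarrow> holds U \<phi> a \<longleftrightarrow> holds U (inst n \<phi>0 b) a"
    and r: "r \<in> inv_types L U (univ M) n"
  shows "\<phi> \<in> r \<longleftrightarrow> inst n \<phi>0 b' \<in> r"
proof -
  have "r \<in> types L U (univ U) n" "invariant L U (univ M) n (\<lambda>\<phi>. \<phi> \<in> r)"
    using r by (auto simp: inv_types_def)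
  then show ?thesis
    using type_cong[OF _ assms(5,6,7)] assms(1-4) unfolding invariant_def by blast
qed

text \<open>A coheir of the type over \<open>M'\<close> is an invariant extension. It is the only one, since the type over
  \<open>M'\<close> is complete and every formula is as good as one over \<open>M'\<close>.\<close>

lemma FM_type_ex1:
  assumes p: "p \<in> inv_types L U (univ M) n"
  shows "\<exists>!r. r \<in> inv_types L U (univ M) n \<and> FM_base L M' N' N n p \<subseteq> r"
proof (rule ex_ex1I)
  have pt: "p \<in> types L U (univ U) n" using p by (simp add: inv_types_def)
  let ?X = "{a. length a = n \<and> set a \<subseteq> univ M}"
  have "FM_base L M' N' N n p \<subseteq> Fm L (univ U) n"
    using FM_base_Fm Fm_mono[OF _ subs(5) order_refl] by blast
  moreover have "?X \<subseteq> tuples U n" using subs by (auto simp: tuples_def)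
  ultimately obtain r where r: "FM_base L M' N' N n p \<subseteq> r" "r \<in> types L U (univ U) n" "finsat U ?X r"
    by (rule finsat_extend[OF _ FM_base_finsat[OF pt]])
  then show "\<exists>r. r \<in> inv_types L U (univ M) n \<and> FM_base L M' N' N n p \<subseteq> r"
    using coheir_invariant[of r L U n "univ M"] by blast
next
  have sub: "r \<subseteq> r'" if r: "r \<in> inv_types L U (univ M) n \<and> FM_base L M' N' N n p \<subseteq> r"
    "r' \<in> inv_types L U (univ M) n \<and> FM_base L M' N' N n p \<subseteq> r'" for r r'
  proof
    fix \<phi> assume "\<phi> \<in> r"
    have rt: "r \<in> types L U (univ U) n" "r' \<in> types L U (univ U) n"
      "invariant L U (univ M) n (\<lambda>\<phi>. \<phi> \<in> r)" "invariant L U (univ M) n (\<lambda>\<phi>. \<phi> \<in> r')"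
      using r by (auto simp: inv_types_def)
    have "\<phi> \<in> Fm L (univ U) n" using rt(1) \<open>\<phi> \<in> r\<close> by (auto simp: types_def)
    note \<phi>U = this
    from invariant_representative[OF \<phi>U] obtain m \<phi>0 b b' where
      rep: "\<phi>0 \<in> Fm L {} (n + m)" "b \<in> tuples U m" "b' \<in> tuples U m"
        "tp L U b (univ M) = tp L U b' (univ M)" "inst n \<phi>0 b \<in> Fm L (univ U) n"
        "\<And>a. a \<in> tuples U n \<Longrightarrow> holds U \<phi> a \<longleftrightarrow> holds U (inst n \<phi>0 b) a"
      and M': "inst n \<phi>0 b' \<in> Fm L (univ M') n" by metis
    let ?\<phi>' = "inst n \<phi>0 b'"
    have 1: "\<phi> \<in> r \<longleftrightarrow> ?\<phi>' \<in> r" and 2: "\<phi> \<in> r' \<longleftrightarrow> ?\<phi>' \<in> r'"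
      using inv_type_representative[OF rep(1-4) \<phi>U rep(5,6)] r by blast+
    have \<phi>'U: "?\<phi>' \<in> Fm L (univ U) n" using Fm_mono[OF M' subs(5) order_refl] .
    have "?\<phi>' \<in> r" using 1 \<open>\<phi> \<in> r\<close> by simp
    then have "Neg ?\<phi>' \<notin> FM_base L M' N' N n p" using type_Neg[OF rt(1) \<phi>'U] r by blast
    then have "?\<phi>' \<in> FM_base L M' N' N n p" using FM_base_decides[OF p M'] by blast
    then show "\<phi> \<in> r'" using r 2 by blast
  qed
  show "r = r'" if "r \<in> inv_types L U (univ M) n \<and> FM_base L M' N' N n p \<subseteq> r"
    "r' \<in> inv_types L U (univ M) n \<and> FM_base L M' N' N n p \<subseteq> r'" for r r'
    using sub[OF that] sub[OF that(2,1)] by blast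
qed

abbreviation F\<^sub>M :: "('f, 'r, 'a) fm set \<Rightarrow> ('f, 'r, 'a) fm set" where
  "F\<^sub>M \<equiv> FM_type L U M M' N' N n"

lemma F_inv: "p \<in> inv_types L U (univ M) n \<Longrightarrow> F\<^sub>M p \<in> inv_types L U (univ M) n"
  and F_base: "p \<in> inv_types L U (univ M) n \<Longrightarrow> FM_base L M' N' N n p \<subseteq> F\<^sub>M p"
  using theI'[OF FM_type_ex1[of p]] unfolding FM_type_def by auto

lemma F_iff:
  assumes p: "p \<in> inv_types L U (univ M) n" and \<phi>: "\<phi> \<in> Fm L (univ M') n"
  shows "\<phi> \<in> F\<^sub>M p \<longleftrightarrow> \<phi> \<in> FM_base L M' N' N n p"
proof -
  have t: "F\<^sub>M p \<in> types L U (univ U) n" using F_inv[OF p] by (simp add: inv_types_def)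
  have "Neg \<phi> \<in> F\<^sub>M p \<longleftrightarrow> \<phi> \<notin> F\<^sub>M p" using type_Neg[OF t Fm_mono[OF \<phi> subs(5) order_refl]] .
  then show ?thesis using FM_base_decides[OF p \<phi>] F_base[OF p] by blast
qed

end

section \<open>Regular Borel extensions\<close>

text \<open>The Borel sets may be far more than the \<open>\<sigma>\<close>-algebra generated by the clopen base \<open>B\<close>, hence the
  outer measure is computed from arbitrary open supersets instead of countable covers by members
  of \<open>B\<close>.\<close>

locale clopen_charge =
  fixes X :: "'b topology" and B :: "'b set set" and m :: "'b set \<Rightarrow> real"
  assumes compact_X: "compact_space X"
    and B_open: "\<And>b. b \<in> B \<Longrightarrow> openin X b"
    and B_space: "topspace X \<in> B"
    and B_compl: "\<And>b. b \<in> B \<Longrightarrow> topspace X - b \<in> B"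
    and B_Un: "\<And>b c. b \<in> B \<Longrightarrow> c \<in> B \<Longrightarrow> b \<union> c \<in> B"
    and B_base: "\<And>V x. openin X V \<Longrightarrow> x \<in> V \<Longrightarrow> \<exists>b\<in>B. x \<in> b \<and> b \<subseteq> V"
    and m_nonneg: "\<And>b. b \<in> B \<Longrightarrow> 0 \<le> m b"
    and m_space: "m (topspace X) = 1"
    and m_add: "\<And>b c. b \<in> B \<Longrightarrow> c \<in> B \<Longrightarrow> b \<inter> c = {} \<Longrightarrow> m (b \<union> c) = m b + m c"
begin

abbreviation "\<Omega> \<equiv> topspace X"

lemma B_sub: "b \<in> B \<Longrightarrow> b \<subseteq> \<Omega>"
  using B_open openin_subset by blast

lemma B_empty: "{} \<in> B"
  using B_compl[OF B_space] by simp

lemma B_Int: "b \<in> B \<Longrightarrow> c \<in> B \<Longrightarrow> b \<inter> c \<in> B"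
proof -
  assume b: "b \<in> B" and c: "c \<in> B"
  have "b \<inter> c = \<Omega> - ((\<Omega> - b) \<union> (\<Omega> - c))" using B_sub[OF b] by blast
  then show ?thesis using b c B_Un B_compl by simp
qed

lemma B_Diff: "b \<in> B \<Longrightarrow> c \<in> B \<Longrightarrow> b - c \<in> B"
proof -
  assume b: "b \<in> B" and c: "c \<in> B"
  have "b - c = b \<inter> (\<Omega> - c)" using B_sub[OF b] by blast
  then show ?thesis using b c B_Int B_compl by simp
qed

lemma B_Union: "finite F \<Longrightarrow> F \<subseteq> B \<Longrightarrow> \<Union>F \<in> B"
  by (induction F rule: finite_induct) (auto intro: B_empty B_Un)

lemma m_mono: "b \<in> B \<Longrightarrow> c \<in> B \<Longrightarrow> b \<subseteq> c \<Longrightarrow> m b \<le> m c"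
proof -
  assume *: "b \<in> B" "c \<in> B" "b \<subseteq> c"
  have "m (b \<union> (c - b)) = m b + m (c - b)" using * B_Diff by (intro m_add) auto
  moreover have "b \<union> (c - b) = c" using * by blast
  ultimately show ?thesis using m_nonneg[OF B_Diff[OF *(2,1)]] by simp
qed

lemma m_empty: "m {} = 0"
  using m_add[OF B_empty B_empty] by simp

lemma B_closed: "b \<in> B \<Longrightarrow> closedin X b"
proof -
  assume b: "b \<in> B"
  have "\<Omega> - (\<Omega> - b) = b" using B_sub[OF b] by blast
  then show ?thesis using B_open[OF B_compl[OF b]] openin_closedin_eq by (metis closedin_diff closedin_topspace)
qed

lemma closed_compact: "closedin X C \<Longrightarrow> compactin X C"
  using compact_X closedin_compact_space by blast

lemma compact_between:
  assumes "compactin X C" "openin X V" "C \<subseteq> V"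
  obtains b where "b \<in> B" "C \<subseteq> b" "b \<subseteq> V"
proof -
  let ?\<U> = "{b \<in> B. b \<subseteq> V}"
  have "C \<subseteq> \<Union>?\<U>" using B_base[OF assms(2)] assms(3) by blast
  then obtain F where F: "finite F" "F \<subseteq> ?\<U>" "C \<subseteq> \<Union>F"
    using assms(1) B_open unfolding compactin_def by (metis (no_types, lifting) mem_Collect_eq)
  show thesis using that[OF B_Union[OF F(1)]] F(2,3) by blast
qed

text \<open>The measure of an open set, approximated from inside by clopen sets; \<open>outer\<close> is the induced outer
  measure.\<close>

definition content :: "'b set \<Rightarrow> ennreal" where
  "content V = (SUP b\<in>{b \<in> B. b \<subseteq> V}. ennreal (m b))"

definition outer :: "'b set \<Rightarrow> ennreal" where
  "outer E = (INF V\<in>{V. openin X V \<and> E \<subseteq> V}. content V)"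

lemma content_upper: "b \<in> B \<Longrightarrow> b \<subseteq> V \<Longrightarrow> ennreal (m b) \<le> content V"
  unfolding content_def by (rule SUP_upper) simp

lemma content_least: "(\<And>b. b \<in> B \<Longrightarrow> b \<subseteq> V \<Longrightarrow> ennreal (m b) \<le> y) \<Longrightarrow> content V \<le> y"
  unfolding content_def by (rule SUP_least) simp

lemma content_mono: "V \<subseteq> W \<Longrightarrow> content V \<le> content W"
  by (rule content_least, rule content_upper) auto

lemma content_B: "b \<in> B \<Longrightarrow> content b = ennreal (m b)"
  by (rule antisym[OF content_least content_upper]) (auto intro: m_mono ennreal_leI)

lemma content_le_1: "content V \<le> 1"
proof (rule content_least)
  fix b assume "b \<in> B"
  then have "m b \<le> 1" using m_mono[OF _ B_space B_sub] m_space by simp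
  then show "ennreal (m b) \<le> 1" using ennreal_leI by fastforce
qed

text \<open>A clopen \<open>b \<subseteq> V \<union> W\<close> is divided by a clopen set between the compact set \<open>b - W\<close> and \<open>V\<close>.\<close>

lemma content_Un:
  assumes V: "openin X V" and W: "openin X W"
  shows "content (V \<union> W) \<le> content V + content W"
proof (rule content_least)
  fix b assume b: "b \<in> B" "b \<subseteq> V \<union> W"
  have "closedin X (b - W)" using B_closed[OF b(1)] W by (rule closedin_diff)
  then obtain c where c: "c \<in> B" "b - W \<subseteq> c" "c \<subseteq> V"
    using compact_between[OF closed_compact V] b(2) by blast
  have "m b \<le> m (c \<union> (b - c))" using b c B_Un B_Diff by (intro m_mono) auto
  also have "\<dots> = m c + m (b - c)" using b c B_Diff by (intro m_add) auto
  finally have "ennreal (m b) \<le> ennreal (m c) + ennreal (m (b - c))"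
    using m_nonneg[OF c(1)] m_nonneg[OF B_Diff[OF b(1) c(1)]] by (simp flip: ennreal_plus add: ennreal_leI)
  also have "\<dots> \<le> content V + content W"
    by (intro add_mono content_upper) (use b c B_Diff in auto)
  finally show "ennreal (m b) \<le> content V + content W" .
qed

lemma content_UN_finite:
  assumes "\<And>i::nat. openin X (V i)"
  shows "content (\<Union>i<k. V i) \<le> (\<Sum>i<k. content (V i))"
proof (induction k)
  case 0
  show ?case using content_B[OF B_empty] m_empty by simp
next
  case (Suc k)
  have "openin X (\<Union>i<k. V i)" using assms by (intro openin_Union) auto
  then have "content ((\<Union>i<k. V i) \<union> V k) \<le> content (\<Union>i<k. V i) + content (V k)"
    using assms by (intro content_Un) auto
  also have "\<dots> \<le> (\<Sum>i<Suc k. content (V i))" using Suc by (simp add: add_right_mono)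
  finally show ?case by (simp add: lessThan_Suc Un_commute)
qed

text \<open>Countable subadditivity comes for free from compactness: a clopen subset of a countable
  union of open sets is covered by finitely many of them.\<close>

lemma content_UN:
  assumes V: "\<And>i::nat. openin X (V i)"
  shows "content (\<Union>i. V i) \<le> (\<Sum>i. content (V i))"
proof (rule content_least)
  fix b assume b: "b \<in> B" "b \<subseteq> (\<Union>i. V i)"
  have "compactin X b" using closed_compact B_closed b by blast
  then obtain F where F: "finite F" "F \<subseteq> range V" "b \<subseteq> \<Union>F"
    using b(2) V unfolding compactin_def by (metis (no_types, lifting) imageE)
  obtain I where I: "finite I" "F = V ` I" using finite_subset_image[OF F(1,2)] by blast
  then obtain k where k: "I \<subseteq> {..<k}" using finite_nat_iff_bounded by blast
  have "ennreal (m b) \<le> content (\<Union>i<k. V i)"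
    using b(1) F(3) I(2) k by (intro content_upper) auto
  also have "\<dots> \<le> (\<Sum>i<k. content (V i))" by (rule content_UN_finite[OF V])
  also have "\<dots> \<le> (\<Sum>i. content (V i))" by (intro sum_le_suminf) auto
  finally show "ennreal (m b) \<le> (\<Sum>i. content (V i))" .
qed

lemma outer_open: "openin X V \<Longrightarrow> outer V = content V"
  unfolding outer_def by (rule antisym[OF INF_lower INF_greatest]) (auto intro: content_mono)

lemma outer_lower: "openin X V \<Longrightarrow> E \<subseteq> V \<Longrightarrow> outer E \<le> content V"
  unfolding outer_def by (rule INF_lower) simp

lemma outer_mono: "E \<subseteq> E' \<Longrightarrow> outer E \<le> outer E'"
  unfolding outer_def by (rule INF_superset_mono) auto

lemma outer_empty: "outer {} = 0"
  using outer_open[of "{}"] content_B[OF B_empty] m_empty by simp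

lemma outer_approx:
  assumes "E \<subseteq> \<Omega>" "e > 0"
  obtains V where "openin X V" "E \<subseteq> V" "content V \<le> outer E + ennreal e"
proof -
  have "outer E \<le> 1" using outer_lower[OF openin_topspace assms(1)] content_le_1 order_trans by blast
  then have "outer E \<noteq> \<infinity>" by (auto simp: top_unique)
  from INF_approx_ennreal[OF assms(2) outer_def[of E] this] obtain V where
    "V \<in> {V. openin X V \<and> E \<subseteq> V}" "content V < outer E + ennreal e" by blast
  then show thesis using that by (auto intro: less_imp_le)
qed

lemma outer_UN:
  assumes E: "\<And>i::nat. E i \<subseteq> \<Omega>"
  shows "outer (\<Union>i. E i) \<le> (\<Sum>i. outer (E i))"
proof (rule ennreal_le_epsilon)
  fix e :: real assume e: "0 < e"
  have "\<exists>V. openin X V \<and> E i \<subseteq> V \<and> content V \<le> outer (E i) + ennreal (e * (1/2) ^ Suc i)" for i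
    using outer_approx[OF E[of i], of "e * (1/2) ^ Suc i"] e by (metis half_gt_zero_iff mult_pos_pos zero_less_one zero_less_power)
  then obtain V where V: "\<And>i. openin X (V i)" "\<And>i. E i \<subseteq> V i"
    "\<And>i. content (V i) \<le> outer (E i) + ennreal (e * (1/2) ^ Suc i)" by metis
  have "outer (\<Union>i. E i) \<le> content (\<Union>i. V i)"
    using V by (intro outer_lower) (auto intro!: openin_Union)
  also have "\<dots> \<le> (\<Sum>i. content (V i))" by (rule content_UN[OF V(1)])
  also have "\<dots> \<le> (\<Sum>i. outer (E i) + ennreal (e * (1/2) ^ Suc i))"
    using V(3) by (intro suminf_le) auto
  also have "\<dots> = (\<Sum>i. outer (E i)) + (\<Sum>i. ennreal (e * (1/2) ^ Suc i))"
    by (intro suminf_add[symmetric]) auto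
  also have "(\<Sum>i. ennreal (e * (1/2) ^ Suc i)) = ennreal e"
  proof -
    have "(\<lambda>i. e * (1/2) ^ Suc i) sums (e * 1)"
      by (intro sums_mult power_half_series)
    then show ?thesis using e by (intro suminf_ennreal_eq) auto
  qed
  finally show "outer (\<Union>i. E i) \<le> (\<Sum>i. outer (E i)) + ennreal e" .
qed

lemma outer_outer: "outer_measure_space (Pow \<Omega>) outer"
  unfolding outer_measure_space_def
proof (intro conjI)
  show "positive (Pow \<Omega>) outer" by (simp add: positive_def outer_empty)
  show "increasing (Pow \<Omega>) outer" by (simp add: increasing_def outer_mono)
  show "countably_subadditive (Pow \<Omega>) outer"
    unfolding countably_subadditive_def by (auto intro!: outer_UN)
qed

text \<open>If \<open>W\<close> is open and contains \<open>E\<close>, it suffices to split \<open>W\<close> along a clopen \<open>b \<subseteq> V \<inter> W\<close> that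
  almost exhausts \<open>V \<inter> W\<close>: the remainder \<open>W - b\<close> is open and contains \<open>E - V\<close>.\<close>

lemma open_measurable:
  assumes V: "openin X V"
  shows "V \<in> lambda_system \<Omega> (Pow \<Omega>) outer"
proof -
  interpret ring_of_sets \<Omega> "Pow \<Omega>" by (rule ring_of_sets_Pow)
  have sub: "subadditive (Pow \<Omega>) outer"
    using outer_outer countably_subadditive_subadditive by (auto simp: outer_measure_space_def)
  have V\<Omega>: "V \<subseteq> \<Omega>" using V openin_subset by blast
  have "outer (V \<inter> E) + outer ((\<Omega> - V) \<inter> E) = outer E" if E: "E \<subseteq> \<Omega>" for E
  proof (rule antisym)
    have "outer ((V \<inter> E) \<union> ((\<Omega> - V) \<inter> E)) \<le> outer (V \<inter> E) + outer ((\<Omega> - V) \<inter> E)"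
      using E by (intro subadditiveD[OF sub]) auto
    moreover have "(V \<inter> E) \<union> ((\<Omega> - V) \<inter> E) = E" using E V\<Omega> by blast
    ultimately show "outer E \<le> outer (V \<inter> E) + outer ((\<Omega> - V) \<inter> E)" by simp
    show "outer (V \<inter> E) + outer ((\<Omega> - V) \<inter> E) \<le> outer E"
      unfolding outer_def[of E]
    proof (rule INF_greatest, safe)
      fix W assume W: "openin X W" "E \<subseteq> W"
      have VW: "openin X (V \<inter> W)" using V W by (intro openin_Int)
      have b: "ennreal (m b) + outer ((\<Omega> - V) \<inter> E) \<le> content W" if b: "b \<in> B" "b \<subseteq> V \<inter> W" for b
      proof -
        have op: "openin X (W - b)" using W(1) B_closed[OF b(1)] by (rule openin_diff)
        have "outer ((\<Omega> - V) \<inter> E) \<le> content (W - b)"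
          by (rule outer_lower[OF op]) (use b W in auto)
        then have "ennreal (m b) + outer ((\<Omega> - V) \<inter> E) \<le> ennreal (m b) + content (W - b)"
          by (rule add_left_mono)
        also have "\<dots> = (SUP c\<in>{c \<in> B. c \<subseteq> W - b}. ennreal (m b) + ennreal (m c))"
          unfolding content_def by (rule ennreal_SUP_add_right) (use B_empty in auto)
        also have "\<dots> \<le> content W"
        proof (rule SUP_least, safe)
          fix c assume c: "c \<in> B" "c \<subseteq> W - b"
          have "b \<inter> c = {}" using c(2) by blast
          then have "ennreal (m b) + ennreal (m c) = ennreal (m (b \<union> c))"
            using m_add[OF b(1) c(1)] m_nonneg[OF b(1)] m_nonneg[OF c(1)] by simp
          also have "\<dots> \<le> content W" using b c B_Un by (intro content_upper) auto
          finally show "ennreal (m b) + ennreal (m c) \<le> content W" .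
        qed
        finally show ?thesis .
      qed
      have "outer (V \<inter> E) + outer ((\<Omega> - V) \<inter> E) \<le> content (V \<inter> W) + outer ((\<Omega> - V) \<inter> E)"
        using W VW by (intro add_right_mono outer_lower) auto
      also have "\<dots> = (SUP b\<in>{b \<in> B. b \<subseteq> V \<inter> W}. ennreal (m b) + outer ((\<Omega> - V) \<inter> E))"
        unfolding content_def by (rule ennreal_SUP_add_left[symmetric]) (use B_empty in auto)
      also have "\<dots> \<le> content W" using b by (intro SUP_least) auto
      finally show "outer (V \<inter> E) + outer ((\<Omega> - V) \<inter> E) \<le> content W" .
    qed
  qed
  then show ?thesis using V\<Omega> by (auto simp: lambda_system_def)
qed

definition ext :: "'b measure" where
  "ext = measure_of \<Omega> {V. openin X V} outer"

lemma sets_ext: "sets ext = sigma_sets \<Omega> {V. openin X V}" and space_ext: "space ext = \<Omega>"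
proof -
  have "{V. openin X V} \<subseteq> Pow \<Omega>" using openin_subset by blast
  then show "sets ext = sigma_sets \<Omega> {V. openin X V}" "space ext = \<Omega>"
    by (simp_all add: ext_def sets_measure_of space_measure_of)
qed

lemma emeasure_ext:
  assumes "A \<in> sets ext"
  shows "emeasure ext A = outer A"
proof (rule emeasure_measure_of[OF ext_def])
  have ms: "measure_space \<Omega> (lambda_system \<Omega> (Pow \<Omega>) outer) outer"
    by (rule sigma_algebra.caratheodory_lemma[OF sigma_algebra_Pow outer_outer])
  have "sigma_sets \<Omega> {V. openin X V} \<subseteq> lambda_system \<Omega> (Pow \<Omega>) outer"
    by (rule sigma_algebra.sigma_sets_subset) (use ms open_measurable in \<open>auto simp: measure_space_def\<close>)
  then have "countably_additive (sigma_sets \<Omega> {V. openin X V}) outer"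
    using ms by (auto simp: measure_space_def countably_additive_def)
  then show "countably_additive (sets ext) outer" by (simp add: sets_ext)
  show "positive (sets ext) outer" by (simp add: positive_def outer_empty)
qed (use assms in \<open>auto dest: openin_subset\<close>)

lemma open_sets: "openin X V \<Longrightarrow> V \<in> sigma_sets \<Omega> {V. openin X V}"
  by (rule sigma_sets.Basic) simp

text \<open>Outer regularity is built in; inner regularity follows by taking complements, because closed
  subsets of a compact space are compact.\<close>

lemma ext_regular: "regular_borel_prob X ext"
  unfolding regular_borel_prob_def
proof (intro conjI ballI)
  have tot: "emeasure ext \<Omega> = 1"
    using emeasure_ext open_sets[OF openin_topspace] outer_open[OF openin_topspace] content_B[OF B_space]
    by (simp add: sets_ext m_space)
  show ps: "prob_space ext" by (rule prob_spaceI) (simp add: space_ext tot)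
  then interpret prob_space ext .
  show "space ext = \<Omega>" "sets ext = sigma_sets \<Omega> {V. openin X V}"
    by (fact space_ext, fact sets_ext)
  show outer: "emeasure ext A = (INF V\<in>{V. A \<subseteq> V \<and> openin X V}. emeasure ext V)" if A: "A \<in> sets ext" for A
  proof -
    have "emeasure ext A = (INF V\<in>{V. openin X V \<and> A \<subseteq> V}. content V)"
      using emeasure_ext[OF A] outer_def by simp
    also have "\<dots> = (INF V\<in>{V. A \<subseteq> V \<and> openin X V}. emeasure ext V)"
      by (intro INF_cong) (auto simp: emeasure_ext sets_ext open_sets outer_open)
    finally show ?thesis .
  qed
  show "emeasure ext A = (SUP C\<in>{C. C \<subseteq> A \<and> compactin X C}. emeasure ext C)" if A: "A \<in> sets ext" for A
  proof (rule antisym)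
    have A\<Omega>: "A \<subseteq> \<Omega>" using sets.sets_into_space[OF A] by (simp add: space_ext)
    let ?\<V> = "{V. \<Omega> - A \<subseteq> V \<and> openin X V}"
    have cl: "C \<in> sets ext" if "closedin X C" for C
    proof -
      have "\<Omega> - C \<in> sets ext" using that by (simp add: sets_ext open_sets openin_diff)
      from sets.compl_sets[OF this] have "\<Omega> - (\<Omega> - C) \<in> sets ext" by (simp add: space_ext)
      moreover have "\<Omega> - (\<Omega> - C) = C" using closedin_subset[OF that] by blast
      ultimately show ?thesis by simp
    qed
    have compl: "emeasure ext (\<Omega> - S) = 1 - emeasure ext S" if "S \<in> sets ext" for S
      using emeasure_compl[OF that] tot by (simp add: space_ext)
    have "\<Omega> - A \<in> sets ext" using sets.compl_sets[OF A] by (simp add: space_ext)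
    then have "emeasure ext (\<Omega> - (\<Omega> - A)) = 1 - (INF V\<in>?\<V>. emeasure ext V)"
      using compl outer by metis
    also have "\<dots> = (SUP V\<in>?\<V>. 1 - emeasure ext V)"
      by (rule ennreal_INF_const_minus[symmetric]) (use openin_topspace in auto)
    also have "\<dots> \<le> (SUP C\<in>{C. C \<subseteq> A \<and> compactin X C}. emeasure ext C)"
    proof (rule SUP_least, safe)
      fix V assume V: "\<Omega> - A \<subseteq> V" "openin X V"
      have "1 - emeasure ext V = emeasure ext (\<Omega> - V)"
        using compl[of V] V(2) by (simp add: sets_ext open_sets)
      also have "\<dots> \<le> (SUP C\<in>{C. C \<subseteq> A \<and> compactin X C}. emeasure ext C)"
        using V by (intro SUP_upper) (auto intro: closed_compact)
      finally show "1 - emeasure ext V \<le> (SUP C\<in>{C. C \<subseteq> A \<and> compactin X C}. emeasure ext C)" .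
    qed
    finally show "emeasure ext A \<le> (SUP C\<in>{C. C \<subseteq> A \<and> compactin X C}. emeasure ext C)"
      using A\<Omega> by (simp add: double_diff)
    show "(SUP C\<in>{C. C \<subseteq> A \<and> compactin X C}. emeasure ext C) \<le> emeasure ext A"
      by (rule SUP_least) (auto intro!: emeasure_mono A)
  qed
qed

lemma ext_B: "b \<in> B \<Longrightarrow> measure ext b = m b"
  using emeasure_ext[of b] outer_open[OF B_open] content_B m_nonneg
  by (simp add: measure_def sets_ext open_sets B_open)

text \<open>The value of a regular extension on an open set is forced by inner regularity, and then on
  all Borel sets by outer regularity.\<close>

lemma regular_open:
  assumes "regular_borel_prob X \<nu>" "\<And>b. b \<in> B \<Longrightarrow> measure \<nu> b = m b" "openin X V"
  shows "emeasure \<nu> V = content V"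
proof -
  interpret prob_space \<nu> using assms(1) by (simp add: regular_borel_prob_def)
  have sets: "openin X W \<Longrightarrow> W \<in> sets \<nu>" for W
    using assms(1) by (simp add: regular_borel_prob_def open_sets)
  have "emeasure \<nu> V = (SUP C\<in>{C. C \<subseteq> V \<and> compactin X C}. emeasure \<nu> C)"
    using assms(1) sets[OF assms(3)] by (simp only: regular_borel_prob_def)
  also have "\<dots> \<le> content V"
  proof (rule SUP_least, safe)
    fix C assume "C \<subseteq> V" "compactin X C"
    then obtain b where b: "b \<in> B" "C \<subseteq> b" "b \<subseteq> V" using compact_between assms(3) by metis
    have "emeasure \<nu> C \<le> emeasure \<nu> b" using b sets B_open by (intro emeasure_mono) auto
    also have "\<dots> = ennreal (m b)" using assms(2) b by (simp add: emeasure_eq_measure)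
    also have "\<dots> \<le> content V" using b by (intro content_upper)
    finally show "emeasure \<nu> C \<le> content V" .
  qed
  finally have "emeasure \<nu> V \<le> content V" .
  moreover have "content V \<le> emeasure \<nu> V"
  proof (rule content_least)
    fix b assume b: "b \<in> B" "b \<subseteq> V"
    have "ennreal (m b) = emeasure \<nu> b" using assms(2) b by (simp add: emeasure_eq_measure)
    also have "\<dots> \<le> emeasure \<nu> V" using b sets assms(3) by (intro emeasure_mono) auto
    finally show "ennreal (m b) \<le> emeasure \<nu> V" .
  qed
  ultimately show ?thesis by simp
qed

text \<open>The union may be uncountable: regularity takes the place of continuity along sequences.\<close>

lemma regular_Union_le:
  assumes "regular_borel_prob X \<nu>" "\<And>b. b \<in> B \<Longrightarrow> measure \<nu> b = m b" "\<W> \<subseteq> B"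
    and le: "\<And>F. finite F \<Longrightarrow> F \<subseteq> \<W> \<Longrightarrow> m (\<Union>F) \<le> r"
  shows "emeasure \<nu> (\<Union>\<W>) \<le> ennreal r"
proof -
  have op: "openin X (\<Union>\<W>)" using assms(3) B_open by (intro openin_Union) auto
  have "content (\<Union>\<W>) \<le> ennreal r"
  proof (rule content_least)
    fix b assume b: "b \<in> B" "b \<subseteq> \<Union>\<W>"
    have "compactin X b" using closed_compact B_closed b by blast
    then obtain F where F: "finite F" "F \<subseteq> \<W>" "b \<subseteq> \<Union>F"
      using b(2) assms(3) B_open unfolding compactin_def by (metis subset_iff)
    have "m b \<le> m (\<Union>F)" by (rule m_mono) (use F b assms(3) B_Union in auto)
    also have "\<dots> \<le> r" using le F by blast
    finally show "ennreal (m b) \<le> ennreal r" by (rule ennreal_leI)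
  qed
  then show ?thesis using regular_open[OF assms(1,2) op] by simp
qed

theorem regular_extension:
  "\<exists>!\<nu>. regular_borel_prob X \<nu> \<and> (\<forall>b\<in>B. measure \<nu> b = m b)"
proof (rule ex1I)
  show "regular_borel_prob X ext \<and> (\<forall>b\<in>B. measure ext b = m b)"
    using ext_regular ext_B by blast
  fix \<nu> assume \<nu>: "regular_borel_prob X \<nu> \<and> (\<forall>b\<in>B. measure \<nu> b = m b)"
  show "\<nu> = ext"
  proof (rule measure_eqI)
    show s: "sets \<nu> = sets ext" using \<nu> by (simp add: regular_borel_prob_def sets_ext)
    fix A assume A: "A \<in> sets \<nu>"
    have "emeasure \<nu> A = (INF V\<in>{V. A \<subseteq> V \<and> openin X V}. emeasure \<nu> V)"
      using \<nu> A unfolding regular_borel_prob_def by blast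
    also have "\<dots> = (INF V\<in>{V. A \<subseteq> V \<and> openin X V}. emeasure ext V)"
      using regular_open[of \<nu>] regular_open[OF ext_regular ext_B] \<nu> by (intro INF_cong) auto
    also have "\<dots> = emeasure ext A"
      using ext_regular A unfolding s regular_borel_prob_def by metis
    finally show "emeasure \<nu> A = emeasure ext A" .
  qed
qed

end

section \<open>The space of global types\<close>

definition cyl :: "('f, 'r) lang \<Rightarrow> ('f, 'r, 'a) struct \<Rightarrow> nat \<Rightarrow> ('f, 'r, 'a) fm \<Rightarrow> ('f, 'r, 'a) fm set set" where
  "cyl L U n \<phi> = {p \<in> types L U (univ U) n. \<phi> \<in> p}"

context
  fixes L :: "('f, 'r) lang" and U :: "('f, 'r, 'a) struct" and n :: nat
begin

abbreviation "\<S> \<equiv> types L U (univ U) n"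
abbreviation "\<F> \<equiv> Fm L (univ U) n"
abbreviation "cy \<equiv> cyl L U n"

lemma cyl_sub: "cy \<phi> \<subseteq> \<S>"
  by (auto simp: cyl_def)

lemma cyl_Top: "cy Top = \<S>"
proof -
  have "Top \<in> p" if "p \<in> \<S>" for p
    by (rule type_consequence[OF that, of "{}"]) simp_all
  then show ?thesis by (auto simp: cyl_def)
qed

lemma cyl_Neg: "\<phi> \<in> \<F> \<Longrightarrow> cy (Neg \<phi>) = \<S> - cy \<phi>"
  using type_Neg[of _ L U "univ U" n \<phi>] by (auto simp: cyl_def)

lemma cyl_Conj: "\<phi> \<in> \<F> \<Longrightarrow> \<psi> \<in> \<F> \<Longrightarrow> cy (Conj \<phi> \<psi>) = cy \<phi> \<inter> cy \<psi>"
  using type_Conj[of _ L U "univ U" n \<phi> \<psi>] by (auto simp: cyl_def)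

lemma cyl_Disj: "\<phi> \<in> \<F> \<Longrightarrow> \<psi> \<in> \<F> \<Longrightarrow> cy (Disj \<phi> \<psi>) = cy \<phi> \<union> cy \<psi>"
  using type_Disj[of _ L U "univ U" n \<phi> \<psi>] by (auto simp: cyl_def)

lemma cyl_subset_iff:
  assumes "\<phi> \<in> \<F>" "\<psi> \<in> \<F>"
  shows "cy \<phi> \<subseteq> cy \<psi> \<longleftrightarrow> (\<forall>a\<in>tuples U n. holds U \<phi> a \<longrightarrow> holds U \<psi> a)"
proof
  assume sub: "cy \<phi> \<subseteq> cy \<psi>"
  show "\<forall>a\<in>tuples U n. holds U \<phi> a \<longrightarrow> holds U \<psi> a"
  proof (intro ballI impI)
    fix a assume a: "a \<in> tuples U n" "holds U \<phi> a"
    have "tp L U a (univ U) \<in> cy \<phi>"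
      using tp_type[OF a(1)] a assms by (auto simp: cyl_def tp_def tuples_def)
    with sub show "holds U \<psi> a" by (auto simp: cyl_def tp_def)
  qed
next
  assume *: "\<forall>a\<in>tuples U n. holds U \<phi> a \<longrightarrow> holds U \<psi> a"
  have "\<psi> \<in> p" if "p \<in> \<S>" "\<phi> \<in> p" for p
    by (rule type_mono[OF that assms(2)]) (use * in blast)
  then show "cy \<phi> \<subseteq> cy \<psi>" by (auto simp: cyl_def)
qed

lemma type_space_def': "type_space L U n = topology_generated_by (cy ` \<F>)"
  by (simp add: type_space_def cyl_def)

lemma openin_cyl: "\<phi> \<in> \<F> \<Longrightarrow> openin (type_space L U n) (cy \<phi>)"
  unfolding type_space_def' by (rule topology_generated_by_Basis) simp

lemma topspace_types: "topspace (type_space L U n) = \<S>"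
proof -
  have "topspace (type_space L U n) = \<Union>(cy ` \<F>)"
    unfolding type_space_def' by (rule topology_generated_by_topspace)
  also have "\<dots> = \<S>"
  proof
    show "\<S> \<subseteq> \<Union>(cy ` \<F>)" using cyl_Top by (intro Union_upper) (metis Fm_Top imageI)
  qed (use cyl_sub in blast)
  finally show ?thesis .
qed

lemma type_space_base:
  assumes "openin (type_space L U n) V" "p \<in> V"
  shows "\<exists>\<phi>\<in>\<F>. p \<in> cy \<phi> \<and> cy \<phi> \<subseteq> V"
proof -
  have "generate_topology_on (cy ` \<F>) V"
    using assms(1) unfolding type_space_def' openin_topology_generated_by_iff .
  then show ?thesis using assms(2)
  proof (induction arbitrary: p)
    case (Int V W)
    obtain \<phi> \<psi> where "\<phi> \<in> \<F>" "p \<in> cy \<phi>" "cy \<phi> \<subseteq> V" "\<psi> \<in> \<F>" "p \<in> cy \<psi>" "cy \<psi> \<subseteq> W"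
      using Int.IH Int.prems by blast
    then show ?case by (intro bexI[of _ "Conj \<phi> \<psi>"]) (auto simp: cyl_Conj)
  next
    case (UN K)
    then obtain k where k: "k \<in> K" "p \<in> k" by blast
    then obtain \<phi> where "\<phi> \<in> \<F>" "p \<in> cy \<phi>" "cy \<phi> \<subseteq> k" using UN.IH by blast
    then show ?case using k(1) by blast
  qed auto
qed

text \<open>The negations of the formulas subordinate to a cover without finite subcover are finitely
  satisfiable, and a type that contains them all is not covered.\<close>

lemma compact_type_space: "compact_space (type_space L U n)"
  unfolding compact_space_alt
proof (intro allI impI, elim conjE)
  fix \<U> assume op: "\<forall>V\<in>\<U>. openin (type_space L U n) V"
    and cov: "topspace (type_space L U n) \<subseteq> \<Union>\<U>"
  let ?C = "{\<phi> \<in> \<F>. \<exists>V\<in>\<U>. cy \<phi> \<subseteq> V}"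
  have "\<exists>F. finite F \<and> F \<subseteq> ?C \<and> \<S> \<subseteq> \<Union>(cy ` F)"
  proof (rule ccontr)
    assume contra: "\<not> ?thesis"
    have fs: "finsat U (tuples U n) (Neg ` ?C)"
      unfolding finsat_def
    proof (intro allI impI)
      fix G assume G: "finite G" "G \<subseteq> Neg ` ?C"
      from finite_subset_image[OF G] obtain F where F: "F \<subseteq> ?C" "finite F" "G = Neg ` F" by auto
      have "\<not> \<S> \<subseteq> \<Union>(cy ` F)" using contra F(1,2) by simp
      then obtain p where p: "p \<in> \<S>" "p \<notin> \<Union>(cy ` F)" by auto
      have "G \<subseteq> p"
      proof
        fix \<xi> assume "\<xi> \<in> G"
        then obtain \<phi> where "\<phi> \<in> F" "\<xi> = Neg \<phi>" using F(3) by blast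
        moreover from this have "\<phi> \<in> \<F>" using F(1) by blast
        ultimately show "\<xi> \<in> p" using p type_Neg[OF p(1)] by (auto simp: cyl_def)
      qed
      then show "\<exists>a\<in>tuples U n. \<forall>\<phi>\<in>G. holds U \<phi> a" by (rule type_sat[OF p(1) G(1)])
    qed
    have "Neg ` ?C \<subseteq> \<F>" by auto
    from finsat_extend[OF this fs order_refl] obtain p where p: "Neg ` ?C \<subseteq> p" "p \<in> \<S>" .
    from p(2) obtain V where V: "V \<in> \<U>" "p \<in> V" using cov by (auto simp: topspace_types)
    obtain \<phi> where \<phi>: "\<phi> \<in> \<F>" "p \<in> cy \<phi>" "cy \<phi> \<subseteq> V" using type_space_base[of V p] op V by blast
    then have "Neg \<phi> \<in> p" using p(1) V(1) by blast
    then show False using type_Neg[OF p(2) \<phi>(1)] \<phi>(2) by (simp add: cyl_def)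
  qed
  then obtain F where F: "finite F" "F \<subseteq> ?C" "\<S> \<subseteq> \<Union>(cy ` F)" by blast
  then have "\<forall>\<phi>\<in>F. \<exists>V. V \<in> \<U> \<and> cy \<phi> \<subseteq> V" by blast
  from bchoice[OF this] obtain v where v: "\<forall>\<phi>\<in>F. v \<phi> \<in> \<U> \<and> cy \<phi> \<subseteq> v \<phi>" ..
  have "\<Union>(cy ` F) \<subseteq> \<Union>(v ` F)" using v by blast
  then have "topspace (type_space L U n) \<subseteq> \<Union>(v ` F)" using F(3) by (simp add: topspace_types)
  moreover have "finite (v ` F)" "v ` F \<subseteq> \<U>" using F(1) v by auto
  ultimately show "\<exists>\<V>. finite \<V> \<and> \<V> \<subseteq> \<U> \<and> topspace (type_space L U n) \<subseteq> \<Union>\<V>"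
    by blast
qed

end

text \<open>Keisler measures and \<open>\<Delta>\<close>-measures are both of this kind.\<close>

locale formula_charge =
  fixes K :: "('f, 'r, 'a) struct" and n :: nat and D :: "('f, 'r, 'a) fm set"
    and \<eta> :: "('f, 'r, 'a) fm \<Rightarrow> real"
  assumes fa: "fa_prob K n D \<eta>"
    and D_Neg: "\<And>\<phi>. \<phi> \<in> D \<Longrightarrow> Neg \<phi> \<in> D"
    and D_Conj: "\<And>\<phi> \<psi>. \<phi> \<in> D \<Longrightarrow> \<psi> \<in> D \<Longrightarrow> Conj \<phi> \<psi> \<in> D"
begin

lemma D_Disj: "\<phi> \<in> D \<Longrightarrow> \<psi> \<in> D \<Longrightarrow> Disj \<phi> \<psi> \<in> D"
  by (simp add: Disj_def D_Neg D_Conj)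

lemma
  shows fa_cong: "\<And>\<phi> \<psi>. \<phi> \<in> D \<Longrightarrow> \<psi> \<in> D \<Longrightarrow>
      (\<And>a. a \<in> tuples K n \<Longrightarrow> holds K \<phi> a \<longleftrightarrow> holds K \<psi> a) \<Longrightarrow> \<eta> \<phi> = \<eta> \<psi>"
    and fa_nonneg: "\<And>\<phi>. \<phi> \<in> D \<Longrightarrow> 0 \<le> \<eta> \<phi>"
    and fa_total: "\<And>\<phi>. \<phi> \<in> D \<Longrightarrow> (\<And>a. a \<in> tuples K n \<Longrightarrow> holds K \<phi> a) \<Longrightarrow> \<eta> \<phi> = 1"
    and fa_add: "\<And>\<phi> \<psi>. \<phi> \<in> D \<Longrightarrow> \<psi> \<in> D \<Longrightarrow>
      (\<And>a. a \<in> tuples K n \<Longrightarrow> \<not> (holds K \<phi> a \<and> holds K \<psi> a)) \<Longrightarrow> \<eta> (Disj \<phi> \<psi>) = \<eta> \<phi> + \<eta> \<psi>"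
  using fa unfolding fa_prob_def by blast+

lemma fa_Neg: "\<phi> \<in> D \<Longrightarrow> \<eta> (Neg \<phi>) = 1 - \<eta> \<phi>"
proof -
  assume \<phi>: "\<phi> \<in> D"
  have "\<eta> (Disj \<phi> (Neg \<phi>)) = \<eta> \<phi> + \<eta> (Neg \<phi>)" by (rule fa_add) (use \<phi> D_Neg in auto)
  moreover have "\<eta> (Disj \<phi> (Neg \<phi>)) = 1" by (rule fa_total) (use \<phi> D_Neg D_Disj in auto)
  ultimately show ?thesis by simp
qed

lemma fa_mono:
  assumes "\<phi> \<in> D" "\<psi> \<in> D" "\<And>a. a \<in> tuples K n \<Longrightarrow> holds K \<phi> a \<Longrightarrow> holds K \<psi> a"
  shows "\<eta> \<phi> \<le> \<eta> \<psi>"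
proof -
  have d: "Conj \<psi> (Neg \<phi>) \<in> D" using assms D_Neg D_Conj by blast
  have "\<eta> \<psi> = \<eta> (Disj \<phi> (Conj \<psi> (Neg \<phi>)))" by (rule fa_cong) (use assms d D_Disj in auto)
  also have "\<dots> = \<eta> \<phi> + \<eta> (Conj \<psi> (Neg \<phi>))" by (rule fa_add) (use assms d in auto)
  finally show ?thesis using fa_nonneg[OF d] by simp
qed

text \<open>With \<open>P(x)\<close> for \<open>\<pi>\<close>: a measure concentrated on \<open>P\<close> respects implications that hold on \<open>P\<close>
  only.\<close>

lemma fa_mono_mod:
  assumes "\<phi> \<in> D" "\<psi> \<in> D" "\<pi> \<in> D" "\<eta> \<pi> = 1"
    "\<And>a. a \<in> tuples K n \<Longrightarrow> holds K \<pi> a \<Longrightarrow> holds K \<phi> a \<Longrightarrow> holds K \<psi> a"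
  shows "\<eta> \<phi> \<le> \<eta> \<psi>"
proof -
  have d: "Conj (Neg \<pi>) (Neg \<psi>) \<in> D" using assms D_Neg D_Conj by blast
  have "\<eta> \<phi> \<le> \<eta> (Disj \<psi> (Conj (Neg \<pi>) (Neg \<psi>)))"
    by (rule fa_mono) (use assms d D_Disj in auto)
  also have "\<dots> = \<eta> \<psi> + \<eta> (Conj (Neg \<pi>) (Neg \<psi>))" by (rule fa_add) (use assms d in auto)
  also have "\<eta> (Conj (Neg \<pi>) (Neg \<psi>)) \<le> \<eta> (Neg \<pi>)"
    by (rule fa_mono[OF d D_Neg[OF assms(3)]]) simp
  also have "\<eta> (Neg \<pi>) = 0" using fa_Neg[OF assms(3)] assms(4) by simp
  finally show ?thesis by simp
qed

end

text \<open>A clopen set of types is cut out by many formulas. They are equivalent to each other, because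
  types of tuples are dense, so the chosen representative does not matter.\<close>

definition cyl_charge ::
  "('f, 'r) lang \<Rightarrow> ('f, 'r, 'a) struct \<Rightarrow> nat \<Rightarrow> (('f, 'r, 'a) fm \<Rightarrow> real) \<Rightarrow> ('f, 'r, 'a) fm set set \<Rightarrow> real" where
  "cyl_charge L U n \<mu> b = \<mu> (SOME \<phi>. \<phi> \<in> Fm L (univ U) n \<and> b = cyl L U n \<phi>)"

locale keisler_measure =
  fixes L :: "('f, 'r) lang" and U :: "('f, 'r, 'a) struct" and n :: nat
    and \<mu> :: "('f, 'r, 'a) fm \<Rightarrow> real"
  assumes keisler: "keisler L U (univ U) n \<mu>"
begin

sublocale \<mu>: formula_charge U n "Fm L (univ U) n" \<mu>
  using keisler by unfold_locales (simp_all add: keisler_def)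

lemma charge_cyl:
  assumes \<phi>: "\<phi> \<in> Fm L (univ U) n"
  shows "cyl_charge L U n \<mu> (cyl L U n \<phi>) = \<mu> \<phi>"
proof -
  let ?\<psi> = "SOME \<psi>. \<psi> \<in> Fm L (univ U) n \<and> cyl L U n \<phi> = cyl L U n \<psi>"
  have *: "?\<psi> \<in> Fm L (univ U) n \<and> cyl L U n \<phi> = cyl L U n ?\<psi>"
    by (rule someI[of _ \<phi>]) (simp add: \<phi>)
  then have "holds U ?\<psi> a \<longleftrightarrow> holds U \<phi> a" if "a \<in> tuples U n" for a
    using cyl_subset_iff[of ?\<psi> L U n \<phi>] cyl_subset_iff[of \<phi> L U n ?\<psi>] \<phi> that by blast
  then show ?thesis unfolding cyl_charge_def using * \<phi> by (intro \<mu>.fa_cong) auto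
qed

sublocale clopen_charge "type_space L U n" "cyl L U n ` Fm L (univ U) n" "cyl_charge L U n \<mu>"
proof
  show "compact_space (type_space L U n)" by (rule compact_type_space)
  show "openin (type_space L U n) b" if "b \<in> cyl L U n ` Fm L (univ U) n" for b
    using that openin_cyl by blast
  show "topspace (type_space L U n) \<in> cyl L U n ` Fm L (univ U) n"
    unfolding topspace_types cyl_Top[symmetric] by (rule imageI) simp
  show "topspace (type_space L U n) - b \<in> cyl L U n ` Fm L (univ U) n"
    if b: "b \<in> cyl L U n ` Fm L (univ U) n" for b
  proof -
    from b obtain \<phi> where "b = cyl L U n \<phi>" "\<phi> \<in> Fm L (univ U) n" by blast
    then show ?thesis by (intro image_eqI[of _ _ "Neg \<phi>"]) (simp_all add: cyl_Neg topspace_types)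
  qed
  show "b \<union> c \<in> cyl L U n ` Fm L (univ U) n"
    if bc: "b \<in> cyl L U n ` Fm L (univ U) n" "c \<in> cyl L U n ` Fm L (univ U) n" for b c
  proof -
    from bc obtain \<phi> \<psi> where "b = cyl L U n \<phi>" "\<phi> \<in> Fm L (univ U) n" "c = cyl L U n \<psi>" "\<psi> \<in> Fm L (univ U) n"
      by blast
    then show ?thesis by (intro image_eqI[of _ _ "Disj \<phi> \<psi>"]) (simp_all add: cyl_Disj)
  qed
  show "\<exists>b\<in>cyl L U n ` Fm L (univ U) n. x \<in> b \<and> b \<subseteq> V" if "openin (type_space L U n) V" "x \<in> V" for V x
    using type_space_base[OF that] by blast
  show "0 \<le> cyl_charge L U n \<mu> b" if "b \<in> cyl L U n ` Fm L (univ U) n" for b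
    using that charge_cyl \<mu>.fa_nonneg by auto
  have "cyl_charge L U n \<mu> (cyl L U n Top) = 1" using charge_cyl[of Top] \<mu>.fa_total[of Top] by simp
  then show "cyl_charge L U n \<mu> (topspace (type_space L U n)) = 1"
    by (simp add: topspace_types cyl_Top)
  show "cyl_charge L U n \<mu> (b \<union> c) = cyl_charge L U n \<mu> b + cyl_charge L U n \<mu> c"
    if bc: "b \<in> cyl L U n ` Fm L (univ U) n" "c \<in> cyl L U n ` Fm L (univ U) n" "b \<inter> c = {}" for b c
  proof -
    from bc obtain \<phi> \<psi> where *: "b = cyl L U n \<phi>" "\<phi> \<in> Fm L (univ U) n" "c = cyl L U n \<psi>" "\<psi> \<in> Fm L (univ U) n"
      by blast
    have "cyl L U n (Conj \<phi> \<psi>) \<subseteq> cyl L U n Bot" using * bc(3) by (simp add: cyl_Conj)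
    then have "\<not> (holds U \<phi> a \<and> holds U \<psi> a)" if "a \<in> tuples U n" for a
      using cyl_subset_iff[of "Conj \<phi> \<psi>" L U n Bot] * that by simp
    then have "\<mu> (Disj \<phi> \<psi>) = \<mu> \<phi> + \<mu> \<psi>" using * by (intro \<mu>.fa_add) auto
    moreover have "b \<union> c = cyl L U n (Disj \<phi> \<psi>)" using * by (simp add: cyl_Disj)
    ultimately show ?thesis using * by (simp add: charge_cyl)
  qed
qed

abbreviation "\<nu> \<equiv> borel_extension L U n \<mu>"

lemma \<nu>_regular: "regular_borel_prob (type_space L U n) \<nu>"
  and \<nu>_cyl: "\<And>\<phi>. \<phi> \<in> Fm L (univ U) n \<Longrightarrow> measure \<nu> (cyl L U n \<phi>) = \<mu> \<phi>"
proof -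
  have "\<exists>!\<nu>. regular_borel_prob (type_space L U n) \<nu> \<and>
      (\<forall>\<phi>\<in>Fm L (univ U) n. measure \<nu> {p \<in> types L U (univ U) n. \<phi> \<in> p} = \<mu> \<phi>)"
    using regular_extension by (simp add: charge_cyl flip: cyl_def)
  from theI'[OF this] show "regular_borel_prob (type_space L U n) \<nu>"
    "\<And>\<phi>. \<phi> \<in> Fm L (univ U) n \<Longrightarrow> measure \<nu> (cyl L U n \<phi>) = \<mu> \<phi>"
    unfolding borel_extension_def cyl_def by blast+
qed

lemma \<nu>_charge: "b \<in> cyl L U n ` Fm L (univ U) n \<Longrightarrow> measure \<nu> b = cyl_charge L U n \<mu> b"
  using \<nu>_cyl charge_cyl by auto

sublocale \<nu>: prob_space \<nu>
  using \<nu>_regular by (simp add: regular_borel_prob_def)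

lemma space_\<nu>: "space \<nu> = types L U (univ U) n"
  using \<nu>_regular by (simp add: regular_borel_prob_def topspace_types)

lemma open_sets_\<nu>: "openin (type_space L U n) V \<Longrightarrow> V \<in> sets \<nu>"
  using \<nu>_regular open_sets by (simp add: regular_borel_prob_def)

lemma cyl_sets: "\<phi> \<in> Fm L (univ U) n \<Longrightarrow> cyl L U n \<phi> \<in> sets \<nu>"
  by (rule open_sets_\<nu>[OF openin_cyl])

end

section \<open>Invariant measures live on invariant types\<close>

lemma morley_pair:
  "morley L U p A n (flat ps) \<Longrightarrow> (x, y) \<in> set ps \<Longrightarrow> morley L U p A n [x, y]"
proof (induction ps rule: flat.induct)
  case (2 x' y' ps)
  show ?case
  proof (cases "(x, y) = (x', y')")
    case True
    have y: "morley L U p A n [y]"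
      by (rule morley_mono[where B = "set (concat (flat ps))"]) (use 2(2) True in auto)
    show ?thesis
      by (rule morley_mono[where B = "set (concat (y' # flat ps))"]) (use 2(2) True y in auto)
  next
    case False
    then show ?thesis using 2 by auto
  qed
qed simp

locale nip_pair_measure = nip_pair L T U M M' N' N PU n + keisler_measure L U n \<mu>
  for L :: "('f, 'r) lang" and T :: "('f, 'r, 'a) fm set"
    and U M M' N' :: "('f, 'r, 'a) struct" and N PU :: "'a set" and n :: nat and \<mu> +
  assumes \<mu>_inv: "invariant L U (univ M) n \<mu>"
begin

lemma realize_over:
  assumes q: "q \<in> types L U (univ U) m" and "finite B" "B \<subseteq> univ U"
  obtains a where "a \<in> tuples U m" "\<forall>\<phi>\<in>q \<inter> Fm L (univ M \<union> B) m. holds U \<phi> a"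
proof -
  have 1: "univ M \<union> B \<subseteq> univ U" using subs assms by blast
  have 2: "|univ M \<union> B| <o |univ U|"
    using card_Un_finite_monster[OF infinite_U _ assms(2)] small_M by (simp add: small_def)
  have 3: "q \<inter> Fm L (univ M \<union> B) m \<subseteq> Fm L (univ M \<union> B) m" by blast
  have 4: "finsat U (tuples U m) (q \<inter> Fm L (univ M \<union> B) m)"
    by (rule finsat_mono[of _ _ q]) (use q in \<open>auto simp: types_alt\<close>)
  obtain a where "a \<in> tuples U m" "\<And>\<phi>. \<phi> \<in> q \<inter> Fm L (univ M \<union> B) m \<Longrightarrow> holds U \<phi> a"
    using saturated_realize[OF saturated_U 1 2 3 4] by metis
  then show thesis by (intro that[of a]) auto
qed

lemma morley_exists:
  assumes q: "q \<in> types L U (univ U) m"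
  obtains ps where "length ps = l" "morley L U q (univ M) m (flat ps)"
proof -
  have "\<exists>ps. length ps = l \<and> morley L U q (univ M) m (flat ps)"
  proof (induction l)
    case 0
    show ?case by (rule exI[of _ "[]"]) simp
  next
    case (Suc l)
    then obtain ps where ps: "length ps = l" "morley L U q (univ M) m (flat ps)" by blast
    have U: "set (concat as) \<subseteq> univ U" if "morley L U q (univ M) m as" for as
      using morley_concat[OF that] by (simp add: tuples_def)
    from realize_over[OF q finite_set U[OF ps(2)]] obtain y where "y \<in> tuples U m"
      "\<forall>\<phi>\<in>q \<inter> Fm L (univ M \<union> set (concat (flat ps))) m. holds U \<phi> y" .
    then have y: "morley L U q (univ M) m (y # flat ps)"
      using ps(2) by (simp only: morley.simps simp_thms)
    from realize_over[OF q finite_set U[OF y]] obtain x where "x \<in> tuples U m"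
      "\<forall>\<phi>\<in>q \<inter> Fm L (univ M \<union> set (concat (y # flat ps))) m. holds U \<phi> x" .
    then have "morley L U q (univ M) m (x # y # flat ps)"
      using y by (simp only: morley.simps(2)[of _ _ _ _ _ x] simp_thms)
    then show ?case using ps(1) by (intro exI[of _ "(x, y) # ps"]) simp
  qed
  then show thesis using that by blast
qed

text \<open>If \<open>\<phi>(x;b) \<and> \<not> \<phi>(x;c)\<close> had positive measure, then so would all formulas
  \<open>\<phi>(x;y\<^sub>i) \<and> \<not> \<phi>(x;x\<^sub>i)\<close> for consecutive terms of a long Morley sequence, with the same value;
  on average, and so somewhere, many of them hold simultaneously, against NIP.\<close>

lemma alternation_null:
  assumes \<phi>: "\<phi> \<in> Fm L {} (n + m)" and q: "q \<in> inv_types L U (univ M) m"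
    and cb: "morley L U q (univ M) m [c, b]"
  shows "\<mu> (Conj (inst n \<phi> b) (Neg (inst n \<phi> c))) = 0"
proof -
  have qt: "q \<in> types L U (univ U) m" using q by (simp add: inv_types_def)
  have bc: "b \<in> tuples U m" "c \<in> tuples U m" using cb by simp_all
  have inst: "inst n \<phi> d \<in> Fm L (univ U) n" if "d \<in> tuples U m" for d
    by (rule inst_Fm[of _ _ "{}"]) (use \<phi> that in \<open>auto simp: tuples_def\<close>)
  \<comment> \<open>The formula \<open>\<phi>(x;y') \<and> \<not> \<phi>(x;y)\<close> with parameters \<open>(y,y')\<close>: in a reversed list the later term
    comes first.\<close>
  have "expressible L {} (n + (m + m)) (\<lambda>K z. holds K \<phi> (take n z @ drop (n + m) z) \<and> \<not> holds K \<phi> (take (n + m) z))"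
  proof (intro expressible_conj expressible_Not)
    let ?f = "\<lambda>i. if i < n then i else i + m"
    have "expressible L {} (n + (m + m)) (\<lambda>K z. holds K \<phi> (map (\<lambda>i. z ! ?f i) [0..<n + m]))"
      by (rule expressible_reindex[OF expressible_holds[OF \<phi>]]) (auto simp: inj_on_def split: if_splits)
    then show "expressible L {} (n + (m + m)) (\<lambda>K z. holds K \<phi> (take n z @ drop (n + m) z))"
    proof (rule expressible_cong)
      fix K :: "('f, 'r, 'a) struct" and z :: "'a list" assume z: "length z = n + (m + m)"
      have "map (\<lambda>i. z ! ?f i) [0..<n + m] = take n z @ drop (n + m) z"
        using z by (intro nth_equalityI) (auto simp: nth_append add.commute)
      then show "holds K \<phi> (map (\<lambda>i. z ! ?f i) [0..<n + m]) \<longleftrightarrow> holds K \<phi> (take n z @ drop (n + m) z)"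
        by simp
    qed
    show "expressible L {} (n + (m + m)) (\<lambda>K z. holds K \<phi> (take (n + m) z))"
      using \<phi> by (intro expressible_take expressible_holds) auto
  qed
  then obtain \<xi> where \<xi>: "\<xi> \<in> Fm L {} (n + (m + m))" and h0: "\<And>K z. length z = n + (m + m) \<Longrightarrow>
      holds K \<xi> z \<longleftrightarrow> holds K \<phi> (take n z @ drop (n + m) z) \<and> \<not> holds K \<phi> (take (n + m) z)"
    unfolding expressible_def by blast
  have inst\<xi>: "inst n \<xi> (x @ y) \<in> Fm L (univ U) n" if "x \<in> tuples U m" "y \<in> tuples U m" for x y
    by (rule inst_Fm[of _ _ "{}"]) (use \<xi> that in \<open>auto simp: tuples_def\<close>)
  have h: "holds U (inst n \<xi> (x @ y)) a \<longleftrightarrow> holds U \<phi> (a @ y) \<and> \<not> holds U \<phi> (a @ x)"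
    if "a \<in> tuples U n" "x \<in> tuples U m" "y \<in> tuples U m" for a x y
    using holds_inst[of \<xi> L "{}" a "x @ y" U] h0[of "a @ x @ y" U] \<xi> that
    by (simp add: tuples_def)
  have h\<phi>: "holds U (inst n \<phi> d) a \<longleftrightarrow> holds U \<phi> (a @ d)"
    if "a \<in> tuples U n" "d \<in> tuples U m" for a d
    using holds_inst[of \<phi> L "{}" a d U] \<phi> that by (simp add: tuples_def)
  define \<epsilon> where "\<epsilon> = \<mu> (inst n \<xi> (c @ b))"
  have \<epsilon>: "\<mu> (Conj (inst n \<phi> b) (Neg (inst n \<phi> c))) = \<epsilon>"
    unfolding \<epsilon>_def by (rule \<mu>.fa_cong) (use inst inst\<xi> h h\<phi> bc in auto)
  have \<epsilon>0: "0 \<le> \<epsilon>" unfolding \<epsilon>_def by (rule \<mu>.fa_nonneg[OF inst\<xi>[OF bc(2,1)]])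
  \<comment> \<open>NIP is applied to the opposite formula; the negation accounts for the order within the pairs.\<close>
  have "expressible L {} (m + n) (\<lambda>K c. \<not> holds K \<phi> (drop m c @ take m c))"
    using \<phi> by (intro expressible_Not expressible_swap expressible_holds)
  then obtain \<psi> where \<psi>: "\<psi> \<in> Fm L {} (m + n)"
    and h\<psi>0: "\<And>K z. length z = m + n \<Longrightarrow> holds K \<psi> z \<longleftrightarrow> \<not> holds K \<phi> (drop m z @ take m z)"
    unfolding expressible_def by blast
  have h\<psi>: "holds U \<psi> (y @ a) \<longleftrightarrow> \<not> holds U \<phi> (a @ y)" if "y \<in> tuples U m" "a \<in> tuples U n" for y a
    using h\<psi>0[of "y @ a" U] that by (simp add: tuples_def)
  from NIP_morley_alternation[OF nip \<psi>] obtain k where k: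
    "\<And>A p ps d. A \<subseteq> univ U \<Longrightarrow> p \<in> inv_types L U A m \<Longrightarrow> morley L U p A m (flat ps) \<Longrightarrow>
      d \<in> tuples U n \<Longrightarrow> (\<And>x y. (x, y) \<in> set ps \<Longrightarrow> holds U \<psi> (x @ d) \<and> \<not> holds U \<psi> (y @ d)) \<Longrightarrow>
      length ps < k" by metis
  have bound: "real l * \<epsilon> \<le> real k" for l
  proof -
    obtain ps where ps: "length ps = l" "morley L U q (univ M) m (flat ps)"
      using morley_exists[OF qt] .
    have psU: "x \<in> tuples U m \<and> y \<in> tuples U m" if "(x, y) \<in> set ps" for x y
      using morley_pair[OF ps(2) that] by simp
    define A where "A i = cyl L U n (inst n \<xi> (fst (ps ! i) @ snd (ps ! i)))" for i
    have A: "A i \<in> sets \<nu>" "measure \<nu> (A i) = \<epsilon>" if "i < l" for i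
    proof -
      obtain x y where xy: "ps ! i = (x, y)" by fastforce
      then have mem: "(x, y) \<in> set ps" using ps(1) that nth_mem by metis
      have "tp L U (concat [x, y]) (univ M) = tp L U (concat [c, b]) (univ M)"
        by (rule morley_tp[OF q subs(1) _ morley_pair[OF ps(2) mem] cb]) simp
      then have "\<mu> (inst n \<xi> (x @ y)) = \<epsilon>"
        using \<mu>_inv \<xi> psU[OF mem] bc unfolding invariant_def \<epsilon>_def
        by (auto simp: tuples_def)
      then show "A i \<in> sets \<nu>" "measure \<nu> (A i) = \<epsilon>"
        using inst\<xi> psU[OF mem] by (simp_all add: A_def xy cyl_sets \<nu>_cyl)
    qed
    \<comment> \<open>The number of indices at which \<open>p\<close> contains \<open>\<phi>(x;y\<^sub>i) \<and> \<not> \<phi>(x;x\<^sub>i)\<close>; its mean is \<open>l\<epsilon>\<close>.\<close>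
    define f where "f p = (\<Sum>i<l. indicator (A i) p :: real)" for p
    have "f p \<le> real k" if p: "p \<in> types L U (univ U) n" for p
    proof -
      define Q where "Q = (\<lambda>(x, y). inst n \<xi> (x @ y) \<in> p)"
      define ps' where "ps' = filter Q ps"
      have "f p = (\<Sum>i<l. if Q (ps ! i) then 1 else 0)"
        unfolding f_def by (intro sum.cong) (auto simp: A_def cyl_def Q_def p indicator_def split: prod.splits)
      also have "\<dots> = real (card {i. i < l \<and> Q (ps ! i)})"
        by (simp add: sum.If_cases Int_def)
      also have "\<dots> = real (length ps')"
        by (simp add: ps'_def length_filter_conv_card ps(1))
      finally have fl: "f p = real (length ps')" .
      have "(\<lambda>(x, y). inst n \<xi> (x @ y)) ` set ps' \<subseteq> p" by (auto simp: ps'_def Q_def)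
      from type_sat[OF p _ this] obtain d where d: "d \<in> tuples U n"
        "\<forall>\<theta>\<in>(\<lambda>(x, y). inst n \<xi> (x @ y)) ` set ps'. holds U \<theta> d" by auto
      have "length ps' < k"
      proof (rule k[OF subs(1) q _ d(1)])
        show "morley L U q (univ M) m (flat ps')" using morley_filter[OF ps(2)] by (simp add: ps'_def)
        fix x y assume xy: "(x, y) \<in> set ps'"
        then have "x \<in> tuples U m" "y \<in> tuples U m" using psU by (auto simp: ps'_def)
        moreover have "holds U (inst n \<xi> (x @ y)) d" using d(2) xy by auto
        ultimately show "holds U \<psi> (x @ d) \<and> \<not> holds U \<psi> (y @ d)"
          using h h\<psi> d(1) by simp
      qed
      then show ?thesis using fl by simp
    qed
    moreover have int: "integrable \<nu> f"
      unfolding f_def using A by (intro Bochner_Integration.integrable_sum) (simp add: \<nu>.emeasure_eq_measure)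
    ultimately have "integral\<^sup>L \<nu> f \<le> real k"
      by (intro \<nu>.integral_le_const AE_I2) (simp_all add: space_\<nu>)
    moreover have "integral\<^sup>L \<nu> f = (\<Sum>i<l. measure \<nu> (A i))"
      unfolding f_def using A by (subst Bochner_Integration.integral_sum) (auto simp: \<nu>.emeasure_eq_measure)
    ultimately show ?thesis using A by simp
  qed
  have "\<epsilon> = 0"
  proof (rule ccontr)
    assume "\<epsilon> \<noteq> 0"
    with \<epsilon>0 have "0 < \<epsilon>" by simp
    then obtain l where "real k < real l * \<epsilon>" using reals_Archimedean3 by blast
    with bound[of l] show False by simp
  qed
  then show ?thesis using \<epsilon> by simp
qed

text \<open>Two tuples with the same type over \<open>M\<close> are compared through a common second term of a
  Morley sequence of a coheir of that type.\<close>

lemma invariant_null: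
  assumes \<phi>: "\<phi> \<in> Fm L {} (n + m)" and b: "b \<in> tuples U m" "b' \<in> tuples U m"
    and eq: "tp L U b (univ M) = tp L U b' (univ M)"
  shows "\<mu> (Conj (inst n \<phi> b) (Neg (inst n \<phi> b'))) = 0"
proof -
  let ?X = "{a. length a = m \<and> set a \<subseteq> univ M}"
  have lb: "length b = m" using b by (simp add: tuples_def)
  have Fm: "tp L U b (univ M) \<subseteq> Fm L (univ M) m" using lb by (auto simp: tp_def)
  have fs: "finsat U ?X (tp L U b (univ M))"
    unfolding finsat_def
  proof (intro allI impI)
    fix G assume G: "finite G" "G \<subseteq> tp L U b (univ M)"
    then have "G \<subseteq> Fm L (univ M) m" using Fm by blast
    from Fm_finite_conj[OF G(1) this] obtain \<theta> where \<theta>: "\<theta> \<in> Fm L (univ M) m"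
      "\<And>K a. holds K \<theta> a \<longleftrightarrow> (\<forall>\<phi>\<in>G. holds K \<phi> a)" by metis
    have "holds U \<theta> b" using G(2) by (auto simp: \<theta>(2) tp_def)
    then obtain a where "a \<in> tuples M m" "holds U \<theta> a"
      using elem_sub_ex[OF MU \<theta>(1) b(1)] by metis
    then show "\<exists>a\<in>?X. \<forall>\<phi>\<in>G. holds U \<phi> a" by (auto simp: \<theta>(2) tuples_def)
  qed
  have FmU: "tp L U b (univ M) \<subseteq> Fm L (univ U) m" using Fm Fm_mono[OF _ subs(1) order_refl] by blast
  have "?X \<subseteq> tuples U m" using subs by (auto simp: tuples_def)
  from finsat_extend[OF FmU fs this] obtain q where
    q: "tp L U b (univ M) \<subseteq> q" "q \<in> types L U (univ U) m" "finsat U ?X q" .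
  have qi: "q \<in> inv_types L U (univ M) m" by (rule coheir_invariant[OF q(2,3)])
  have "finite (set (b @ b'))" "set (b @ b') \<subseteq> univ U" using b by (auto simp: tuples_def)
  from realize_over[OF q(2) this] obtain c where c: "c \<in> tuples U m"
    "\<forall>\<phi>\<in>q \<inter> Fm L (univ M \<union> set (b @ b')) m. holds U \<phi> c" .
  have mor: "morley L U q (univ M) m [c, d]"
    if d: "d \<in> tuples U m" "tp L U d (univ M) = tp L U b (univ M)" "set d \<subseteq> set (b @ b')" for d
  proof -
    have "holds U \<theta> d" if \<theta>: "\<theta> \<in> q \<inter> Fm L (univ M \<union> set (concat [])) m" for \<theta>
    proof (rule ccontr)
      assume "\<not> holds U \<theta> d"
      then have "Neg \<theta> \<in> tp L U d (univ M)" using \<theta> d(1) by (auto simp: tp_def tuples_def)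
      then have "Neg \<theta> \<in> q" using q(1) d(2) by blast
      moreover have "\<theta> \<in> Fm L (univ U) m" using \<theta> q(2) by (auto simp: types_def)
      ultimately show False using type_Neg[OF q(2)] \<theta> by blast
    qed
    then have "morley L U q (univ M) m [d]" using d(1) by simp
    then show ?thesis
      by (intro morley_mono[OF c]) (use d(3) in auto)
  qed
  have 1: "\<mu> (Conj (inst n \<phi> b) (Neg (inst n \<phi> c))) = 0"
    by (rule alternation_null[OF \<phi> qi mor]) (use b in auto)
  have "\<mu> (Conj (inst n (Neg \<phi>) b') (Neg (inst n (Neg \<phi>) c))) = 0"
    by (rule alternation_null[OF _ qi mor]) (use \<phi> b eq in auto)
  then have 2: "\<mu> (Conj (Neg (inst n \<phi> b')) (Neg (Neg (inst n \<phi> c)))) = 0"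
    by (simp add: inst_def)
  have inst: "inst n \<phi> d \<in> Fm L (univ U) n" if "d \<in> tuples U m" for d
    by (rule inst_Fm[of _ _ "{}"]) (use \<phi> that in \<open>auto simp: tuples_def\<close>)
  note i = inst[OF b(1)] inst[OF b(2)] inst[OF c(1)]
  let ?C = "cyl L U n"
  let ?X = "Conj (inst n \<phi> b) (Neg (inst n \<phi> b'))" and ?Y = "Conj (inst n \<phi> b) (Neg (inst n \<phi> c))"
    and ?Z = "Conj (Neg (inst n \<phi> b')) (Neg (Neg (inst n \<phi> c)))"
  have "?C ?X \<subseteq> ?C ?Y \<union> ?C ?Z"
    using i by (auto simp: cyl_Conj cyl_Neg)
  then have "measure \<nu> (?C ?X) \<le> measure \<nu> (?C ?Y \<union> ?C ?Z)"
    using i by (intro \<nu>.finite_measure_mono) (auto intro!: cyl_sets)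
  also have "\<dots> \<le> measure \<nu> (?C ?Y) + measure \<nu> (?C ?Z)"
    using i by (intro measure_subadditive) (auto intro!: cyl_sets)
  finally have "\<mu> ?X \<le> \<mu> ?Y + \<mu> ?Z" using i by (simp add: \<nu>_cyl)
  then show ?thesis using 1 2 \<mu>.fa_nonneg[of ?X] i by simp
qed

abbreviation "Inv \<equiv> inv_types L U (univ M) n"

text \<open>The complement of the invariant types is the union of the null clopen sets
  \<open>[\<phi>(x;b) \<and> \<not> \<phi>(x;b')]\<close>. The union need not be countable; it is null by regularity.\<close>

lemma Inv_full: "Inv \<in> sets \<nu>" "measure \<nu> Inv = 1"
proof -
  define \<W> where "\<W> = {cyl L U n (Conj (inst n \<phi> b) (Neg (inst n \<phi> b'))) | m \<phi> b b'.
    \<phi> \<in> Fm L {} (n + m) \<and> b \<in> tuples U m \<and> b' \<in> tuples U m \<and> tp L U b (univ M) = tp L U b' (univ M)}"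
  have inst: "inst n \<phi> d \<in> Fm L (univ U) n" if "\<phi> \<in> Fm L {} (n + m)" "d \<in> tuples U m" for m \<phi> d
    by (rule inst_Fm[of _ _ "{}"]) (use that in \<open>auto simp: tuples_def\<close>)
  have \<W>: "w \<in> cyl L U n ` Fm L (univ U) n \<and> measure \<nu> w = 0" if w: "w \<in> \<W>" for w
  proof -
    from w obtain m \<phi> b b' where *: "w = cyl L U n (Conj (inst n \<phi> b) (Neg (inst n \<phi> b')))"
      "\<phi> \<in> Fm L {} (n + m)" "b \<in> tuples U m" "b' \<in> tuples U m" "tp L U b (univ M) = tp L U b' (univ M)"
      unfolding \<W>_def by blast
    have "Conj (inst n \<phi> b) (Neg (inst n \<phi> b')) \<in> Fm L (univ U) n" using inst[OF *(2)] * by simp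
    then show ?thesis using invariant_null[OF *(2-5)] *(1) by (simp add: \<nu>_cyl)
  qed
  have op: "openin (type_space L U n) (\<Union>\<W>)" using \<W> B_open by (intro openin_Union) blast
  have Inv: "Inv = space \<nu> - \<Union>\<W>"
  proof (intro set_eqI iffI)
    fix p assume "p \<in> Inv"
    then have p: "p \<in> types L U (univ U) n" "invariant L U (univ M) n (\<lambda>\<phi>. \<phi> \<in> p)"
      by (auto simp: inv_types_def)
    have "p \<notin> w" if w: "w \<in> \<W>" for w
    proof
      assume pw: "p \<in> w"
      from w obtain m \<phi> b b' where *: "w = cyl L U n (Conj (inst n \<phi> b) (Neg (inst n \<phi> b')))"
        "\<phi> \<in> Fm L {} (n + m)" "b \<in> tuples U m" "b' \<in> tuples U m" "tp L U b (univ M) = tp L U b' (univ M)"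
        unfolding \<W>_def by blast
      have "inst n \<phi> b \<in> p \<longleftrightarrow> inst n \<phi> b' \<in> p" using p(2) *(2-5) unfolding invariant_def by blast
      then show False using pw inst[OF *(2,3)] inst[OF *(2,4)] by (simp add: * cyl_Conj cyl_Neg) (auto simp: cyl_def)
    qed
    then show "p \<in> space \<nu> - \<Union>\<W>" using p(1) by (auto simp: space_\<nu>)
  next
    fix p assume p: "p \<in> space \<nu> - \<Union>\<W>"
    then have pt: "p \<in> types L U (univ U) n" by (simp add: space_\<nu>)
    show "p \<in> Inv"
    proof (rule inv_typeI[OF pt], rule ccontr)
      fix m \<phi> b b'
      assume *: "\<phi> \<in> Fm L {} (n + m)" "b \<in> tuples U m" "b' \<in> tuples U m"
        "tp L U b (univ M) = tp L U b' (univ M)" "inst n \<phi> b \<in> p"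
      assume "inst n \<phi> b' \<notin> p"
      then have "p \<in> cyl L U n (Conj (inst n \<phi> b) (Neg (inst n \<phi> b')))"
        using *(5) pt inst[OF *(1,2)] inst[OF *(1,3)] by (simp add: cyl_Conj cyl_Neg) (simp add: cyl_def)
      moreover have "cyl L U n (Conj (inst n \<phi> b) (Neg (inst n \<phi> b'))) \<in> \<W>"
        unfolding \<W>_def using *(1-4) by blast
      ultimately show False using p by blast
    qed
  qed
  show "Inv \<in> sets \<nu>" unfolding Inv using open_sets_\<nu>[OF op] by blast
  have "emeasure \<nu> (\<Union>\<W>) \<le> ennreal 0"
  proof (rule regular_Union_le[OF \<nu>_regular \<nu>_charge])
    show "\<W> \<subseteq> cyl L U n ` Fm L (univ U) n" using \<W> by blast
    fix G assume G: "finite G" "G \<subseteq> \<W>"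
    then have GB: "G \<subseteq> cyl L U n ` Fm L (univ U) n" using \<W> by blast
    then have "cyl_charge L U n \<mu> (\<Union>G) = measure \<nu> (\<Union>G)" using \<nu>_charge[OF B_Union[OF G(1)]] by simp
    also have "\<dots> \<le> (\<Sum>w\<in>G. measure \<nu> w)"
      using \<nu>.finite_measure_subadditive_finite[of G "\<lambda>w. w"] G(1) GB cyl_sets by auto
    also have "\<dots> = 0" using G(2) \<W> by (intro sum.neutral) blast
    finally show "cyl_charge L U n \<mu> (\<Union>G) \<le> 0" .
  qed
  then have "measure \<nu> (\<Union>\<W>) = 0" by (simp add: measure_def)
  then show "measure \<nu> Inv = 1" unfolding Inv using \<nu>.prob_compl[OF open_sets_\<nu>[OF op]] by simp
qed

end

section \<open>Extending measures to \<open>\<Delta>\<close>-formulas\<close>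

text \<open>Charges are defined on all subsets of the type, with \<open>X\<close> as a set of full measure; solution sets
  of formulas can then be measured without intersecting them with \<open>X\<close>.\<close>

definition charge_on :: "'x set \<Rightarrow> ('x set \<Rightarrow> real) \<Rightarrow> bool" where
  "charge_on X g \<longleftrightarrow> (\<forall>Y. 0 \<le> g Y) \<and> (\<forall>Y Z. Y \<inter> Z = {} \<longrightarrow> g (Y \<union> Z) = g Y + g Z) \<and>
     g UNIV = 1 \<and> g (- X) = 0"

lemma charge_on_add: "charge_on X g \<Longrightarrow> Y \<inter> Z = {} \<Longrightarrow> g (Y \<union> Z) = g Y + g Z"
  by (simp add: charge_on_def)

lemma charge_on_mono: "charge_on X g \<Longrightarrow> Y \<subseteq> Z \<Longrightarrow> g Y \<le> g Z"
proof -
  assume g: "charge_on X g" and YZ: "Y \<subseteq> Z"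
  have "g (Y \<union> (Z - Y)) = g Y + g (Z - Y)" by (rule charge_on_add[OF g]) blast
  moreover have "Y \<union> (Z - Y) = Z" using YZ by blast
  moreover have "0 \<le> g (Z - Y)" using g by (simp add: charge_on_def)
  ultimately show ?thesis by simp
qed

lemma charge_on_restrict: "charge_on X g \<Longrightarrow> g (Y \<inter> X) = g Y"
proof -
  assume g: "charge_on X g"
  have "g ((Y \<inter> X) \<union> (Y - X)) = g (Y \<inter> X) + g (Y - X)" by (rule charge_on_add[OF g]) blast
  moreover have "(Y \<inter> X) \<union> (Y - X) = Y" by blast
  moreover have "g (Y - X) \<le> g (- X)" by (rule charge_on_mono[OF g]) blast
  moreover have "0 \<le> g (Y - X)" "g (- X) = 0" using g by (auto simp: charge_on_def)
  ultimately show ?thesis by simp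
qed

text \<open>The charges form a closed subset of a compact power of \<open>[0,1]\<close>, so finitely many prescribed
  values at a time suffice.\<close>

lemma charge_extension:
  fixes S :: "'i \<Rightarrow> 'x set" and v :: "'i \<Rightarrow> real"
  assumes fin: "\<And>F. finite F \<Longrightarrow> F \<subseteq> I \<Longrightarrow> \<exists>g. charge_on X g \<and> (\<forall>i\<in>F. g (S i) = v i)"
  shows "\<exists>g. charge_on X g \<and> (\<forall>i\<in>I. g (S i) = v i)"
proof -
  let ?K = "PiE UNIV (\<lambda>_ :: 'x set. {0..1 :: real})"
  define C where "C i = {g. charge_on X g} \<inter> {g. g (S i) = v i}" for i
  have K: "compact ?K"
  proof -
    have "compactin (product_topology (\<lambda>i :: 'x set. euclidean) UNIV) ?K"
      unfolding compactin_PiE by simp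
    then show ?thesis by (simp add: euclidean_product_topology)
  qed
  have "{g. charge_on X g} = (\<Inter>Y. {g. 0 \<le> g Y}) \<inter>
      (\<Inter>Y. \<Inter>Z\<in>{Z. Y \<inter> Z = {}}. {g. g (Y \<union> Z) = g Y + g Z}) \<inter> {g. g UNIV = 1} \<inter> {g. g (- X) = 0}"
    unfolding charge_on_def by blast
  also have "closed \<dots>"
    by (intro closed_Int closed_INT ballI closed_Collect_le closed_Collect_eq continuous_on_add
        continuous_on_const continuous_on_product_coordinates)
  finally have cl: "closed {g. charge_on X g}" .
  have sub: "g \<in> ?K" if "charge_on X g" for g
    using that charge_on_mono[OF that, of _ UNIV] by (auto simp: charge_on_def)
  have "?K \<inter> \<Inter>(insert {g. charge_on X g} (C ` I)) \<noteq> {}"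
  proof (rule compact_imp_fip[OF K])
    fix D assume "D \<in> insert {g. charge_on X g} (C ` I)"
    then show "closed D"
      using cl by (auto simp: C_def intro!: closed_Int closed_Collect_eq continuous_on_const)
  next
    fix G assume G: "finite G" "G \<subseteq> insert {g. charge_on X g} (C ` I)"
    then have "finite (G - {{g. charge_on X g}})" "G - {{g. charge_on X g}} \<subseteq> C ` I" by auto
    from finite_subset_image[OF this] obtain F where F: "F \<subseteq> I" "finite F" "G - {{g. charge_on X g}} = C ` F"
      by blast
    from fin[OF F(2,1)] obtain g where g: "charge_on X g" "\<forall>i\<in>F. g (S i) = v i" by blast
    have "g \<in> D" if "D \<in> G" for D
    proof (cases "D = {g. charge_on X g}")
      case False
      then have "D \<in> C ` F" using that F(3) by blast
      then show ?thesis using g by (auto simp: C_def)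
    qed (use g in simp)
    then show "?K \<inter> \<Inter>G \<noteq> {}" using sub[OF g(1)] by blast
  qed
  then obtain g where "charge_on X g" "\<forall>i\<in>I. g \<in> C i" by auto
  then show ?thesis by (auto simp: C_def)
qed

context nip_pair_measure
begin

lemma sets_trace:
  assumes "finite F" "F \<subseteq> Fm L (univ U) n"
  shows "{p \<in> space \<nu>. Q (p \<inter> F)} \<in> sets \<nu>"
proof -
  have one: "{p \<in> space \<nu>. p \<inter> F = G} \<in> sets \<nu>" if "G \<subseteq> F" for G
  proof -
    have "{p \<in> space \<nu>. \<phi> \<in> p \<longleftrightarrow> \<phi> \<in> G} \<in> sets \<nu>" if "\<phi> \<in> F" for \<phi>
    proof -
      have "{p \<in> space \<nu>. \<phi> \<in> p \<longleftrightarrow> \<phi> \<in> G} = (if \<phi> \<in> G then cyl L U n \<phi> else space \<nu> - cyl L U n \<phi>)"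
        by (auto simp: cyl_def space_\<nu>)
      moreover have "cyl L U n \<phi> \<in> sets \<nu>" using assms(2) that by (intro cyl_sets) blast
      ultimately show ?thesis by (cases "\<phi> \<in> G") simp_all
    qed
    then have "{p \<in> space \<nu>. \<forall>\<phi>\<in>F. \<phi> \<in> p \<longleftrightarrow> \<phi> \<in> G} \<in> sets \<nu>"
      by (rule sets.sets_Collect_finite_All[OF _ assms(1)])
    moreover have "p \<inter> F = G \<longleftrightarrow> (\<forall>\<phi>\<in>F. \<phi> \<in> p \<longleftrightarrow> \<phi> \<in> G)" for p using that by blast
    ultimately show ?thesis by simp
  qed
  have "{p \<in> space \<nu>. Q (p \<inter> F)} = (\<Union>G\<in>{G \<in> Pow F. Q G}. {p \<in> space \<nu>. p \<inter> F = G})"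
    by auto
  also have "\<dots> \<in> sets \<nu>"
    using assms(1) by (intro sets.finite_UN) (auto intro: one)
  finally show ?thesis .
qed

text \<open>Choosing, for each type, a point of \<open>P\<close> that agrees with it on the finite set \<open>F\<close> pushes
  the measure forward to a charge on the points of \<open>P\<close> with the right values on \<open>F\<close>.\<close>

lemma finite_charge:
  assumes F: "finite F" "F \<subseteq> Fm L N n"
  shows "\<exists>g. charge_on {a. length a = n \<and> set a \<subseteq> PU} g \<and> (\<forall>\<phi>\<in>F. g {a. holds U \<phi> a} = \<mu> \<phi>)"
proof -
  have FU: "F \<subseteq> Fm L (univ U) n" using F(2) Fm_mono[OF _ subs(6) order_refl] by blast
  let ?X = "{a. length a = n \<and> set a \<subseteq> PU}"
  define h where "h G = (SOME a. a \<in> ?X \<and> (\<forall>\<phi>\<in>F. holds U \<phi> a \<longleftrightarrow> \<phi> \<in> G))" for G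
  have h: "h (p \<inter> F) \<in> ?X \<and> (\<forall>\<phi>\<in>F. holds U \<phi> (h (p \<inter> F)) \<longleftrightarrow> \<phi> \<in> p)" if p: "p \<in> types L U (univ U) n" for p
  proof -
    let ?l = "\<lambda>\<phi>. if \<phi> \<in> p then \<phi> else Neg \<phi>"
    have "?l ` F \<subseteq> p \<inter> Fm L N n"
    proof (rule image_subsetI)
      fix \<phi> assume "\<phi> \<in> F"
      then have "\<phi> \<in> Fm L N n" "\<phi> \<in> Fm L (univ U) n" using F(2) FU by auto
      then show "?l \<phi> \<in> p \<inter> Fm L N n" using type_Neg[OF p] by simp
    qed
    from realize_in_N[OF p finite_imageI[OF F(1)] this] obtain c where
      c: "length c = n" "set c \<subseteq> N" "\<forall>\<psi>\<in>?l ` F. holds N' \<psi> c" .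
    have cN': "c \<in> tuples N' n" using c N_sub by (auto simp: tuples_def)
    have "holds U \<phi> c \<longleftrightarrow> \<phi> \<in> p \<inter> F" if \<phi>: "\<phi> \<in> F" for \<phi>
    proof -
      have "\<phi> \<in> Fm L (univ N') n" using \<phi> F(2) Fm_mono[OF _ N_sub order_refl] by blast
      then have "holds U \<phi> c \<longleftrightarrow> holds N' \<phi> c" using holds_elem_sub[OF N'U _ cN'] by blast
      also have "\<dots> \<longleftrightarrow> \<phi> \<in> p"
        using bspec[OF c(3) imageI[OF \<phi>]] by (cases "\<phi> \<in> p") simp_all
      finally show ?thesis using \<phi> by simp
    qed
    then have "c \<in> ?X \<and> (\<forall>\<phi>\<in>F. holds U \<phi> c \<longleftrightarrow> \<phi> \<in> p \<inter> F)" using c N_sub_PU by auto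
    then have "h (p \<inter> F) \<in> ?X \<and> (\<forall>\<phi>\<in>F. holds U \<phi> (h (p \<inter> F)) \<longleftrightarrow> \<phi> \<in> p \<inter> F)"
      unfolding h_def by (rule someI)
    then show ?thesis by simp
  qed
  define g where "g Y = measure \<nu> {p \<in> space \<nu>. h (p \<inter> F) \<in> Y}" for Y
  have "charge_on ?X g"
    unfolding charge_on_def
  proof (intro conjI allI impI)
    show "0 \<le> g Y" for Y by (simp add: g_def)
    show "g (Y \<union> Z) = g Y + g Z" if "Y \<inter> Z = {}" for Y Z
    proof -
      have "{p \<in> space \<nu>. h (p \<inter> F) \<in> Y \<union> Z} = {p \<in> space \<nu>. h (p \<inter> F) \<in> Y} \<union> {p \<in> space \<nu>. h (p \<inter> F) \<in> Z}"
        by auto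
      then show ?thesis unfolding g_def
        using that by (subst \<nu>.finite_measure_Union[symmetric])
          (auto intro!: sets_trace[OF F(1) FU, of "\<lambda>G. h G \<in> Y"] sets_trace[OF F(1) FU, of "\<lambda>G. h G \<in> Z"])
    qed
    show "g UNIV = 1" by (simp add: g_def \<nu>.prob_space)
    have "{p \<in> space \<nu>. h (p \<inter> F) \<in> - ?X} = {}" using h by (auto simp: space_\<nu>)
    then show "g (- ?X) = 0" unfolding g_def by (simp only: measure_empty)
  qed
  moreover have "g {a. holds U \<phi> a} = \<mu> \<phi>" if \<phi>: "\<phi> \<in> F" for \<phi>
  proof -
    have "{p \<in> space \<nu>. h (p \<inter> F) \<in> {a. holds U \<phi> a}} = cyl L U n \<phi>"
      using h \<phi> by (auto simp: space_\<nu> cyl_def)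
    moreover have "\<phi> \<in> Fm L (univ U) n" using \<phi> FU by blast
    ultimately show ?thesis unfolding g_def using \<nu>_cyl by (simp only:)
  qed
  ultimately show ?thesis by blast
qed

text \<open>Only because such measures exist is there a common restriction to speak of.\<close>

lemma delta_extensions_nonempty: "delta_extensions L U PU N n \<mu> \<noteq> {}"
proof -
  let ?X = "{a. length a = n \<and> set a \<subseteq> PU}"
  obtain g where g: "charge_on ?X g" and g\<mu>: "\<And>\<phi>. \<phi> \<in> Fm L N n \<Longrightarrow> g {a. holds U \<phi> a} = \<mu> \<phi>"
    using charge_extension[of "Fm L N n" ?X "\<lambda>\<phi>. {a. holds U \<phi> a}" \<mu>, OF finite_charge] by blast
  let ?S = "\<lambda>\<delta>. {a \<in> ?X. holds (pair U PU) \<delta> a}"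
  have gX: "g ?X = 1"
    using charge_on_restrict[OF g, of UNIV] g by (simp add: charge_on_def)
  have XU: "a \<in> tuples U n" if "a \<in> ?X" for a using that PU_sub by (auto simp: tuples_def)
  define \<eta> where "\<eta> = (\<lambda>\<delta>\<in>Delta L (univ U) n. g (?S \<delta>))"
  have "fa_prob (pair U PU) n (Delta L (univ U) n) \<eta>"
    unfolding fa_prob_def
  proof (intro conjI ballI impI)
    show "\<eta> \<in> extensional (Delta L (univ U) n)" by (simp add: \<eta>_def)
    show "0 \<le> \<eta> \<delta>" if "\<delta> \<in> Delta L (univ U) n" for \<delta>
      using g that by (simp add: \<eta>_def charge_on_def)
    show "\<eta> \<delta> = 1" if "\<delta> \<in> Delta L (univ U) n" "\<forall>a\<in>tuples (pair U PU) n. holds (pair U PU) \<delta> a" for \<delta>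
    proof -
      have "?S \<delta> = ?X" using that(2) XU by auto
      then show ?thesis using that(1) gX by (simp add: \<eta>_def)
    qed
    show "\<eta> \<delta> = \<eta> \<delta>'" if "\<delta> \<in> Delta L (univ U) n" "\<delta>' \<in> Delta L (univ U) n"
      "\<forall>a\<in>tuples (pair U PU) n. holds (pair U PU) \<delta> a \<longleftrightarrow> holds (pair U PU) \<delta>' a" for \<delta> \<delta>'
    proof -
      have "?S \<delta> = ?S \<delta>'" using that(3) XU by auto
      then show ?thesis using that by (simp add: \<eta>_def)
    qed
    show "\<eta> (Disj \<delta> \<delta>') = \<eta> \<delta> + \<eta> \<delta>'" if "\<delta> \<in> Delta L (univ U) n" "\<delta>' \<in> Delta L (univ U) n"
      "\<forall>a\<in>tuples (pair U PU) n. \<not> (holds (pair U PU) \<delta> a \<and> holds (pair U PU) \<delta>' a)" for \<delta> \<delta>'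
    proof -
      have "Disj \<delta> \<delta>' \<in> Delta L (univ U) n" using that by (auto simp: Disj_def intro: Delta.intros)
      moreover have "?S (Disj \<delta> \<delta>') = ?S \<delta> \<union> ?S \<delta>'" by auto
      moreover have "?S \<delta> \<inter> ?S \<delta>' = {}" using that(3) XU by auto
      ultimately show ?thesis using that g by (simp add: \<eta>_def charge_on_def)
    qed
  qed
  moreover have "\<eta> (lift \<phi>) = \<mu> \<phi>" if \<phi>: "\<phi> \<in> Fm L N n" for \<phi>
  proof -
    have "lift \<phi> \<in> Delta L (univ U) n" by (intro Delta.intros Fm_mono[OF \<phi> subs(6) order_refl])
    moreover have "?S (lift \<phi>) = {a. holds U \<phi> a} \<inter> ?X" by auto
    ultimately show ?thesis using charge_on_restrict[OF g] g\<mu>[OF \<phi>] by (simp add: \<eta>_def)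
  qed
  moreover have "\<eta> (Pfm n) = 1"
  proof -
    have "?S (Pfm n) = ?X" by auto
    then show ?thesis using gX by (simp add: \<eta>_def Delta.intros)
  qed
  ultimately show ?thesis unfolding delta_extensions_def by blast
qed

end

section \<open>The two constructions agree\<close>

context nip_pair_measure
begin

definition C :: "('f, 'r, 'a) fm \<Rightarrow> ('f, 'r, 'a) fm set set" where
  "C \<phi> = {p \<in> Inv. \<phi> \<in> F\<^sub>M p}"

abbreviation "FM\<mu> \<equiv> FM L U M M' N' N n \<mu>"

lemma FM_eq: "\<phi> \<in> Fm L (univ U) n \<Longrightarrow> FM\<mu> \<phi> = measure \<nu> (C \<phi>)"
  by (simp add: FM_def C_def)

lemma F_type: "p \<in> Inv \<Longrightarrow> F\<^sub>M p \<in> types L U (univ U) n"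
  using F_inv by (simp add: inv_types_def)

lemma C_eq:
  assumes \<phi>: "\<phi> \<in> Fm L (univ M') n"
  shows "C \<phi> = Inv \<inter> \<Union>(cyl L U n ` \<Theta> \<phi>)"
proof -
  have "\<phi> \<in> F\<^sub>M p \<longleftrightarrow> (\<exists>\<theta>\<in>\<Theta> \<phi>. \<theta> \<in> p)" if p: "p \<in> Inv" for p
  proof -
    have pt: "p \<in> types L U (univ U) n" using p by (simp add: inv_types_def)
    show ?thesis using F_iff[OF p \<phi>] FM_base_iff[OF pt \<phi>] by simp
  qed
  then show ?thesis by (auto simp: C_def cyl_def inv_types_def)
qed

lemma C_representative:
  assumes "\<phi>0 \<in> Fm L {} (n + m)" "b \<in> tuples U m" "b' \<in> tuples U m"
    "tp L U b (univ M) = tp L U b' (univ M)" "\<phi> \<in> Fm L (univ U) n" "inst n \<phi>0 b \<in> Fm L (univ U) n"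
    "\<And>a. a \<in> tuples U n \<Longrightarrow> holds U \<phi> a \<longleftrightarrow> holds U (inst n \<phi>0 b) a"
  shows "C \<phi> = C (inst n \<phi>0 b')"
proof -
  have "\<phi> \<in> F\<^sub>M p \<longleftrightarrow> inst n \<phi>0 b' \<in> F\<^sub>M p" if p: "p \<in> Inv" for p
    using inv_type_representative[OF assms F_inv[OF p]] .
  then show ?thesis by (auto simp: C_def)
qed

lemma open_\<Theta>: "openin (type_space L U n) (\<Union>(cyl L U n ` \<Theta> \<phi>))"
  using \<Theta>_Fm openin_cyl by (intro openin_Union) blast

text \<open>By invariance \<open>\<phi>\<close> may be replaced with a formula over \<open>M'\<close>, for which the set is relatively
  open in the invariant types.\<close>

lemma C_sets:
  assumes "\<phi> \<in> Fm L (univ U) n"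
  shows "C \<phi> \<in> sets \<nu>"
proof -
  from invariant_representative[OF assms] obtain m \<phi>0 b b' where
    rep: "\<phi>0 \<in> Fm L {} (n + m)" "b \<in> tuples U m" "b' \<in> tuples U m"
      "tp L U b (univ M) = tp L U b' (univ M)" "inst n \<phi>0 b \<in> Fm L (univ U) n"
      "\<And>a. a \<in> tuples U n \<Longrightarrow> holds U \<phi> a \<longleftrightarrow> holds U (inst n \<phi>0 b) a"
    and M': "inst n \<phi>0 b' \<in> Fm L (univ M') n" by metis
  have "C \<phi> = Inv \<inter> \<Union>(cyl L U n ` \<Theta> (inst n \<phi>0 b'))"
    using C_representative[OF rep(1-4) assms rep(5,6)] C_eq[OF M'] by simp
  then show ?thesis using Inv_full(1) open_sets_\<nu>[OF open_\<Theta>] by auto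
qed

lemma FM_keisler: "keisler L U (univ U) n FM\<mu>"
  unfolding keisler_def fa_prob_def
proof (intro conjI ballI impI)
  show "FM\<mu> \<in> extensional (Fm L (univ U) n)" by (simp add: FM_def)
  show "0 \<le> FM\<mu> \<phi>" if "\<phi> \<in> Fm L (univ U) n" for \<phi> using that by (simp add: FM_eq)
  show "FM\<mu> \<phi> = FM\<mu> \<psi>" if \<phi>: "\<phi> \<in> Fm L (univ U) n" and \<psi>: "\<psi> \<in> Fm L (univ U) n"
    and eq: "\<forall>a\<in>tuples U n. holds U \<phi> a \<longleftrightarrow> holds U \<psi> a" for \<phi> \<psi>
  proof -
    have "\<phi> \<in> F\<^sub>M p \<longleftrightarrow> \<psi> \<in> F\<^sub>M p" if "p \<in> Inv" for p
      by (rule type_cong[OF F_type[OF that] \<phi> \<psi>]) (use eq in blast)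
    then have "C \<phi> = C \<psi>" by (auto simp: C_def)
    then show ?thesis using \<phi> \<psi> by (simp add: FM_eq)
  qed
  show "FM\<mu> \<phi> = 1" if \<phi>: "\<phi> \<in> Fm L (univ U) n" and all: "\<forall>a\<in>tuples U n. holds U \<phi> a" for \<phi>
  proof -
    have "\<phi> \<in> F\<^sub>M p" if "p \<in> Inv" for p
      by (rule type_consequence[OF F_type[OF that], of "{}"]) (use \<phi> all in auto)
    then have "C \<phi> = Inv" by (auto simp: C_def)
    then show ?thesis using \<phi> Inv_full by (simp add: FM_eq)
  qed
  show "FM\<mu> (Disj \<phi> \<psi>) = FM\<mu> \<phi> + FM\<mu> \<psi>" if \<phi>: "\<phi> \<in> Fm L (univ U) n" and \<psi>: "\<psi> \<in> Fm L (univ U) n"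
    and dis: "\<forall>a\<in>tuples U n. \<not> (holds U \<phi> a \<and> holds U \<psi> a)" for \<phi> \<psi>
  proof -
    have "C (Disj \<phi> \<psi>) = C \<phi> \<union> C \<psi>"
      using type_Disj[OF F_type \<phi> \<psi>] by (auto simp: C_def)
    moreover have "\<not> (\<phi> \<in> F\<^sub>M p \<and> \<psi> \<in> F\<^sub>M p)" if p: "p \<in> Inv" for p
    proof
      assume "\<phi> \<in> F\<^sub>M p \<and> \<psi> \<in> F\<^sub>M p"
      then have "{\<phi>, \<psi>} \<subseteq> F\<^sub>M p" by blast
      from type_sat[OF F_type[OF p] _ this] dis show False by auto
    qed
    then have "C \<phi> \<inter> C \<psi> = {}" by (auto simp: C_def)
    ultimately show ?thesis
      using \<nu>.finite_measure_Union[OF C_sets[OF \<phi>] C_sets[OF \<psi>]] \<phi> \<psi> by (simp add: FM_eq)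
  qed
qed

lemma FM_invariant: "invariant L U (univ M) n FM\<mu>"
  unfolding invariant_def
proof (intro allI ballI impI)
  fix m and \<phi> :: "('f, 'r, 'a) fm" and b b'
  assume *: "\<phi> \<in> Fm L {} (n + m)" "b \<in> tuples U m" "b' \<in> tuples U m"
    "tp L U b (univ M) = tp L U b' (univ M)"
  have i: "inst n \<phi> d \<in> Fm L (univ U) n" if "d \<in> tuples U m" for d
    by (rule inst_Fm[of _ _ "{}"]) (use * that in \<open>auto simp: tuples_def\<close>)
  have "C (inst n \<phi> b) = C (inst n \<phi> b')"
    by (rule C_representative[OF * i[OF *(2)] i[OF *(2)]]) simp
  then show "FM\<mu> (inst n \<phi> b) = FM\<mu> (inst n \<phi> b')"
    using i *(2,3) by (simp add: FM_eq)
qed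

text \<open>On invariant types, \<open>\<phi> \<in> F\<^sub>M(p)\<close> is witnessed by some \<open>\<theta> \<in> p\<^sub>|\<^sub>N\<close> with
  \<open>\<theta>(x) \<and> P(x) \<rightarrow> \<phi>(x)\<close>, and any \<open>\<Delta>\<close>-extension \<open>\<eta>\<close> of \<open>\<mu>\<^sub>|\<^sub>N\<close> concentrated on \<open>P\<close> gives
  \<open>\<phi>\<close> at least the measure \<open>\<mu>(\<theta>)\<close>. As the witnesses are closed under disjunction, regularity
  passes from single witnesses to their union.\<close>

lemma FM_le_delta:
  assumes \<eta>: "\<eta> \<in> delta_extensions L U PU N n \<mu>" and \<phi>: "\<phi> \<in> Fm L (univ M') n"
  shows "FM\<mu> \<phi> \<le> \<eta> (lift \<phi>)"
proof -
  let ?D = "Delta L (univ U) n"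
  interpret \<eta>: formula_charge "pair U PU" n ?D \<eta>
    using \<eta> by unfold_locales (auto simp: delta_extensions_def intro: Delta.intros)
  have \<phi>U: "\<phi> \<in> Fm L (univ U) n" by (rule Fm_mono[OF \<phi> subs(5) order_refl])
  have \<phi>D: "lift \<phi> \<in> ?D" using \<phi>U by (rule Delta.intros)
  have le: "\<mu> \<theta> \<le> \<eta> (lift \<phi>)" if \<theta>: "\<theta> \<in> \<Theta> \<phi>" for \<theta>
  proof -
    have \<theta>N: "\<theta> \<in> Fm L N n" using \<theta> by (simp add: \<Theta>_def)
    have "\<eta> (lift \<theta>) \<le> \<eta> (lift \<phi>)"
    proof (rule \<eta>.fa_mono_mod[where \<pi> = "Pfm n"])
      show "lift \<theta> \<in> ?D" using \<theta> \<Theta>_Fm by (intro Delta.intros) blast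
      show "Pfm n \<in> ?D" "\<eta> (Pfm n) = 1" using \<eta> by (auto simp: delta_extensions_def intro: Delta.intros)
      fix a assume a: "a \<in> tuples (pair U PU) n" "holds (pair U PU) (Pfm n) a" "holds (pair U PU) (lift \<theta>) a"
      show "holds (pair U PU) (lift \<phi>) a"
      proof (rule ccontr)
        assume no: "\<not> holds (pair U PU) (lift \<phi>) a"
        let ?\<xi> = "Conj (Pfm n) (Conj (lift \<theta>) (Neg (lift \<phi>)))"
        have "?\<xi> \<in> Fm (LP L) (univ (pair N' N)) n"
          using Fm_mono[OF \<theta>N N_sub order_refl] Fm_mono[OF \<phi> subs(3) order_refl] by simp
        moreover have "holds (pair U PU) ?\<xi> a" using a no by simp
        ultimately obtain c where c: "c \<in> tuples (pair N' N) n" "holds (pair N' N) ?\<xi> c"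
          using elem_sub_ex[OF N'U_pair _ a(1)] by metis
        then show False using \<theta> by (auto simp: \<Theta>_def tuples_def)
      qed
    qed (fact \<phi>D)
    moreover have "\<eta> (lift \<theta>) = \<mu> \<theta>" using \<eta> \<theta>N by (simp add: delta_extensions_def)
    ultimately show ?thesis by simp
  qed
  have sub: "cyl L U n ` \<Theta> \<phi> \<subseteq> cyl L U n ` Fm L (univ U) n" using \<Theta>_Fm by blast
  have "emeasure \<nu> (\<Union>(cyl L U n ` \<Theta> \<phi>)) \<le> ennreal (\<eta> (lift \<phi>))"
  proof (rule regular_Union_le[OF \<nu>_regular \<nu>_charge sub])
    fix F assume F: "finite F" "F \<subseteq> cyl L U n ` \<Theta> \<phi>"
    from finite_subset_image[OF F] obtain G where G: "G \<subseteq> \<Theta> \<phi>" "finite G" "F = cyl L U n ` G" by blast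
    have GN: "G \<subseteq> Fm L N n" using G(1) by (auto simp: \<Theta>_def)
    from Fm_finite_disj[OF G(2) GN] obtain \<theta> where \<theta>: "\<theta> \<in> Fm L N n"
      "\<And>K a. holds K \<theta> a \<longleftrightarrow> (\<exists>\<phi>\<in>G. holds K \<phi> a)" by metis
    have \<theta>U: "\<theta> \<in> Fm L (univ U) n" by (rule Fm_mono[OF \<theta>(1) subs(6) order_refl])
    have \<theta>\<Theta>: "\<theta> \<in> \<Theta> \<phi>" using \<theta> G(1) by (auto simp: \<Theta>_def)
    have "cyl L U n \<psi> \<subseteq> cyl L U n \<theta>" if "\<psi> \<in> G" for \<psi>
    proof -
      have "\<psi> \<in> Fm L (univ U) n" using that G(1) \<Theta>_Fm by blast
      then show ?thesis using cyl_subset_iff[OF _ \<theta>U] that by (auto simp: \<theta>(2))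
    qed
    then have "\<Union>F \<subseteq> cyl L U n \<theta>" using G(3) by blast
    moreover have "\<Union>F \<in> cyl L U n ` Fm L (univ U) n" using B_Union[OF F(1)] F(2) sub by blast
    ultimately have "cyl_charge L U n \<mu> (\<Union>F) \<le> cyl_charge L U n \<mu> (cyl L U n \<theta>)"
      using \<theta>U by (intro m_mono) auto
    also have "\<dots> = \<mu> \<theta>" using charge_cyl[OF \<theta>U] .
    finally show "cyl_charge L U n \<mu> (\<Union>F) \<le> \<eta> (lift \<phi>)" using le[OF \<theta>\<Theta>] by simp
  qed
  then have "measure \<nu> (\<Union>(cyl L U n ` \<Theta> \<phi>)) \<le> \<eta> (lift \<phi>)"
    using \<eta>.fa_nonneg[OF \<phi>D] by (simp add: \<nu>.emeasure_eq_measure)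
  moreover have "measure \<nu> (C \<phi>) \<le> measure \<nu> (\<Union>(cyl L U n ` \<Theta> \<phi>))"
    using open_sets_\<nu>[OF open_\<Theta>] by (intro \<nu>.finite_measure_mono) (auto simp: C_eq[OF \<phi>])
  ultimately show ?thesis using FM_eq[OF \<phi>U] by simp
qed

text \<open>The inequalities for \<open>\<phi>\<close> and for \<open>\<not>\<phi>\<close> add up to \<open>1 \<le> 1\<close>, so both are equalities.\<close>

lemma delta_eq_FM:
  assumes \<eta>: "\<eta> \<in> delta_extensions L U PU N n \<mu>" and \<phi>: "\<phi> \<in> Fm L (univ M') n"
  shows "\<eta> (lift \<phi>) = FM\<mu> \<phi>"
proof -
  interpret \<eta>: formula_charge "pair U PU" n "Delta L (univ U) n" \<eta>
    using \<eta> by unfold_locales (auto simp: delta_extensions_def intro: Delta.intros)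
  interpret FM: formula_charge U n "Fm L (univ U) n" FM\<mu>
    using FM_keisler by unfold_locales (auto simp: keisler_def)
  have \<phi>U: "\<phi> \<in> Fm L (univ U) n" by (rule Fm_mono[OF \<phi> subs(5) order_refl])
  have "FM\<mu> (Neg \<phi>) \<le> \<eta> (lift (Neg \<phi>))" by (rule FM_le_delta[OF \<eta>]) (simp add: \<phi>)
  then have "1 - FM\<mu> \<phi> \<le> 1 - \<eta> (lift \<phi>)"
    using \<eta>.fa_Neg[OF Delta.intros(1)[OF \<phi>U]] FM.fa_Neg[OF \<phi>U] by simp
  then show ?thesis using FM_le_delta[OF \<eta> \<phi>] by simp
qed

lemma invariant_measure_unique:
  assumes \<kappa>: "keisler L U (univ U) n \<kappa>" "invariant L U (univ M) n \<kappa>"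
    and \<kappa>': "keisler L U (univ U) n \<kappa>'" "invariant L U (univ M) n \<kappa>'"
    and eq: "\<And>\<phi>. \<phi> \<in> Fm L (univ M') n \<Longrightarrow> \<kappa> \<phi> = \<kappa>' \<phi>"
  shows "\<kappa> = \<kappa>'"
proof (rule extensionalityI[of _ "Fm L (univ U) n"])
  show "\<kappa> \<in> extensional (Fm L (univ U) n)" "\<kappa>' \<in> extensional (Fm L (univ U) n)"
    using \<kappa>(1) \<kappa>'(1) by (auto simp: keisler_def fa_prob_def)
  fix \<phi> assume \<phi>: "\<phi> \<in> Fm L (univ U) n"
  from invariant_representative[OF \<phi>] obtain m \<phi>0 b b' where
    rep: "\<phi>0 \<in> Fm L {} (n + m)" "b \<in> tuples U m" "b' \<in> tuples U m"
      "tp L U b (univ M) = tp L U b' (univ M)" "inst n \<phi>0 b \<in> Fm L (univ U) n"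
      "\<And>a. a \<in> tuples U n \<Longrightarrow> holds U \<phi> a \<longleftrightarrow> holds U (inst n \<phi>0 b) a"
    and M': "inst n \<phi>0 b' \<in> Fm L (univ M') n" by metis
  have rep_eq: "\<rho> \<phi> = \<rho> (inst n \<phi>0 b')" if \<rho>: "keisler L U (univ U) n \<rho>" "invariant L U (univ M) n \<rho>" for \<rho>
  proof -
    have "\<rho> \<phi> = \<rho> (inst n \<phi>0 b)"
      using \<rho>(1) \<phi> rep(5,6) unfolding keisler_def fa_prob_def by blast
    also have "\<dots> = \<rho> (inst n \<phi>0 b')" using \<rho>(2) rep(1-4) unfolding invariant_def by blast
    finally show ?thesis .
  qed
  show "\<kappa> \<phi> = \<kappa>' \<phi>" using rep_eq[OF \<kappa>] rep_eq[OF \<kappa>'] eq[OF M'] by (simp only:)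
qed

lemma FMt_eq_FM: "FMt L U M M' N PU n \<mu> = FM\<mu>"
proof -
  let ?r = "\<lambda>\<eta>. \<lambda>\<phi>\<in>Fm L (univ M') n. \<eta> (lift \<phi>)"
  have "?r \<eta> = restrict FM\<mu> (Fm L (univ M') n)" if "\<eta> \<in> delta_extensions L U PU N n \<mu>" for \<eta>
    using delta_eq_FM[OF that] by (intro restrict_ext)
  then have "?r ` delta_extensions L U PU N n \<mu> = {restrict FM\<mu> (Fm L (univ M') n)}"
    using delta_extensions_nonempty by auto
  then have the: "the_elem (?r ` delta_extensions L U PU N n \<mu>) = restrict FM\<mu> (Fm L (univ M') n)"
    by simp
  show ?thesis
    unfolding FMt_def the
  proof (rule the_equality)
    show "keisler L U (univ U) n FM\<mu> \<and> invariant L U (univ M) n FM\<mu> \<and>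
        restrict FM\<mu> (Fm L (univ M') n) = restrict FM\<mu> (Fm L (univ M') n)"
      using FM_keisler FM_invariant by simp
    fix \<kappa> assume \<kappa>: "keisler L U (univ U) n \<kappa> \<and> invariant L U (univ M) n \<kappa> \<and>
        restrict \<kappa> (Fm L (univ M') n) = restrict FM\<mu> (Fm L (univ M') n)"
    then have "\<kappa> \<phi> = FM\<mu> \<phi>" if "\<phi> \<in> Fm L (univ M') n" for \<phi>
      using that by (metis restrict_apply')
    then show "\<kappa> = FM\<mu>"
      using invariant_measure_unique[OF _ _ FM_keisler FM_invariant] \<kappa> by blast
  qed
qed

end

theorem theorem4p7:
  fixes L :: "('f, 'r) lang"
    and T :: "('f, 'r, 'a) fm set"
    and U M M' N' :: "('f, 'r, 'a) struct"
    and N PU :: "'a set"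
    and n :: nat
    and \<mu> :: "('f, 'r, 'a) fm \<Rightarrow> real"
  assumes "complete_theory L T" and "monster L T U" and "NIP L U"
    and "elem_sub L M U" and "small U (univ M)"
    and "elem_sub_plus L T M M'"
    and "N \<subseteq> univ N'" and "elem_sub_plus (LP L) T (pair M' (univ M)) (pair N' N)"
    and "small U (univ N')"
    and "PU \<subseteq> univ U" and "elem_sub (LP L) (pair N' N) (pair U PU)"
    and "keisler L U (univ U) n \<mu>" and "invariant L U (univ M) n \<mu>"
  shows "FMt L U M M' N PU n \<mu> = FM L U M M' N' N n \<mu>"
proof -
  interpret nip_pair_measure L T U M M' N' N PU n \<mu>
    by unfold_locales (fact assms)+
  show ?thesis by (rule FMt_eq_FM)
qed

end
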